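(* Let $V$, $V_1=V/W$, $\overline G$, $G$ be as in the context, and for $\alpha\in\mathbb C^n$ let $(\mathfrak L(V_1),\pi(\alpha))$ be the $G$-module $V_1\otimes\mathbb C[t_1^{\pm1},\dots,t_n^{\pm1}]$ defined there. (1) $(\mathfrak L(V_1),\pi(\alpha))$ is completely reducible as a $G$-module with finitely many irreducible components, and all the components are isomorphic as $G$-modules up to grade shift. (2) For a suitable $\alpha\in\mathbb C^n$, some irreducible component of $(\mathfrak L(V_1),\pi(\alpha))$ is isomorphic to $V$ as a $G$-module.
   Context: Everything is over $\mathbb{C}$. Let $\mathfrak g$ be a finite dimensional simple Lie algebra with a non-degenerate symmetric invariant bilinear form $(\cdot|\cdot)$. Let $n\ge 1$ and let $\sigma_0,\dots,\sigma_n$ be commuting automorphisms of $\mathfrak g$ of finite orders $m_0,\dots,m_n$; $\xi_i$ a primitive $m_i$-th root of unity. For $(k_0,k)\in\mathbb Z\times\mathbb Z^n$ put $\mathfrak g(\bar k_0,\bar k)=\{X\in\mathfrak g:\sigma_iX=\xi_i^{k_i}X,\ 0\le i\le n\}$. Write $t^k=t_1^{k_1}\cdots t_n^{k_n}$, $\Gamma_0=m_0\mathbb Z$, $\Gamma=m_1\mathbb Z\oplus\cdots\oplus m_n\mathbb Z$, $A(m)=\mathbb C[t_1^{\pm m_1},\dots,t_n^{\pm m_n}]$, $A_n=\mathbb C[t_1^{\pm1},\dots,t_n^{\pm1}]$. Standing assumption: $LT=\bigoplus_{(k_0,k)\in\mathbb Z^{n+1}}\mathfrak g(\bar k_0,\bar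 k)t_0^{k_0}t^k$ is a Lie torus, i.e. $\mathfrak g(\bar0,\bar0)$ is simple and, as a $\mathfrak g(\bar0,\bar0)$-module, each $\mathfrak g(\bar k_0,\bar k)$ is the direct sum of a trivial module and a module that is zero or irreducible with highest weight the highest root, or the highest short root (if the root system of $\mathfrak g(\bar0,\bar0)$ is not simply laced), or twice the highest short root (if it is of type $B_l$). Let $\mathfrak h(0)$ be a Cartan subalgebra of $\mathfrak g(\bar0,\bar0)$. Let $Z(m_0,m)$ be the span of symbols $t_0^{k_0}t^kK_i$, $(k_0,k)\in\Gamma_0\oplus\Gamma$, $0\le i\le n$, modulo the relations $\sum_{i=0}^nk_it_0^{k_0}t^kK_i=0$. $\overline{LT}=LT\oplus Z(m_0,m)$ has brackets $[X(k_0,k),Y(l_0,l)]=[X,Y](k_0+l_0,k+l)+(X|Y)\sum_{i=0}^nk_it_0^{k_0+l_0}t^{k+l}K_i$ with $Z(m_0,m)$ central, where $X(k_0,k)=X\otimes t_0^{k_0}t^k$. $\widetilde{LT}=\overline{LT}\oplus\mathrm{span}(d_0,\dots,d_n)$ where $d_i$ acts on the degree-$(k_0,k)$ part of $\overline{LT}$ as multiplication by $k_i$ and $[d_i,d_j]=0$. Put $D=\mathrm{span}(d_1,\dots,d_n)$, $\tilde{\mathfrak h}=\mathfrak h(0)\oplus\sum_i\mathbb CK_i\oplus\mathrm{span}(d_0,\dots,d_n)$. A weight module for $\widetilde{LT}$ is one that is the direct sum of finite dimensional $\tilde{\mathfrak h}$-weight spaces. The Lie algebra $\mathfrak L=LT\oplus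 (K\otimes A(m))\oplus\mathbb Cd_0$ has brackets $[X(k_0,k),Y(l_0,l)]=[X,Y](k_0+l_0,k+l)+(X|Y)\delta_{k_0+l_0,0}k_0K\otimes t^{k+l}$, $K\otimes A(m)$ central, $[d_0,X(k_0,k)]=k_0X(k_0,k)$; $\tilde{\mathfrak h}(0)=\mathfrak h(0)\oplus\mathbb CK\oplus\mathbb Cd_0$. A weight $\mathfrak L$-module is a direct sum of finite dimensional $\tilde{\mathfrak h}(0)$-weight spaces. Setting. $V$ is an irreducible weight $\widetilde{LT}$-module. A linear map $z:V\to V$ is a central operator of degree $(k_0,k)$ if it commutes with $\overline{LT}$ and $d_iz-zd_i=k_iz$ for $0\le i\le n$. It is assumed (as is arranged by a choice of coordinates when the center acts non-trivially) that every $t_0^{k_0}t^kK_i$ with $i\ne0$ or $k_0\neq0$ acts as $0$ on $V$, so that $V$ is an $\mathfrak L\oplus D$-module with $K\otimes t^k$ acting as $t^kK_0$; and that the subgroup $\langle S\rangle\subseteq\Gamma$ generated by $S=\{k: t^kK_0\ne0\text{ on }V\}$ equals $l_1\mathbb Z\oplus\cdots\oplus l_n\mathbb Z$ for positive integers $l_i$ with $m_i\mid l_i$. For $1\le i\le n$ fix a non-zero central operator $z_i$ of degree $(0,l_ie_i)$ ($e_i$ the standard basis of $\mathbb Z^n$); non-zero central operators are invertible, and those of a given degree are unique up to scalar. $W$ is a maximal $\mathfrak L$-submodule of $V$ containing $z_iv-v$ for all $v\in V$, $1\le i\le n$, such that $V_1=V/W$ is an irreducible weight $\mathfrak L$-module.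 $[S]$ is the span of all central operators on $V$ of degree $(0,s)$, $s\in\langle S\rangle$. $\overline G=LT+[S]+\mathbb Cd_0$ is the Lie algebra in which $[S]$ is central, $d_0$ acts by $t_0$-degree, and brackets in $LT$ are those of $\overline{LT}$ with the elements of $Z(m_0,m)$ replaced by the operators in $[S]$ by which they act on $V$. $G=\overline G\oplus D$, with $d_i$ ($1\le i\le n$) acting by $t_i$-degree. $V$ is an irreducible $G$-module and $V_1$ is an irreducible $\overline G$-module on which each $z_i$ acts as $1$. $\overline G=\bigoplus_{k\in\mathbb Z^n}\overline G_k$ is the grading by $D$. For $\alpha\in\mathbb C^n$, $(\mathfrak L(V_1),\pi(\alpha))$ is the $G$-module $\mathfrak L(V_1)=V_1\otimes A_n$ with, writing $v(r)=v\otimes t^r$: $X\cdot v(r)=(Xv)(r+k)$ for $X\in\overline G_k$ (in particular $d_0\cdot v(r)=(d_0v)(r)$), and $d_i\cdot v(r)=(r_i+\alpha_i)v(r)$, $1\le i\le n$. Two $G$-modules $M,M'$ are isomorphic up to grade shift if $M\cong M'\otimes\mathbb C_\gamma$ for some $\gamma\in\mathbb C^n$, where $\mathbb C_\gamma$ is the one dimensional $G$-module on which $\overline G$ acts by $0$ and $d_i$ acts by $\gamma_i$. *)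

theory Defs
  imports
    "HOL-Analysis.Finite_Cartesian_Product"
    "HOL-Library.Poly_Mapping"
    "HOL-Library.Function_Algebras"
    "HOL-Library.Product_Plus"
begin

section \<open>Complex vector spaces\<close>

class complex_vector_space = ab_group_add +
  fixes scaleC :: "complex \<Rightarrow> 'a \<Rightarrow> 'a" (infixr \<open>*\<^sub>C\<close> 75)
  assumes scaleC_add_right: "c *\<^sub>C (x + y) = c *\<^sub>C x + c *\<^sub>C y"
    and scaleC_add_left: "(c + d) *\<^sub>C x = c *\<^sub>C x + d *\<^sub>C x"
    and scaleC_scaleC: "c *\<^sub>C d *\<^sub>C x = (c * d) *\<^sub>C x"
    and scaleC_one: "1 *\<^sub>C x = x"

global_interpretation cvs: vector_space "scaleC :: complex \<Rightarrow> 'a \<Rightarrow> 'a::complex_vector_space"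
  by standard (simp_all add: scaleC_add_right scaleC_add_left scaleC_scaleC scaleC_one)

instantiation complex :: complex_vector_space
begin
definition scaleC_complex :: "complex \<Rightarrow> complex \<Rightarrow> complex" where "scaleC_complex c x = c * x"
instance by standard (simp_all add: scaleC_complex_def algebra_simps)
end

instantiation "fun" :: (type, complex_vector_space) complex_vector_space
begin
definition scaleC_fun :: "complex \<Rightarrow> ('a \<Rightarrow> 'b) \<Rightarrow> 'a \<Rightarrow> 'b" where
  "scaleC_fun c f = (\<lambda>x. c *\<^sub>C f x)"
instance
  by standard
    (simp_all add: scaleC_fun_def fun_eq_iff scaleC_add_right scaleC_add_left scaleC_scaleC scaleC_one)
end

instantiation prod :: (complex_vector_space, complex_vector_space) complex_vector_space
begin
definition scaleC_prod :: "complex \<Rightarrow> 'a \<times> 'b \<Rightarrow> 'a \<times> 'b" where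
  "scaleC_prod c x = (c *\<^sub>C fst x, c *\<^sub>C snd x)"
instance
  by standard
    (simp_all add: scaleC_prod_def prod_eq_iff scaleC_add_right scaleC_add_left scaleC_scaleC scaleC_one)
end

instantiation poly_mapping :: (type, complex_vector_space) complex_vector_space
begin
definition scaleC_poly_mapping :: "complex \<Rightarrow> ('a \<Rightarrow>\<^sub>0 'b) \<Rightarrow> 'a \<Rightarrow>\<^sub>0 'b" where
  "scaleC_poly_mapping c f = Poly_Mapping.map (scaleC c) f"
lemma lookup_scaleC: "Poly_Mapping.lookup (c *\<^sub>C f) k = c *\<^sub>C Poly_Mapping.lookup f k"
  by (simp add: scaleC_poly_mapping_def map.rep_eq when_def)
instance
  by standard
    (rule poly_mapping_eqI, simp add: lookup_scaleC lookup_add scaleC_add_right scaleC_add_left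
      scaleC_scaleC scaleC_one)+
end

definition finite_dim :: "'a::complex_vector_space set \<Rightarrow> bool" where
  "finite_dim M \<longleftrightarrow> (\<exists>B. finite B \<and> M \<subseteq> cvs.span B)"

definition linear_on :: "'a::complex_vector_space set \<Rightarrow> ('a \<Rightarrow> 'b::complex_vector_space) \<Rightarrow> bool" where
  "linear_on M f \<longleftrightarrow>
     (\<forall>x\<in>M. \<forall>y\<in>M. f (x + y) = f x + f y) \<and> (\<forall>c. \<forall>x\<in>M. f (c *\<^sub>C x) = c *\<^sub>C f x)"

definition internal_direct_sum :: "'a::complex_vector_space set \<Rightarrow> 'a set set \<Rightarrow> bool" where
  "internal_direct_sum M \<N> \<longleftrightarrow>
     (\<forall>N\<in>\<N>. cvs.subspace N) \<and> cvs.span (\<Union>\<N>) = M \<and>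
     (\<forall>N\<in>\<N>. N \<inter> cvs.span (\<Union>(\<N> - {N})) = {0})"

definition trace_on :: "'a::complex_vector_space set \<Rightarrow> ('a \<Rightarrow> 'a) \<Rightarrow> complex" where
  "trace_on M f = (let B = (SOME B. cvs.independent B \<and> cvs.span B = M)
     in \<Sum>b\<in>B. cvs.representation B (f b) b)"

text \<open>Functionals on a subspace \<open>H\<close> are extended by \<open>0\<close> outside \<open>H\<close>, so that equality of
  functionals on \<open>H\<close> is equality of functions and the operations are pointwise.\<close>

definition dual :: "'a::complex_vector_space set \<Rightarrow> ('a \<Rightarrow> complex) set" where
  "dual H = {\<phi>. linear_on H \<phi> \<and> (\<forall>x. x \<notin> H \<longrightarrow> \<phi> x = 0)}"


section \<open>Lie algebras and their modules\<close>

record 'a lie_alg =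
  car :: "'a set"
  bk :: "'a \<Rightarrow> 'a \<Rightarrow> 'a"

definition lie_algebra :: "'a::complex_vector_space lie_alg \<Rightarrow> bool" where
  "lie_algebra A \<longleftrightarrow>
     cvs.subspace (car A) \<and>
     (\<forall>x\<in>car A. \<forall>y\<in>car A. bk A x y \<in> car A) \<and>
     (\<forall>x\<in>car A. linear_on (car A) (bk A x) \<and> linear_on (car A) (\<lambda>y. bk A y x)) \<and>
     (\<forall>x\<in>car A. bk A x x = 0) \<and>
     (\<forall>x\<in>car A. \<forall>y\<in>car A. \<forall>z\<in>car A.
        bk A x (bk A y z) + bk A y (bk A z x) + bk A z (bk A x y) = 0)"

definition lie_ideal :: "'a::complex_vector_space lie_alg \<Rightarrow> 'a set \<Rightarrow> bool" where
  "lie_ideal A I \<longleftrightarrow> cvs.subspace I \<and> I \<subseteq> car A \<and> (\<forall>x\<in>car A. \<forall>y\<in>I. bk A x y \<in> I)"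

definition simple_lie_algebra :: "'a::complex_vector_space lie_alg \<Rightarrow> bool" where
  "simple_lie_algebra A \<longleftrightarrow>
     lie_algebra A \<and> (\<exists>x\<in>car A. \<exists>y\<in>car A. bk A x y \<noteq> 0) \<and>
     (\<forall>I. lie_ideal A I \<longrightarrow> I = {0} \<or> I = car A)"

primrec lower_central :: "'a::complex_vector_space lie_alg \<Rightarrow> nat \<Rightarrow> 'a set" where
  "lower_central A 0 = car A"
| "lower_central A (Suc j) = cvs.span {bk A x y | x y. x \<in> car A \<and> y \<in> lower_central A j}"

definition cartan_subalgebra :: "'a::complex_vector_space lie_alg \<Rightarrow> 'a set \<Rightarrow> bool" where
  "cartan_subalgebra A H \<longleftrightarrow>
     H \<subseteq> car A \<and> lie_algebra (A\<lparr>car := H\<rparr>) \<and>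
     (\<exists>j. lower_central (A\<lparr>car := H\<rparr>) j = {0}) \<and>
     {x \<in> car A. \<forall>h\<in>H. bk A x h \<in> H} = H"

definition lie_module ::
  "'a::complex_vector_space lie_alg \<Rightarrow> 'v::complex_vector_space set \<Rightarrow> ('a \<Rightarrow> 'v \<Rightarrow> 'v) \<Rightarrow> bool" where
  "lie_module A M \<rho> \<longleftrightarrow>
     cvs.subspace M \<and>
     (\<forall>x\<in>car A. \<forall>v\<in>M. \<rho> x v \<in> M) \<and>
     (\<forall>x\<in>car A. linear_on M (\<rho> x)) \<and>
     (\<forall>v\<in>M. linear_on (car A) (\<lambda>x. \<rho> x v)) \<and>
     (\<forall>x\<in>car A. \<forall>y\<in>car A. \<forall>v\<in>M. \<rho> (bk A x y) v = \<rho> x (\<rho> y v) - \<rho> y (\<rho> x v))"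

definition submodule ::
  "'a::complex_vector_space lie_alg \<Rightarrow> 'v::complex_vector_space set \<Rightarrow> ('a \<Rightarrow> 'v \<Rightarrow> 'v) \<Rightarrow> 'v set \<Rightarrow> bool" where
  "submodule A M \<rho> N \<longleftrightarrow> cvs.subspace N \<and> N \<subseteq> M \<and> (\<forall>x\<in>car A. \<forall>v\<in>N. \<rho> x v \<in> N)"

definition irreducible_module ::
  "'a::complex_vector_space lie_alg \<Rightarrow> 'v::complex_vector_space set \<Rightarrow> ('a \<Rightarrow> 'v \<Rightarrow> 'v) \<Rightarrow> bool" where
  "irreducible_module A M \<rho> \<longleftrightarrow>
     lie_module A M \<rho> \<and> M \<noteq> {0} \<and> (\<forall>N. submodule A M \<rho> N \<longrightarrow> N = {0} \<or> N = M)"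

definition maximal_submodule ::
  "'a::complex_vector_space lie_alg \<Rightarrow> 'v::complex_vector_space set \<Rightarrow> ('a \<Rightarrow> 'v \<Rightarrow> 'v) \<Rightarrow> 'v set \<Rightarrow> bool" where
  "maximal_submodule A M \<rho> W \<longleftrightarrow>
     submodule A M \<rho> W \<and> W \<noteq> M \<and> (\<forall>N. submodule A M \<rho> N \<and> W \<subseteq> N \<longrightarrow> N = W \<or> N = M)"

definition weight_space ::
  "'a::complex_vector_space set \<Rightarrow> 'v::complex_vector_space set \<Rightarrow> ('a \<Rightarrow> 'v \<Rightarrow> 'v) \<Rightarrow> ('a \<Rightarrow> complex) \<Rightarrow> 'v set" where
  "weight_space H M \<rho> \<phi> = {v \<in> M. \<forall>h\<in>H. \<rho> h v = \<phi> h *\<^sub>C v}"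

definition weight_module ::
  "'a::complex_vector_space set \<Rightarrow> 'v::complex_vector_space set \<Rightarrow> ('a \<Rightarrow> 'v \<Rightarrow> 'v) \<Rightarrow> bool" where
  "weight_module H M \<rho> \<longleftrightarrow>
     internal_direct_sum M (weight_space H M \<rho> ` dual H) \<and>
     (\<forall>\<phi>\<in>dual H. finite_dim (weight_space H M \<rho> \<phi>))"

definition irreducible_decomposition ::
  "'a::complex_vector_space lie_alg \<Rightarrow> 'v::complex_vector_space set \<Rightarrow> ('a \<Rightarrow> 'v \<Rightarrow> 'v) \<Rightarrow> 'v set set \<Rightarrow> bool" where
  "irreducible_decomposition A M \<rho> \<N> \<longleftrightarrow>
     internal_direct_sum M \<N> \<and> (\<forall>N\<in>\<N>. irreducible_module A N \<rho>)"

definition completely_reducible ::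
  "'a::complex_vector_space lie_alg \<Rightarrow> 'v::complex_vector_space set \<Rightarrow> ('a \<Rightarrow> 'v \<Rightarrow> 'v) \<Rightarrow> bool" where
  "completely_reducible A M \<rho> \<longleftrightarrow> lie_module A M \<rho> \<and> (\<exists>\<N>. irreducible_decomposition A M \<rho> \<N>)"

definition irreducible_component ::
  "'a::complex_vector_space lie_alg \<Rightarrow> 'v::complex_vector_space set \<Rightarrow> ('a \<Rightarrow> 'v \<Rightarrow> 'v) \<Rightarrow> 'v set \<Rightarrow> bool" where
  "irreducible_component A M \<rho> N \<longleftrightarrow> (\<exists>\<N>. irreducible_decomposition A M \<rho> \<N> \<and> N \<in> \<N>)"

definition module_iso ::
  "'a::complex_vector_space lie_alg \<Rightarrow>
   'v::complex_vector_space set \<Rightarrow> ('a \<Rightarrow> 'v \<Rightarrow> 'v) \<Rightarrow>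
   'w::complex_vector_space set \<Rightarrow> ('a \<Rightarrow> 'w \<Rightarrow> 'w) \<Rightarrow> bool" where
  "module_iso A M \<rho> M' \<rho>' \<longleftrightarrow>
     (\<exists>f. linear_on M f \<and> bij_betw f M M' \<and> (\<forall>x\<in>car A. \<forall>v\<in>M. f (\<rho> x v) = \<rho>' x (f v)))"


section \<open>Root systems\<close>

definition root_space :: "'a::complex_vector_space lie_alg \<Rightarrow> 'a set \<Rightarrow> ('a \<Rightarrow> complex) \<Rightarrow> 'a set" where
  "root_space A H \<alpha> = weight_space H (car A) (bk A) \<alpha>"

definition roots :: "'a::complex_vector_space lie_alg \<Rightarrow> 'a set \<Rightarrow> ('a \<Rightarrow> complex) set" where
  "roots A H = {\<alpha> \<in> dual H. \<alpha> \<noteq> 0 \<and> root_space A H \<alpha> \<noteq> {0}}"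

definition nonneg_comb :: "('a \<Rightarrow> complex) set \<Rightarrow> ('a \<Rightarrow> complex) \<Rightarrow> bool" where
  "nonneg_comb \<Delta> \<beta> \<longleftrightarrow> (\<exists>c :: _ \<Rightarrow> nat. \<beta> = (\<Sum>\<alpha>\<in>\<Delta>. of_nat (c \<alpha>) *\<^sub>C \<alpha>))"

definition root_base ::
  "'a::complex_vector_space lie_alg \<Rightarrow> 'a set \<Rightarrow> ('a \<Rightarrow> complex) set \<Rightarrow> bool" where
  "root_base A H \<Delta> \<longleftrightarrow>
     finite \<Delta> \<and> \<Delta> \<subseteq> roots A H \<and> cvs.independent \<Delta> \<and>
     (\<forall>\<beta>\<in>roots A H. nonneg_comb \<Delta> \<beta> \<or> nonneg_comb \<Delta> (- \<beta>))"

definition killing :: "'a::complex_vector_space lie_alg \<Rightarrow> 'a \<Rightarrow> 'a \<Rightarrow> complex" where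
  "killing A x y = trace_on (car A) (\<lambda>z. bk A x (bk A y z))"

text \<open>The form on the dual of \<open>H\<close> transported from the Killing form. Its values on roots are
  positive rationals for a simple Lie algebra, so \<open>Re\<close> below loses nothing.\<close>

definition dual_form ::
  "'a::complex_vector_space lie_alg \<Rightarrow> 'a set \<Rightarrow> ('a \<Rightarrow> complex) \<Rightarrow> ('a \<Rightarrow> complex) \<Rightarrow> complex" where
  "dual_form A H \<alpha> \<beta> = \<beta> (THE t. t \<in> H \<and> (\<forall>h\<in>H. killing A t h = \<alpha> h))"

definition root_length2 ::
  "'a::complex_vector_space lie_alg \<Rightarrow> 'a set \<Rightarrow> ('a \<Rightarrow> complex) \<Rightarrow> real" where
  "root_length2 A H \<alpha> = Re (dual_form A H \<alpha> \<alpha>)"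

definition simply_laced :: "'a::complex_vector_space lie_alg \<Rightarrow> 'a set \<Rightarrow> bool" where
  "simply_laced A H \<longleftrightarrow>
     (\<forall>\<alpha>\<in>roots A H. \<forall>\<beta>\<in>roots A H. root_length2 A H \<alpha> = root_length2 A H \<beta>)"

text \<open>Short roots are the roots of minimal length, so in the simply laced case all roots are short.
  This matters only for \<open>B\<^sub>1 = A\<^sub>1\<close>, where twice the root is admitted as in the twisted
  affine algebra of type \<open>A\<^sub>2\<close>.\<close>

definition short_roots :: "'a::complex_vector_space lie_alg \<Rightarrow> 'a set \<Rightarrow> ('a \<Rightarrow> complex) set" where
  "short_roots A H =
     {\<alpha> \<in> roots A H. \<forall>\<beta>\<in>roots A H. root_length2 A H \<alpha> \<le> root_length2 A H \<beta>}"

definition highest_in :: "('a \<Rightarrow> complex) set \<Rightarrow> ('a \<Rightarrow> complex) set \<Rightarrow> ('a \<Rightarrow> complex) \<Rightarrow> bool" where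
  "highest_in \<Delta> R \<theta> \<longleftrightarrow> \<theta> \<in> R \<and> (\<forall>\<beta>\<in>R. nonneg_comb \<Delta> (\<theta> - \<beta>))"

text \<open>The standard model of \<open>B\<^sub>l\<close>, with roots \<open>\<plusminus>\<epsilon>\<^sub>i\<close> and \<open>\<plusminus>\<epsilon>\<^sub>i\<plusminus>\<epsilon>\<^sub>j\<close> for \<open>i \<noteq> j\<close>.\<close>

definition type_B :: "'a::complex_vector_space lie_alg \<Rightarrow> 'a set \<Rightarrow> bool" where
  "type_B A H \<longleftrightarrow>
     (\<exists>l\<ge>1. \<exists>\<epsilon> :: nat \<Rightarrow> 'a \<Rightarrow> complex.
        inj_on \<epsilon> {..<l} \<and> cvs.independent (\<epsilon> ` {..<l}) \<and>
        roots A H =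
          {s *\<^sub>C \<epsilon> i | s i. s \<in> {1, -1} \<and> i < l} \<union>
          {s *\<^sub>C \<epsilon> i + t *\<^sub>C \<epsilon> j | s t i j. s \<in> {1, -1} \<and> t \<in> {1, -1} \<and> i < l \<and> j < l \<and> i \<noteq> j})"

definition has_highest_weight ::
  "'a::complex_vector_space lie_alg \<Rightarrow> 'a set \<Rightarrow> ('a \<Rightarrow> complex) set \<Rightarrow>
   'v::complex_vector_space set \<Rightarrow> ('a \<Rightarrow> 'v \<Rightarrow> 'v) \<Rightarrow> ('a \<Rightarrow> complex) \<Rightarrow> bool" where
  "has_highest_weight A H \<Delta> M \<rho> \<phi> \<longleftrightarrow>
     (\<exists>v\<in>weight_space H M \<rho> \<phi>. v \<noteq> 0 \<and>
        (\<forall>\<alpha>\<in>roots A H. nonneg_comb \<Delta> \<alpha> \<longrightarrow> (\<forall>x\<in>root_space A H \<alpha>. \<rho> x v = 0)))"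


section \<open>Lie tori\<close>

text \<open>A degree is a pair \<open>(k\<^sub>0, k)\<close>. The index set \<open>{0,\<dots>,n}\<close> is \<open>'n option\<close>: \<open>None\<close> is the index
  \<open>0\<close>, and \<open>Some i\<close> with \<open>i :: 'n\<close> are the indices \<open>1,\<dots>,n\<close>.\<close>

type_synonym 'n deg = "int \<times> (int ^ 'n)"

definition coord :: "'n::finite deg \<Rightarrow> 'n option \<Rightarrow> int" where
  "coord \<kappa> i = (case i of None \<Rightarrow> fst \<kappa> | Some j \<Rightarrow> snd \<kappa> $ j)"

text \<open>The eigenvalue of the derivation \<open>\<Sum>\<^sub>i a\<^sub>i d\<^sub>i\<close> in degree \<open>\<kappa>\<close>.\<close>

definition pairing :: "('n::finite option \<Rightarrow> complex) \<Rightarrow> 'n deg \<Rightarrow> complex" where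
  "pairing a \<kappa> = (\<Sum>i\<in>UNIV. a i * of_int (coord \<kappa> i))"

definition dcoef :: "'n option \<Rightarrow> 'n option \<Rightarrow> complex" where
  "dcoef i = (\<lambda>j. if j = i then 1 else 0)"

record ('g, 'n) torus_data =
  gbr :: "'g \<Rightarrow> 'g \<Rightarrow> 'g"
  gform :: "'g \<Rightarrow> 'g \<Rightarrow> complex"
  aut :: "'n option \<Rightarrow> 'g \<Rightarrow> 'g"
  per :: "'n option \<Rightarrow> nat"
  zeta :: "'n option \<Rightarrow> complex"
  h0 :: "'g set"

definition galg :: "('g::complex_vector_space, 'n::finite) torus_data \<Rightarrow> 'g lie_alg" where
  "galg T = \<lparr>car = UNIV, bk = gbr T\<rparr>"

definition gdeg :: "('g::complex_vector_space, 'n::finite) torus_data \<Rightarrow> 'n deg \<Rightarrow> 'g set" where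
  "gdeg T \<kappa> = {X. \<forall>i. aut T i X = (zeta T i powi coord \<kappa> i) *\<^sub>C X}"

definition g00 :: "('g::complex_vector_space, 'n::finite) torus_data \<Rightarrow> 'g lie_alg" where
  "g00 T = \<lparr>car = gdeg T 0, bk = gbr T\<rparr>"

definition invariant_form :: "('g::complex_vector_space, 'n::finite) torus_data \<Rightarrow> bool" where
  "invariant_form T \<longleftrightarrow>
     (\<forall>x. linear_on UNIV (gform T x)) \<and>
     (\<forall>x y. gform T x y = gform T y x) \<and>
     (\<forall>x y z. gform T (gbr T x y) z = gform T x (gbr T y z)) \<and>
     (\<forall>x. (\<forall>y. gform T x y = 0) \<longrightarrow> x = 0)"

definition commuting_automorphisms :: "('g::complex_vector_space, 'n::finite) torus_data \<Rightarrow> bool" where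
  "commuting_automorphisms T \<longleftrightarrow>
     (\<forall>i. linear_on UNIV (aut T i) \<and> bij (aut T i) \<and>
          (\<forall>x y. aut T i (gbr T x y) = gbr T (aut T i x) (aut T i y))) \<and>
     (\<forall>i j. aut T i \<circ> aut T j = aut T j \<circ> aut T i) \<and>
     (\<forall>i. per T i > 0 \<and> aut T i ^^ per T i = id \<and> (\<forall>j. 0 < j \<and> j < per T i \<longrightarrow> aut T i ^^ j \<noteq> id)) \<and>
     (\<forall>i. zeta T i ^ per T i = 1 \<and> (\<forall>j. 0 < j \<and> j < per T i \<longrightarrow> zeta T i ^ j \<noteq> 1))"

definition lie_torus :: "('g::complex_vector_space, 'n::finite) torus_data \<Rightarrow> bool" where
  "lie_torus T \<longleftrightarrow>
     simple_lie_algebra (g00 T) \<and>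
     cartan_subalgebra (g00 T) (h0 T) \<and>
     (\<exists>\<Delta>. root_base (g00 T) (h0 T) \<Delta> \<and>
        (\<forall>\<kappa>. \<exists>U M.
           submodule (g00 T) (gdeg T \<kappa>) (gbr T) U \<and> submodule (g00 T) (gdeg T \<kappa>) (gbr T) M \<and>
           U \<inter> M = {0} \<and> cvs.span (U \<union> M) = gdeg T \<kappa> \<and>
           (\<forall>x\<in>car (g00 T). \<forall>u\<in>U. gbr T x u = 0) \<and>
           (M = {0} \<or>
            irreducible_module (g00 T) M (gbr T) \<and>
            (\<exists>\<phi>. has_highest_weight (g00 T) (h0 T) \<Delta> M (gbr T) \<phi> \<and>
               (highest_in \<Delta> (roots (g00 T) (h0 T)) \<phi> \<or>
                \<not> simply_laced (g00 T) (h0 T) \<and> highest_in \<Delta> (short_roots (g00 T) (h0 T)) \<phi> \<or>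
                type_B (g00 T) (h0 T) \<and>
                  (\<exists>\<theta>. highest_in \<Delta> (short_roots (g00 T) (h0 T)) \<theta> \<and> \<phi> = 2 *\<^sub>C \<theta>))))))"

text \<open>Elements of \<open>LT\<close> are finitely supported functions on degrees.\<close>

definition LT :: "('g::complex_vector_space, 'n::finite) torus_data \<Rightarrow> ('n deg \<Rightarrow>\<^sub>0 'g) set" where
  "LT T = {X. \<forall>\<kappa>. Poly_Mapping.lookup X \<kappa> \<in> gdeg T \<kappa>}"

definition LT_br ::
  "('g::complex_vector_space, 'n::finite) torus_data \<Rightarrow>
   ('n deg \<Rightarrow>\<^sub>0 'g) \<Rightarrow> ('n deg \<Rightarrow>\<^sub>0 'g) \<Rightarrow> ('n deg \<Rightarrow>\<^sub>0 'g)" where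
  "LT_br T X Y = (\<Sum>\<kappa>\<in>Poly_Mapping.keys X. \<Sum>\<mu>\<in>Poly_Mapping.keys Y.
     Poly_Mapping.single (\<kappa> + \<mu>) (gbr T (Poly_Mapping.lookup X \<kappa>) (Poly_Mapping.lookup Y \<mu>)))"

definition LT_der ::
  "('n::finite option \<Rightarrow> complex) \<Rightarrow> ('n deg \<Rightarrow>\<^sub>0 'g::complex_vector_space) \<Rightarrow> ('n deg \<Rightarrow>\<^sub>0 'g)" where
  "LT_der a X = Poly_Mapping.mapp (\<lambda>\<kappa> x. pairing a \<kappa> *\<^sub>C x) X"


subsection \<open>The centre\<close>

text \<open>\<open>'n kahler\<close> is the span of the symbols \<open>t\<^sub>0\<^bsup>k\<^sub>0\<^esup> t\<^bsup>k\<^esup> K\<^sub>i\<close> over all degrees, modulo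
  \<open>\<Sum>\<^sub>i k\<^sub>i t\<^sub>0\<^bsup>k\<^sub>0\<^esup> t\<^bsup>k\<^esup> K\<^sub>i = 0\<close>. Each relation lives in a single degree, so \<open>Z(m\<^sub>0,m)\<close> is the
  subspace spanned by the symbols with degree in \<open>\<Gamma>\<^sub>0 \<oplus> \<Gamma>\<close>.\<close>

definition kahler_rel :: "'n::finite deg \<Rightarrow> (('n deg \<times> 'n option) \<Rightarrow>\<^sub>0 complex)" where
  "kahler_rel \<kappa> = (\<Sum>i\<in>UNIV. Poly_Mapping.single (\<kappa>, i) (of_int (coord \<kappa> i)))"

quotient_type (overloaded) 'n kahler =
  "('n::finite deg \<times> 'n option) \<Rightarrow>\<^sub>0 complex" / "\<lambda>x y. x - y \<in> cvs.span (range kahler_rel)"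
  morphisms rep_kahler abs_kahler
proof (intro equivpI reflpI sympI transpI)
  fix x y z :: "('n deg \<times> 'n option) \<Rightarrow>\<^sub>0 complex"
  show "x - x \<in> cvs.span (range kahler_rel)" by (simp add: cvs.span_zero)
  show "y - x \<in> cvs.span (range kahler_rel)" if "x - y \<in> cvs.span (range kahler_rel)"
    using cvs.span_neg[OF that] by simp
  show "x - z \<in> cvs.span (range kahler_rel)"
    if "x - y \<in> cvs.span (range kahler_rel)" "y - z \<in> cvs.span (range kahler_rel)"
    using cvs.span_add[OF that] by simp
qed

instantiation kahler :: (finite) complex_vector_space
begin

lift_definition zero_kahler :: "'a kahler" is 0 .

lift_definition plus_kahler :: "'a kahler \<Rightarrow> 'a kahler \<Rightarrow> 'a kahler" is "(+)"
proof -
  fix a b c d :: "('a deg \<times> 'a option) \<Rightarrow>\<^sub>0 complex"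
  assume "a - b \<in> cvs.span (range kahler_rel)" "c - d \<in> cvs.span (range kahler_rel)"
  then have "(a - b) + (c - d) \<in> cvs.span (range kahler_rel)" by (rule cvs.span_add)
  then show "(a + c) - (b + d) \<in> cvs.span (range kahler_rel)" by (simp add: algebra_simps)
qed

lift_definition minus_kahler :: "'a kahler \<Rightarrow> 'a kahler \<Rightarrow> 'a kahler" is "(-)"
proof -
  fix a b c d :: "('a deg \<times> 'a option) \<Rightarrow>\<^sub>0 complex"
  assume "a - b \<in> cvs.span (range kahler_rel)" "c - d \<in> cvs.span (range kahler_rel)"
  then have "(a - b) - (c - d) \<in> cvs.span (range kahler_rel)" by (rule cvs.span_diff)
  then show "(a - c) - (b - d) \<in> cvs.span (range kahler_rel)" by (simp add: algebra_simps)
qed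

lift_definition uminus_kahler :: "'a kahler \<Rightarrow> 'a kahler" is "uminus"
proof -
  fix a b :: "('a deg \<times> 'a option) \<Rightarrow>\<^sub>0 complex"
  assume "a - b \<in> cvs.span (range kahler_rel)"
  then have "- (a - b) \<in> cvs.span (range kahler_rel)" by (rule cvs.span_neg)
  then show "(- a) - (- b) \<in> cvs.span (range kahler_rel)" by (simp add: algebra_simps)
qed

lift_definition scaleC_kahler :: "complex \<Rightarrow> 'a kahler \<Rightarrow> 'a kahler" is "scaleC"
proof -
  fix c and a b :: "('a deg \<times> 'a option) \<Rightarrow>\<^sub>0 complex"
  assume "a - b \<in> cvs.span (range kahler_rel)"
  then have "c *\<^sub>C (a - b) \<in> cvs.span (range kahler_rel)" by (rule cvs.span_scale)
  then show "c *\<^sub>C a - c *\<^sub>C b \<in> cvs.span (range kahler_rel)"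
    by (simp add: cvs.scale_right_diff_distrib)
qed

instance
proof
  fix a b c :: "'a kahler" and r s :: complex
  show "a + b + c = a + (b + c)" by transfer (simp add: add.assoc cvs.span_zero)
  show "a + b = b + a" by transfer (simp add: add.commute cvs.span_zero)
  show "0 + a = a" by transfer (simp add: cvs.span_zero)
  show "- a + a = 0" by transfer (simp add: cvs.span_zero)
  show "a - b = a + - b" by transfer (simp add: cvs.span_zero)
  show "r *\<^sub>C (a + b) = r *\<^sub>C a + r *\<^sub>C b" by transfer (simp add: scaleC_add_right cvs.span_zero)
  show "(r + s) *\<^sub>C a = r *\<^sub>C a + s *\<^sub>C a" by transfer (simp add: scaleC_add_left cvs.span_zero)
  show "r *\<^sub>C s *\<^sub>C a = (r * s) *\<^sub>C a" by transfer (simp add: scaleC_scaleC cvs.span_zero)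
  show "1 *\<^sub>C a = a" by transfer (simp add: scaleC_one cvs.span_zero)
qed

end

lift_definition tK :: "'n::finite deg \<Rightarrow> 'n option \<Rightarrow> 'n kahler" is
  "\<lambda>\<kappa> i. Poly_Mapping.single (\<kappa>, i) 1" .

lemma lookup_kahler_rel:
  "Poly_Mapping.lookup (kahler_rel \<kappa>) q = (if fst q = \<kappa> then of_int (coord \<kappa> (snd q)) else 0)"
proof (cases q)
  case (Pair \<mu> j)
  show ?thesis
    by (cases "\<mu> = \<kappa>")
      (simp_all add: Pair kahler_rel_def lookup_sum lookup_single when_def)
qed

lemma lookup_degree_mult:
  "Poly_Mapping.lookup (Poly_Mapping.mapp (\<lambda>(\<kappa>, i) x. pairing a \<kappa> * x) f) p =
   pairing a (fst p) * Poly_Mapping.lookup f p"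
  by (simp add: mapp.rep_eq when_def in_keys_iff split: prod.splits)

lift_definition kahler_der :: "('n::finite option \<Rightarrow> complex) \<Rightarrow> 'n kahler \<Rightarrow> 'n kahler" is
  "\<lambda>a. Poly_Mapping.mapp (\<lambda>(\<kappa>, i) x. pairing a \<kappa> * x)"
proof -
  fix a and f g :: "('n deg \<times> 'n option) \<Rightarrow>\<^sub>0 complex"
  let ?D = "Poly_Mapping.mapp (\<lambda>(\<kappa>, i) x. pairing a \<kappa> * x)
    :: (('n deg \<times> 'n option) \<Rightarrow>\<^sub>0 complex) \<Rightarrow> (('n deg \<times> 'n option) \<Rightarrow>\<^sub>0 complex)"
  assume "f - g \<in> cvs.span (range kahler_rel)"
  then have "?D (f - g) \<in> cvs.span (range kahler_rel)"
  proof (induction rule: cvs.span_induct_alt)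
    case base
    have "?D 0 = 0" by (rule poly_mapping_eqI) (simp add: lookup_degree_mult)
    then show ?case by (simp add: cvs.span_zero)
  next
    case (step c x y)
    then obtain \<kappa> where x: "x = kahler_rel \<kappa>" by auto
    have "?D (c *\<^sub>C x + y) = (c * pairing a \<kappa>) *\<^sub>C kahler_rel \<kappa> + ?D y"
    proof (rule poly_mapping_eqI)
      fix p
      show "Poly_Mapping.lookup (?D (c *\<^sub>C x + y)) p =
            Poly_Mapping.lookup ((c * pairing a \<kappa>) *\<^sub>C kahler_rel \<kappa> + ?D y) p"
        by (simp only: lookup_add lookup_degree_mult lookup_scaleC x lookup_kahler_rel)
          (simp add: scaleC_complex_def distrib_left)
    qed
    with step(2) show ?case
      by (simp add: cvs.span_add cvs.span_scale cvs.span_base)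
  qed
  also have "?D (f - g) = ?D f - ?D g"
    by (rule poly_mapping_eqI) (simp only: lookup_degree_mult lookup_minus right_diff_distrib)
  finally show "?D f - ?D g \<in> cvs.span (range kahler_rel)" .
qed

definition in_lattice :: "('g, 'n::finite) torus_data \<Rightarrow> 'n deg \<Rightarrow> bool" where
  "in_lattice T \<kappa> \<longleftrightarrow> (\<forall>i. int (per T i) dvd coord \<kappa> i)"

definition ZZ :: "('g, 'n::finite) torus_data \<Rightarrow> 'n kahler set" where
  "ZZ T = cvs.span {tK \<kappa> i | \<kappa> i. in_lattice T \<kappa>}"

text \<open>\<open>Z(m\<^sub>0,m)\<close> has symbols only in degrees in \<open>\<Gamma>\<^sub>0 \<oplus> \<Gamma>\<close>. For the other values of \<open>\<kappa> + \<mu>\<close> the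
  form vanishes on the homogeneous components of degrees \<open>\<kappa>\<close> and \<open>\<mu>\<close>, and the central term is read
  as \<open>0\<close>.\<close>

definition LT_cocycle ::
  "('g::complex_vector_space, 'n::finite) torus_data \<Rightarrow>
   ('n deg \<Rightarrow>\<^sub>0 'g) \<Rightarrow> ('n deg \<Rightarrow>\<^sub>0 'g) \<Rightarrow> 'n kahler" where
  "LT_cocycle T X Y = (\<Sum>\<kappa>\<in>Poly_Mapping.keys X. \<Sum>\<mu>\<in>Poly_Mapping.keys Y.
     if in_lattice T (\<kappa> + \<mu>)
     then gform T (Poly_Mapping.lookup X \<kappa>) (Poly_Mapping.lookup Y \<mu>) *\<^sub>C
       (\<Sum>i\<in>UNIV. of_int (coord \<kappa> i) *\<^sub>C tK (\<kappa> + \<mu>) i)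
     else 0)"


subsection \<open>The algebra \<open>LTt\<close> with all derivations, and the algebra \<open>LL\<close>\<close>

text \<open>\<open>(X, z, a)\<close> stands for \<open>X + z + \<Sum>\<^sub>i a\<^sub>i d\<^sub>i\<close>.\<close>

type_synonym ('g, 'n) LTt_elem = "('n deg \<Rightarrow>\<^sub>0 'g) \<times> 'n kahler \<times> ('n option \<Rightarrow> complex)"

definition LTt :: "('g::complex_vector_space, 'n::finite) torus_data \<Rightarrow> ('g, 'n) LTt_elem lie_alg" where
  "LTt T = \<lparr>car = LT T \<times> ZZ T \<times> UNIV,
     bk = (\<lambda>(X, z, a) (Y, w, b).
       (LT_br T X Y + LT_der a Y - LT_der b X,
        LT_cocycle T X Y + kahler_der a w - kahler_der b z,
        0))\<rparr>"

definition htilde :: "('g::complex_vector_space, 'n::finite) torus_data \<Rightarrow> ('g, 'n) LTt_elem set" where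
  "htilde T = {(Poly_Mapping.single 0 h, z, a) | h z a. h \<in> h0 T \<and> z \<in> cvs.span (range (tK 0))}"

text \<open>\<open>(X, f, c)\<close> stands for \<open>X + K \<otimes> f + c d\<^sub>0\<close>.\<close>

type_synonym ('g, 'n) LL_elem = "('n deg \<Rightarrow>\<^sub>0 'g) \<times> ((int ^ 'n) \<Rightarrow>\<^sub>0 complex) \<times> complex"

definition LL :: "('g::complex_vector_space, 'n::finite) torus_data \<Rightarrow> ('g, 'n) LL_elem lie_alg" where
  "LL T = \<lparr>car = LT T \<times> {f. \<forall>k\<in>Poly_Mapping.keys f. in_lattice T (0, k)} \<times> UNIV,
     bk = (\<lambda>(X, f, c) (Y, g, e).
       (LT_br T X Y + c *\<^sub>C LT_der (dcoef None) Y - e *\<^sub>C LT_der (dcoef None) X,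
        (\<Sum>\<kappa>\<in>Poly_Mapping.keys X. \<Sum>\<mu>\<in>Poly_Mapping.keys Y.
           if fst \<kappa> + fst \<mu> = 0 \<and> in_lattice T (\<kappa> + \<mu>)
           then Poly_Mapping.single (snd \<kappa> + snd \<mu>)
             (gform T (Poly_Mapping.lookup X \<kappa>) (Poly_Mapping.lookup Y \<mu>) * of_int (fst \<kappa>))
           else 0),
        0))\<rparr>"

definition htilde0 :: "('g::complex_vector_space, 'n::finite) torus_data \<Rightarrow> ('g, 'n) LL_elem set" where
  "htilde0 T = {(Poly_Mapping.single 0 h, Poly_Mapping.single 0 b, c) | h b c. h \<in> h0 T}"

text \<open>The action of \<open>LL\<close> on an \<open>LTt\<close>-module in which \<open>K \<otimes> t\<^bsup>k\<^esup>\<close> acts as \<open>t\<^bsup>k\<^esup>K\<^sub>0\<close>.\<close>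

definition LL_act ::
  "(('g::complex_vector_space, 'n::finite) LTt_elem \<Rightarrow> 'v \<Rightarrow> 'v) \<Rightarrow> ('g, 'n) LL_elem \<Rightarrow> 'v \<Rightarrow> 'v" where
  "LL_act \<rho> = (\<lambda>(X, f, c).
     \<rho> (X, (\<Sum>k\<in>Poly_Mapping.keys f. Poly_Mapping.lookup f k *\<^sub>C tK (0, k) None), c *\<^sub>C dcoef None))"


section \<open>Central operators and the algebras \<open>G\<close> and \<open>Gbar\<close>\<close>

definition central_operator ::
  "('g::complex_vector_space, 'n::finite) torus_data \<Rightarrow>
   (('g, 'n) LTt_elem \<Rightarrow> 'v::complex_vector_space \<Rightarrow> 'v) \<Rightarrow> 'n deg \<Rightarrow> ('v \<Rightarrow> 'v) \<Rightarrow> bool" where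
  "central_operator T \<rho> \<kappa> z \<longleftrightarrow>
     linear_on UNIV z \<and>
     (\<forall>X\<in>LT T. \<forall>w\<in>ZZ T. \<forall>v. z (\<rho> (X, w, 0) v) = \<rho> (X, w, 0) (z v)) \<and>
     (\<forall>i v. \<rho> (0, 0, dcoef i) (z v) - z (\<rho> (0, 0, dcoef i) v) = of_int (coord \<kappa> i) *\<^sub>C z v)"

definition SS ::
  "('g::complex_vector_space, 'n::finite) torus_data \<Rightarrow>
   (('g, 'n) LTt_elem \<Rightarrow> 'v::complex_vector_space \<Rightarrow> 'v) \<Rightarrow> (int ^ 'n) set" where
  "SS T \<rho> = {k. in_lattice T (0, k) \<and> \<rho> (0, tK (0, k) None, 0) \<noteq> 0}"

definition subgroup_generated_by :: "'a::ab_group_add set \<Rightarrow> 'a set" where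
  "subgroup_generated_by S = \<Inter>{H. S \<subseteq> H \<and> 0 \<in> H \<and> (\<forall>x\<in>H. \<forall>y\<in>H. x - y \<in> H)}"

definition SSspan ::
  "('g::complex_vector_space, 'n::finite) torus_data \<Rightarrow>
   (('g, 'n) LTt_elem \<Rightarrow> 'v::complex_vector_space \<Rightarrow> 'v) \<Rightarrow> ('v \<Rightarrow> 'v) set" where
  "SSspan T \<rho> = cvs.span {z. \<exists>s\<in>subgroup_generated_by (SS T \<rho>). central_operator T \<rho> (0, s) z}"

text \<open>\<open>(X, A, a)\<close> stands for \<open>X + A + \<Sum>\<^sub>i a\<^sub>i d\<^sub>i\<close> with \<open>X \<in> LT\<close> and \<open>A \<in> [S]\<close>; the sum is
  the external direct one. The derivations act on \<open>[S]\<close> by the commutator with their action on \<open>V\<close>,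
  which on a central operator of degree \<open>(k\<^sub>0, k)\<close> is multiplication by \<open>k\<^sub>i\<close>.\<close>

type_synonym ('g, 'n, 'v) G_elem = "('n deg \<Rightarrow>\<^sub>0 'g) \<times> ('v \<Rightarrow> 'v) \<times> ('n option \<Rightarrow> complex)"

definition op_der ::
  "(('g::complex_vector_space, 'n::finite) LTt_elem \<Rightarrow> 'v::complex_vector_space \<Rightarrow> 'v) \<Rightarrow>
   ('n option \<Rightarrow> complex) \<Rightarrow> ('v \<Rightarrow> 'v) \<Rightarrow> ('v \<Rightarrow> 'v)" where
  "op_der \<rho> a A = (\<lambda>v. \<rho> (0, 0, a) (A v) - A (\<rho> (0, 0, a) v))"

definition G_alg ::
  "('g::complex_vector_space, 'n::finite) torus_data \<Rightarrow>
   (('g, 'n) LTt_elem \<Rightarrow> 'v::complex_vector_space \<Rightarrow> 'v) \<Rightarrow> ('g, 'n, 'v) G_elem lie_alg" where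
  "G_alg T \<rho> = \<lparr>car = LT T \<times> SSspan T \<rho> \<times> UNIV,
     bk = (\<lambda>(X, A, a) (Y, B, b).
       (LT_br T X Y + LT_der a Y - LT_der b X,
        \<rho> (0, LT_cocycle T X Y, 0) + op_der \<rho> a B - op_der \<rho> b A,
        0))\<rparr>"

definition Gbar ::
  "('g::complex_vector_space, 'n::finite) torus_data \<Rightarrow>
   (('g, 'n) LTt_elem \<Rightarrow> 'v::complex_vector_space \<Rightarrow> 'v) \<Rightarrow> ('g, 'n, 'v) G_elem lie_alg" where
  "Gbar T \<rho> = (G_alg T \<rho>)\<lparr>car := LT T \<times> SSspan T \<rho> \<times> cvs.span {dcoef None}\<rparr>"

definition Gbar_deg ::
  "('g::complex_vector_space, 'n::finite) torus_data \<Rightarrow>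
   (('g, 'n) LTt_elem \<Rightarrow> 'v::complex_vector_space \<Rightarrow> 'v) \<Rightarrow> (int ^ 'n) \<Rightarrow> ('g, 'n, 'v) G_elem set" where
  "Gbar_deg T \<rho> k = {x \<in> car (Gbar T \<rho>).
     \<forall>i. bk (G_alg T \<rho>) (0, 0, dcoef (Some i)) x = of_int (k $ i) *\<^sub>C x}"

definition Gbar_components ::
  "('g::complex_vector_space, 'n::finite) torus_data \<Rightarrow>
   (('g, 'n) LTt_elem \<Rightarrow> 'v::complex_vector_space \<Rightarrow> 'v) \<Rightarrow>
   ('g, 'n, 'v) G_elem \<Rightarrow> ((int ^ 'n) \<Rightarrow>\<^sub>0 ('g, 'n, 'v) G_elem)" where
  "Gbar_components T \<rho> x = (THE f. (\<forall>k. Poly_Mapping.lookup f k \<in> Gbar_deg T \<rho> k) \<and>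
     (\<Sum>k\<in>Poly_Mapping.keys f. Poly_Mapping.lookup f k) = x)"

definition G_act ::
  "(('g::complex_vector_space, 'n::finite) LTt_elem \<Rightarrow> 'v::complex_vector_space \<Rightarrow> 'v) \<Rightarrow>
   ('g, 'n, 'v) G_elem \<Rightarrow> 'v \<Rightarrow> 'v" where
  "G_act \<rho> = (\<lambda>(X, A, a) v. \<rho> (X, 0, a) v + A v)"


section \<open>The quotient \<open>V/W\<close> and the loop module\<close>

text \<open>The quotient of \<open>V\<close> by \<open>W\<close> is presented by a surjective linear map \<open>p\<close> with kernel \<open>W\<close>.
  An operator on \<open>V\<close> that preserves \<open>W\<close> induces an operator on the quotient, independent of the
  preimage chosen by \<open>inv\<close>.\<close>

definition is_quotient_map ::
  "('v::complex_vector_space \<Rightarrow> 'w::complex_vector_space) \<Rightarrow> 'v set \<Rightarrow> bool" where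
  "is_quotient_map p W \<longleftrightarrow> linear_on UNIV p \<and> surj p \<and> {v. p v = 0} = W"

definition quot_act :: "('v \<Rightarrow> 'w) \<Rightarrow> ('a \<Rightarrow> 'v \<Rightarrow> 'v) \<Rightarrow> 'a \<Rightarrow> 'w \<Rightarrow> 'w" where
  "quot_act p \<rho> x w = p (\<rho> x (inv p w))"

text \<open>\<open>V\<^sub>1 \<otimes> A\<^sub>n\<close> consists of the finitely supported functions from \<open>\<int>\<^sup>n\<close> to \<open>V\<^sub>1\<close>;
  \<open>v \<otimes> t\<^bsup>r\<^esup>\<close> is \<open>Poly_Mapping.single r v\<close>.\<close>

definition loop_act ::
  "('g::complex_vector_space, 'n::finite) torus_data \<Rightarrow>
   (('g, 'n) LTt_elem \<Rightarrow> 'v::complex_vector_space \<Rightarrow> 'v) \<Rightarrow> ('v \<Rightarrow> 'w::complex_vector_space) \<Rightarrow>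
   complex ^ 'n \<Rightarrow> ('g, 'n, 'v) G_elem \<Rightarrow> ((int ^ 'n) \<Rightarrow>\<^sub>0 'w) \<Rightarrow> ((int ^ 'n) \<Rightarrow>\<^sub>0 'w)" where
  "loop_act T \<rho> p \<alpha> = (\<lambda>(X, A, a) F.
     (let x = Gbar_components T \<rho> (X, A, a None *\<^sub>C dcoef None) in
        \<Sum>k\<in>Poly_Mapping.keys x. \<Sum>r\<in>Poly_Mapping.keys F.
          Poly_Mapping.single (r + k)
            (quot_act p (G_act \<rho>) (Poly_Mapping.lookup x k) (Poly_Mapping.lookup F r))) +
     (\<Sum>r\<in>Poly_Mapping.keys F. Poly_Mapping.single r
        ((\<Sum>i\<in>UNIV. a (Some i) * (of_int (r $ i) + \<alpha> $ i)) *\<^sub>C Poly_Mapping.lookup F r)))"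

text \<open>The action on \<open>M \<otimes> \<complex>\<^sub>\<gamma>\<close>, whose underlying space is identified with \<open>M\<close>.\<close>

definition grade_shift ::
  "complex ^ 'n::finite \<Rightarrow> (('g, 'n, 'v) G_elem \<Rightarrow> 'm::complex_vector_space \<Rightarrow> 'm) \<Rightarrow>
   ('g, 'n, 'v) G_elem \<Rightarrow> 'm \<Rightarrow> 'm" where
  "grade_shift \<gamma> \<rho> = (\<lambda>(X, A, a) v. \<rho> (X, A, a) v + (\<Sum>i\<in>UNIV. a (Some i) * \<gamma> $ i) *\<^sub>C v)"

definition iso_up_to_grade_shift ::
  "('g::complex_vector_space, 'n::finite, 'v::complex_vector_space) G_elem lie_alg \<Rightarrow>
   'm::complex_vector_space set \<Rightarrow> (('g, 'n, 'v) G_elem \<Rightarrow> 'm \<Rightarrow> 'm) \<Rightarrow>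
   'k::complex_vector_space set \<Rightarrow> (('g, 'n, 'v) G_elem \<Rightarrow> 'k \<Rightarrow> 'k) \<Rightarrow> bool" where
  "iso_up_to_grade_shift A M \<rho> M' \<rho>' \<longleftrightarrow> (\<exists>\<gamma>. module_iso A M \<rho> M' (grade_shift \<gamma> \<rho>'))"

end

theory Submission
  imports Defs "HOL-Computational_Algebra.Fundamental_Theorem_Algebra"
begin

text \<open>By irreducibility, \<open>D\<close> acts on \<open>V\<close> with weights in one coset of \<open>\<int>\<^sup>n\<close>, which grades
  \<open>V = \<Oplus>\<^sub>k V\<^sub>k\<close>. For every \<open>r\<close> the map sending \<open>v \<in> V\<^sub>k\<close> to \<open>p v \<otimes> t\<^bsup>k+r\<^esup>\<close> intertwines the action of
  \<open>G\<close> on a grade shift of \<open>V\<close> with its action on the loop module, and it is injective because \<open>V\<close> is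
  irreducible over \<open>G\<close>. By Schur's lemma a central operator of degree \<open>s \<in> \<langle>S\<rangle>\<close> is a multiple of one
  that is the identity modulo \<open>W\<close>. Hence \<open>p V\<^sub>k = p V\<^bsub>k+s\<^esub>\<close>, the images for \<open>r\<close> in a finite system of
  representatives modulo \<open>\<langle>S\<rangle>\<close> already span the loop module, and the loop module is a finite sum of
  irreducible modules that are grade shifts of \<open>V\<close>.\<close>

section \<open>Linear algebra\<close>

text \<open>\<open>W\<close> is only assumed stable under \<open>LL\<close>, so the quotient need
  not carry an action of \<open>D\<close>. The exponent of \<open>t\<close> restores it by recording
  the degree of a homogeneous vector, which \<open>p\<close> forgets. The eigenvector comes from a
  single finite dimensional weight space, which every central operator of degree 0 preserves. The
  module axioms and the irreducibility of the pieces are not checked on the long formula for the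
  loop action. They are carried over from \<open>V\<close> along the intertwining maps, which
  requires only that each element of \<open>G\<close> acts linearly. Nothing in the construction
  makes the images for different \<open>r\<close> independent, so a spanning subfamily of least
  cardinality is taken to obtain a direct sum. Finiteness and isomorphism are claimed for every
  decomposition, not just for the one constructed. An arbitrary decomposition is therefore compared
  with the finite spanning family.\<close>

global_interpretation cvp: vector_space_pair
    "scaleC :: complex \<Rightarrow> 'a \<Rightarrow> 'a::complex_vector_space"
    "scaleC :: complex \<Rightarrow> 'b \<Rightarrow> 'b::complex_vector_space"
  by standard

abbreviation clin :: "('a::complex_vector_space \<Rightarrow> 'b::complex_vector_space) \<Rightarrow> bool" where
  "clin f \<equiv> Vector_Spaces.linear scaleC scaleC f"

lemma clinI:
  assumes "\<And>x y. f (x + y) = f x + f y" "\<And>c x. f (c *\<^sub>C x) = c *\<^sub>C f x"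
  shows "clin f"
  unfolding linear_iff_module_hom module_hom_iff
  by (simp add: assms cvs.module_axioms)

lemma linear_on_UNIV_iff: "linear_on UNIV f \<longleftrightarrow> clin f"
  by (auto simp: linear_on_def cvp.linear_add cvp.linear_scale intro!: clinI)

lemma linear_on_UNIV_imp: "clin f \<Longrightarrow> linear_on M f"
  by (auto simp: linear_on_def cvp.linear_add cvp.linear_scale)

lemma linear_on_add: "linear_on M f \<Longrightarrow> x \<in> M \<Longrightarrow> y \<in> M \<Longrightarrow> f (x + y) = f x + f y"
  by (simp add: linear_on_def)

lemma linear_on_scale: "linear_on M f \<Longrightarrow> x \<in> M \<Longrightarrow> f (c *\<^sub>C x) = c *\<^sub>C f x"
  by (simp add: linear_on_def)

lemma linear_on_zero: "linear_on M f \<Longrightarrow> 0 \<in> M \<Longrightarrow> f 0 = 0"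
  using linear_on_scale[of M f 0 0] by simp

lemma linear_on_sum:
  assumes "linear_on M f" "cvs.subspace M" "\<And>i. i \<in> I \<Longrightarrow> g i \<in> M"
  shows "f (sum g I) = (\<Sum>i\<in>I. f (g i))"
  using assms(3)
proof (induction I rule: infinite_finite_induct)
  case (insert i I)
  then have "sum g I \<in> M" by (intro cvs.subspace_sum[OF assms(2)]) auto
  with insert show ?case by (simp add: linear_on_add[OF assms(1)])
qed (simp_all add: linear_on_zero[OF assms(1) cvs.subspace_0[OF assms(2)]])

lemma linear_on_span_mem:
  assumes f: "linear_on (cvs.span B) f" and S: "cvs.subspace S"
    and B: "\<And>b. b \<in> B \<Longrightarrow> f b \<in> S" and x: "x \<in> cvs.span B"
  shows "f x \<in> S"
proof -
  have "x \<in> cvs.span B \<and> f x \<in> S"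
    using x
  proof (induction rule: cvs.span_induct_alt)
    case base
    show ?case using linear_on_zero[OF f] by (simp add: cvs.span_zero cvs.subspace_0[OF S])
  next
    case (step c x y)
    then show ?case
      using B cvs.span_base[of x B]
      by (simp add: linear_on_add[OF f] linear_on_scale[OF f] cvs.span_add cvs.span_scale
          cvs.subspace_add[OF S] cvs.subspace_scale[OF S])
  qed
  then show ?thesis ..
qed

lemma scaleC_fun_apply [simp]: "(c *\<^sub>C f) x = c *\<^sub>C f x"
  by (simp add: scaleC_fun_def)

lemma sum_fun_apply: "(\<Sum>i\<in>I. f i) x = (\<Sum>i\<in>I. f i x)"
  by (induction I rule: infinite_finite_induct) auto

lemma scaleC_Pair: "c *\<^sub>C (x, y) = (c *\<^sub>C x, c *\<^sub>C y)"
  by (simp add: scaleC_prod_def)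

section \<open>Finitely supported functions as sums of their values\<close>

lemma scaleC_single: "c *\<^sub>C Poly_Mapping.single k x = Poly_Mapping.single k (c *\<^sub>C x)"
  by (rule poly_mapping_eqI) (simp add: lookup_scaleC lookup_single when_def)

lemma clin_single: "clin (Poly_Mapping.single k)"
  by (intro clinI) (simp_all add: single_add scaleC_single)

lemma sum_keys_superset:
  assumes "finite K" "Poly_Mapping.keys f \<subseteq> K" "\<And>k. g k 0 = 0"
  shows "(\<Sum>k\<in>Poly_Mapping.keys f. g k (Poly_Mapping.lookup f k)) =
    (\<Sum>k\<in>K. g k (Poly_Mapping.lookup f k))"
  using assms by (intro sum.mono_neutral_left) (auto simp: in_keys_iff)

lemma clin_keys_sum:
  fixes g :: "'k \<Rightarrow> 'v::complex_vector_space \<Rightarrow> 'w::complex_vector_space"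
  assumes g: "\<And>k. clin (g k)"
  shows "clin (\<lambda>f. \<Sum>k\<in>Poly_Mapping.keys f. g k (Poly_Mapping.lookup f k))"
proof (intro clinI)
  fix f h :: "'k \<Rightarrow>\<^sub>0 'v" and c
  let ?K = "Poly_Mapping.keys f \<union> Poly_Mapping.keys h"
  have g0: "g k 0 = 0" for k using g cvp.linear_0 by blast
  have "Poly_Mapping.keys (f + h) \<subseteq> ?K" by (rule keys_add)
  then show "(\<Sum>k\<in>Poly_Mapping.keys (f + h). g k (Poly_Mapping.lookup (f + h) k)) =
    (\<Sum>k\<in>Poly_Mapping.keys f. g k (Poly_Mapping.lookup f k)) +
    (\<Sum>k\<in>Poly_Mapping.keys h. g k (Poly_Mapping.lookup h k))"
    by (subst (1 2 3) sum_keys_superset[where K = ?K])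
      (auto simp: g0 lookup_add cvp.linear_add[OF g] sum.distrib)
  have "Poly_Mapping.keys (c *\<^sub>C f) \<subseteq> Poly_Mapping.keys f"
    by (auto simp: in_keys_iff lookup_scaleC)
  then show "(\<Sum>k\<in>Poly_Mapping.keys (c *\<^sub>C f). g k (Poly_Mapping.lookup (c *\<^sub>C f) k)) =
    c *\<^sub>C (\<Sum>k\<in>Poly_Mapping.keys f. g k (Poly_Mapping.lookup f k))"
    by (subst sum_keys_superset[where K = "Poly_Mapping.keys f"])
      (auto simp: g0 lookup_scaleC cvp.linear_scale[OF g] cvs.scale_sum_right)
qed

lemma sum_single_lookup:
  fixes f :: "'k \<Rightarrow>\<^sub>0 'v::ab_group_add"
  shows "(\<Sum>k\<in>Poly_Mapping.keys f. Poly_Mapping.single k (Poly_Mapping.lookup f k)) = f"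
  by (rule poly_mapping_eqI)
    (simp add: lookup_sum lookup_single when_def sum.delta in_keys_iff)

lemma span_singles: "cvs.span {Poly_Mapping.single k v | k v. True} = (UNIV :: ('k \<Rightarrow>\<^sub>0 'v::complex_vector_space) set)"
proof -
  have "f \<in> cvs.span {Poly_Mapping.single k v | k v. True}" for f :: "'k \<Rightarrow>\<^sub>0 'v"
    by (subst sum_single_lookup[of f, symmetric]) (intro cvs.span_sum cvs.span_base, auto)
  then show ?thesis by auto
qed

subsection \<open>Eigenvectors\<close>

text \<open>This is q(f) v, computed by Horner's scheme on the vector, so that no ring of operators
  has to be introduced.\<close>

definition horner :: "('v \<Rightarrow> 'v::complex_vector_space) \<Rightarrow> 'v \<Rightarrow> complex poly \<Rightarrow> 'v" where
  "horner f v q = fold_coeffs (\<lambda>a u. a *\<^sub>C v + f u) q 0"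

text \<open>Linearity matters only for \<open>pCons 0 0\<close>, which is the zero polynomial and
  contributes no coefficient to the fold; there the equation says \<open>f 0 = 0\<close>.\<close>

lemma horner_pCons:
  assumes "clin f"
  shows "horner f v (pCons a q) = a *\<^sub>C v + f (horner f v q)"
  using cvp.linear_0[OF assms] by (cases "q = 0"; cases "a = 0") (auto simp: horner_def)

lemma horner_0 [simp]: "horner f v 0 = 0"
  by (simp add: horner_def)

lemma horner_add: "clin f \<Longrightarrow> horner f v (q + r) = horner f v q + horner f v r"
  by (induction q r rule: poly_induct2)
    (simp_all add: horner_pCons cvp.linear_add scaleC_add_left add_ac)

lemma horner_smult: "clin f \<Longrightarrow> horner f v (smult c q) = c *\<^sub>C horner f v q"
  by (induction q)
    (simp_all add: horner_pCons cvp.linear_scale scaleC_add_right scaleC_scaleC)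

text \<open>As f commutes with q(f), the factor f - c may be applied to the vector first. A root of
  an annihilating polynomial can thus be traded for a change of vector, which drives the induction
  in \<open>ex_eigenvector\<close>.\<close>

lemma horner_mult_linear_factor:
  assumes f: "clin f"
  shows "horner f v ([:- c, 1:] * q) = horner f (f v - c *\<^sub>C v) q"
proof -
  have eq: "horner f v ([:- c, 1:] * q) = f (horner f v q) - c *\<^sub>C horner f v q"
    unfolding mult_pCons_left by (simp only: horner_add horner_smult horner_pCons f) (simp add: cvp.linear_0[OF f])
  also have "\<dots> = horner f (f v - c *\<^sub>C v) q"
    by (induction q)
      (simp_all add: f horner_pCons cvp.linear_0 cvp.linear_add cvp.linear_diff cvp.linear_scale
        scaleC_scaleC cvs.scale_right_diff_distrib scaleC_add_right algebra_simps)
  finally show ?thesis .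
qed

lemma horner_monom: "clin f \<Longrightarrow> horner f v (monom 1 n) = (f ^^ n) v"
  by (induction n) (simp_all add: horner_pCons monom_Suc cvp.linear_0 monom_0)

text \<open>Without an annihilating polynomial the iterates of \<open>v\<close> would be linearly
  independent. One more of them than a finite spanning set has elements is too many.\<close>

lemma ex_annihilating_poly:
  assumes f: "clin f" and E: "\<And>u. u \<in> E \<Longrightarrow> f u \<in> E" "finite_dim E" and v: "v \<in> E"
  shows "\<exists>q. q \<noteq> 0 \<and> horner f v q = 0"
proof (rule ccontr)
  assume "\<not> ?thesis"
  then have nz: "horner f v q = 0 \<Longrightarrow> q = 0" for q by auto
  \<comment> \<open>The vanishing coefficient at \<open>n\<close> expresses degree less than
    \<open>n\<close> in a form that also admits the zero polynomial when \<open>n = 0\<close>. It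
    later makes the coefficient of the difference with the monomial equal to 1.\<close>
  have span: "\<exists>q. degree q < Suc n \<and> horner f v q = u \<and> coeff q n = 0"
    if "u \<in> cvs.span ((\<lambda>i. (f ^^ i) v) ` {..<n})" for u n
    using that
  proof (induction rule: cvs.span_induct_alt)
    case base
    show ?case by (intro exI[of _ 0]) simp
  next
    case (step c x y)
    then obtain i q where "i < n" "x = (f ^^ i) v"
      and q: "degree q < Suc n" "horner f v q = y" "coeff q n = 0" by auto
    then have "degree (smult c (monom 1 i) + q) < Suc n"
      by (intro degree_add_less) (auto intro: le_less_trans[OF degree_smult_le] simp: degree_monom_eq)
    then show ?case
      using q \<open>i < n\<close> \<open>x = (f ^^ i) v\<close>
      by (intro exI[of _ "smult c (monom 1 i) + q"])
        (auto simp: horner_add f horner_smult horner_monom)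
  qed
  have notin: "(f ^^ n) v \<notin> cvs.span ((\<lambda>i. (f ^^ i) v) ` {..<n})" for n
  proof
    assume "(f ^^ n) v \<in> cvs.span ((\<lambda>i. (f ^^ i) v) ` {..<n})"
    from span[OF this] obtain q where q: "horner f v q = (f ^^ n) v" "coeff q n = 0" by auto
    have "horner f v (monom 1 n + smult (- 1) q) = 0"
      using q horner_smult[OF f, of v "-1" q] by (simp only: horner_add f horner_monom) simp
    then have "monom 1 n + smult (- 1) q = 0" by (rule nz)
    then have "coeff (monom 1 n + smult (- 1) q) n = 0" by simp
    with q show False by simp
  qed
  have indep: "cvs.independent ((\<lambda>i. (f ^^ i) v) ` {..<n}) \<and> card ((\<lambda>i. (f ^^ i) v) ` {..<n}) = n" for n
  proof (induction n)
    case (Suc n)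
    let ?B = "(\<lambda>i. (f ^^ i) v) ` {..<n}"
    have "(\<lambda>i. (f ^^ i) v) ` {..<Suc n} = insert ((f ^^ n) v) ?B"
      by (simp only: lessThan_Suc image_insert)
    moreover have "cvs.independent (insert ((f ^^ n) v) ?B)"
      using notin[of n] Suc by (intro cvs.independent_insertI) auto
    moreover have "(f ^^ n) v \<notin> ?B"
      using notin[of n] by (rule contrapos_nn) (rule cvs.span_base)
    then have "card (insert ((f ^^ n) v) ?B) = Suc (card ?B)"
      by (intro card_insert_disjoint finite_imageI finite_lessThan)
    ultimately show ?case by (simp only: Suc simp_thms)
  qed (simp add: cvs.independent_empty)
  obtain B where B: "finite B" "E \<subseteq> cvs.span B" using E(2) by (auto simp: finite_dim_def)
  have "(f ^^ i) v \<in> E" for i by (induction i) (use v E(1) in auto)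
  then have "(\<lambda>i. (f ^^ i) v) ` {..<Suc (card B)} \<subseteq> cvs.span B" using B by auto
  from cvs.independent_span_bound[OF B(1) conjunct1[OF indep] this] indep[of "Suc (card B)"]
  show False by simp
qed

text \<open>For a root c of an annihilating polynomial of v, either v is an eigenvector for c, or f
  v - c v is a non-zero vector of \<open>E\<close> annihilated by the cofactor of smaller degree. In
  degree 0 a non-zero constant cannot annihilate v.\<close>

lemma ex_eigenvector:
  assumes f: "clin f" and E: "cvs.subspace E" "finite_dim E" "E \<noteq> {0}" "\<And>u. u \<in> E \<Longrightarrow> f u \<in> E"
  shows "\<exists>v\<in>E. v \<noteq> 0 \<and> (\<exists>c. f v = c *\<^sub>C v)"
proof -
  have main: "q \<noteq> 0 \<Longrightarrow> v \<in> E \<Longrightarrow> v \<noteq> 0 \<Longrightarrow> horner f v q = 0 \<Longrightarrow> \<exists>v\<in>E. v \<noteq> 0 \<and> (\<exists>c. f v = c *\<^sub>C v)" for q v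
  proof (induction "degree q" arbitrary: q v)
    case 0
    then obtain a where "q = [:a:]" using degree_0_id by metis
    with 0 show ?case by (auto simp: horner_pCons f cvp.linear_0)
  next
    case (Suc d)
    then obtain c where "poly q c = 0"
      using fundamental_theorem_of_algebra[of q] constant_degree[of q] by auto
    then obtain r where q: "q = [:- c, 1:] * r" by (auto simp: poly_eq_0_iff_dvd)
    with Suc have "r \<noteq> 0" by auto
    then have d: "degree r = d" using Suc(2) q by (simp add: degree_mult_eq del: mult_pCons_left)
    show ?case
    proof (cases "f v - c *\<^sub>C v = 0")
      case True
      with Suc show ?thesis by auto
    next
      case False
      have "horner f (f v - c *\<^sub>C v) r = 0"
        using Suc q by (simp only: horner_mult_linear_factor[OF f])
      with Suc(1)[OF d[symmetric] \<open>r \<noteq> 0\<close> _ False] Suc(4) E show ?thesis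
        by (meson cvs.subspace_diff cvs.subspace_scale)
    qed
  qed
  have "0 \<in> E" using E(1) by (rule cvs.subspace_0)
  with E(3) obtain v where "v \<in> E" "v \<noteq> 0" by auto
  with main ex_annihilating_poly[OF f E(4) E(2)] show ?thesis by blast
qed

text \<open>For each \<open>k1\<close> in \<open>K\<close> there is an index \<open>i\<close> at
  which the weights of \<open>k0\<close> and \<open>k1\<close> differ. The operator
  \<open>D i\<close> minus its eigenvalue at \<open>k0\<close> removes the \<open>k0\<close> term
  and rescales the others, and the factor at \<open>k1\<close> is non-zero.\<close>

lemma joint_eigenvectors_independent:
  fixes D :: "'i \<Rightarrow> 'v::complex_vector_space \<Rightarrow> 'v" and wt :: "'k \<Rightarrow> 'i \<Rightarrow> complex"
  assumes D: "\<And>i. clin (D i)" and wt: "inj wt"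
    and "finite K" "\<And>k i. k \<in> K \<Longrightarrow> D i (h k) = wt k i *\<^sub>C h k" "(\<Sum>k\<in>K. h k) = 0" "k \<in> K"
  shows "h k = 0"
  using assms(3-)
proof (induction K arbitrary: h k rule: finite_induct)
  case (insert k0 K)
  have zero: "h k1 = 0" if "k1 \<in> K" for k1
  proof -
    have "wt k0 \<noteq> wt k1" using wt insert that by (auto dest: injD)
    then obtain i where "wt k0 i \<noteq> wt k1 i" by auto
    then have i: "wt k1 i - wt k0 i \<noteq> 0" by auto
    have "(\<Sum>k\<in>insert k0 K. wt k i *\<^sub>C h k) = D i (\<Sum>k\<in>insert k0 K. h k)"
      using insert.hyps insert.prems(1) by (simp add: cvp.linear_sum[OF D] cvp.linear_add[OF D])
    also have "\<dots> = wt k0 i *\<^sub>C (\<Sum>k\<in>insert k0 K. h k)"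
      using insert cvp.linear_0[OF D] by simp
    finally have "(\<Sum>k\<in>insert k0 K. (wt k i - wt k0 i) *\<^sub>C h k) = 0"
      by (simp only: cvs.scale_sum_right cvs.scale_left_diff_distrib sum_subtractf diff_self)
    then have "(\<Sum>k\<in>K. (wt k i - wt k0 i) *\<^sub>C h k) = 0"
      using insert.hyps by simp
    moreover have "D j ((wt k i - wt k0 i) *\<^sub>C h k) = wt k j *\<^sub>C (wt k i - wt k0 i) *\<^sub>C h k"
      if "k \<in> K" for k j
      using insert that by (simp add: cvp.linear_scale[OF D] scaleC_scaleC mult.commute)
    ultimately have "(wt k1 i - wt k0 i) *\<^sub>C h k1 = 0"
      using insert.IH[of "\<lambda>k. (wt k i - wt k0 i) *\<^sub>C h k" k1] that by blast
    with i show ?thesis by simp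
  qed
  then have "(\<Sum>k\<in>K. h k) = 0" by simp
  with insert have "h k0 = 0" by simp
  with zero insert show ?case by auto
qed simp

subsection \<open>Gradings\<close>

text \<open>The description has the shape of \<open>Gbar_components\<close>, so one theory of
  gradings covers both the algebra and \<open>V\<close>.\<close>

definition components :: "('k \<Rightarrow> 'v set) \<Rightarrow> 'v::complex_vector_space \<Rightarrow> ('k \<Rightarrow>\<^sub>0 'v)" where
  "components E v = (THE f. (\<forall>k. Poly_Mapping.lookup f k \<in> E k) \<and>
     (\<Sum>k\<in>Poly_Mapping.keys f. Poly_Mapping.lookup f k) = v)"

text \<open>Independence alone is required, because the family may span only a part of the type,
  such as the carrier of \<open>Gbar\<close>. Existence of components is stated on the span.\<close>

locale grading =
  fixes E :: "'k \<Rightarrow> 'v::complex_vector_space set"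
  assumes subspace: "cvs.subspace (E k)"
    and independent: "(\<And>k. Poly_Mapping.lookup f k \<in> E k) \<Longrightarrow>
      (\<Sum>k\<in>Poly_Mapping.keys f. Poly_Mapping.lookup f k) = 0 \<Longrightarrow> f = 0"
begin

lemma clin_total: "clin (\<lambda>f::'k \<Rightarrow>\<^sub>0 'v. \<Sum>k\<in>Poly_Mapping.keys f. Poly_Mapping.lookup f k)"
  by (rule clin_keys_sum[where g = "\<lambda>_ x. x"]) (rule cvs.linear_ident)

lemma components_unique:
  assumes "\<And>k. Poly_Mapping.lookup f k \<in> E k"
    and "(\<Sum>k\<in>Poly_Mapping.keys f. Poly_Mapping.lookup f k) = v"
  shows "components E v = f"
  unfolding components_def
proof (rule the_equality)
  fix g :: "'k \<Rightarrow>\<^sub>0 'v"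
  assume g: "(\<forall>k. Poly_Mapping.lookup g k \<in> E k) \<and>
    (\<Sum>k\<in>Poly_Mapping.keys g. Poly_Mapping.lookup g k) = v"
  have "g - f = 0"
  proof (rule independent)
    show "Poly_Mapping.lookup (g - f) k \<in> E k" for k
      using g assms cvs.subspace_diff[OF subspace] by (simp add: lookup_minus)
    show "(\<Sum>k\<in>Poly_Mapping.keys (g - f). Poly_Mapping.lookup (g - f) k) = 0"
      using g assms cvp.linear_diff[OF clin_total, of g f] by simp
  qed
  then show "g = f" by simp
qed (use assms in auto)

lemma components_homogeneous:
  assumes "v \<in> E k"
  shows "components E v = Poly_Mapping.single k v"
  using assms
  by (intro components_unique)
    (auto simp: lookup_single when_def cvs.subspace_0[OF subspace])

lemma components_exist:
  assumes "v \<in> cvs.span (\<Union>k. E k)"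
  shows "\<exists>f. (\<forall>k. Poly_Mapping.lookup f k \<in> E k) \<and>
    (\<Sum>k\<in>Poly_Mapping.keys f. Poly_Mapping.lookup f k) = v"
  using assms
proof (induction rule: cvs.span_induct_alt)
  case base
  show ?case by (intro exI[of _ 0]) (simp add: cvs.subspace_0[OF subspace])
next
  case (step c x y)
  then obtain k f where "x \<in> E k" and f: "\<forall>k. Poly_Mapping.lookup f k \<in> E k"
    "(\<Sum>k\<in>Poly_Mapping.keys f. Poly_Mapping.lookup f k) = y" by auto
  then show ?case
    using cvp.linear_add[OF clin_total, of "Poly_Mapping.single k (c *\<^sub>C x)" f]
    by (intro exI[of _ "Poly_Mapping.single k (c *\<^sub>C x) + f"])
      (auto simp: lookup_add lookup_single when_def
        intro: cvs.subspace_add[OF subspace] cvs.subspace_scale[OF subspace])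
qed

lemma
  assumes "v \<in> cvs.span (\<Union>k. E k)"
  shows components_in: "Poly_Mapping.lookup (components E v) k \<in> E k"
    and components_sum: "(\<Sum>k\<in>Poly_Mapping.keys (components E v). Poly_Mapping.lookup (components E v) k) = v"
proof -
  obtain f where f: "\<forall>k. Poly_Mapping.lookup f k \<in> E k"
    "(\<Sum>k\<in>Poly_Mapping.keys f. Poly_Mapping.lookup f k) = v"
    using components_exist[OF assms] by auto
  then have "components E v = f" by (intro components_unique) auto
  with f show "Poly_Mapping.lookup (components E v) k \<in> E k"
    "(\<Sum>k\<in>Poly_Mapping.keys (components E v). Poly_Mapping.lookup (components E v) k) = v"
    by auto
qed

lemma linear_on_components: "linear_on (cvs.span (\<Union>k. E k)) (components E)"
  unfolding linear_on_def
proof (intro conjI ballI allI)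
  fix v w c
  assume v: "v \<in> cvs.span (\<Union>k. E k)"
  show "components E (c *\<^sub>C v) = c *\<^sub>C components E v"
    using cvp.linear_scale[OF clin_total, of c "components E v"] v
    by (intro components_unique)
      (auto simp: lookup_scaleC components_sum intro: cvs.subspace_scale[OF subspace] components_in)
  assume w: "w \<in> cvs.span (\<Union>k. E k)"
  show "components E (v + w) = components E v + components E w"
    using cvp.linear_add[OF clin_total, of "components E v" "components E w"] v w
    by (intro components_unique)
      (auto simp: lookup_add components_sum intro: cvs.subspace_add[OF subspace] components_in)
qed

end

lemma grading_joint_eigenspaces:
  fixes D :: "'i \<Rightarrow> 'v::complex_vector_space \<Rightarrow> 'v" and wt :: "'k \<Rightarrow> 'i \<Rightarrow> complex"
  assumes D: "\<And>i. clin (D i)" and wt: "inj wt" and S: "cvs.subspace S"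
  shows "grading (\<lambda>k. {v \<in> S. \<forall>i. D i v = wt k i *\<^sub>C v})"
proof
  show "cvs.subspace {v \<in> S. \<forall>i. D i v = wt k i *\<^sub>C v}" for k
    using S
    by (auto simp: cvs.subspace_def cvp.linear_0[OF D] cvp.linear_add[OF D] cvp.linear_scale[OF D]
        scaleC_add_right scaleC_scaleC mult.commute)
  fix f :: "'k \<Rightarrow>\<^sub>0 'v"
  assume f: "\<And>k. Poly_Mapping.lookup f k \<in> {v \<in> S. \<forall>i. D i v = wt k i *\<^sub>C v}"
    and sum: "(\<Sum>k\<in>Poly_Mapping.keys f. Poly_Mapping.lookup f k) = 0"
  have "Poly_Mapping.lookup f k = 0" if "k \<in> Poly_Mapping.keys f" for k
    by (rule joint_eigenvectors_independent[OF D wt, where K = "Poly_Mapping.keys f"])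
      (use f sum that in auto)
  then show "f = 0" by (intro poly_mapping_eqI) (metis in_keys_iff lookup_zero)
qed

section \<open>Sums of irreducible modules\<close>

definition lie_closed :: "'a::complex_vector_space lie_alg \<Rightarrow> bool" where
  "lie_closed A \<longleftrightarrow> cvs.subspace (car A) \<and> (\<forall>x\<in>car A. \<forall>y\<in>car A. bk A x y \<in> car A)"

text \<open>The invariant finite dimensional \<open>E\<close> yields an eigenvalue even if the
  module is infinite dimensional. The eigenspace in the whole module is a non-zero submodule, hence
  everything.\<close>

lemma schur:
  assumes irr: "irreducible_module A UNIV \<rho>" and f: "clin f"
    and comm: "\<And>x v. x \<in> car A \<Longrightarrow> f (\<rho> x v) = \<rho> x (f v)"
    and E: "cvs.subspace E" "finite_dim E" "E \<noteq> {0}" "\<And>u. u \<in> E \<Longrightarrow> f u \<in> E"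
  shows "\<exists>c. \<forall>v. f v = c *\<^sub>C v"
proof -
  obtain v c where v: "v \<noteq> 0" "f v = c *\<^sub>C v" using ex_eigenvector[OF f E] by auto
  have lin: "linear_on UNIV (\<rho> x)" if "x \<in> car A" for x
    using irr that by (auto simp: irreducible_module_def lie_module_def)
  have "submodule A UNIV \<rho> {u. f u = c *\<^sub>C u}"
    unfolding submodule_def
    by (auto simp: cvs.subspace_def cvp.linear_0[OF f] cvp.linear_add[OF f] cvp.linear_scale[OF f]
        scaleC_add_right scaleC_scaleC mult.commute comm linear_on_scale[OF lin])
  then have "{u. f u = c *\<^sub>C u} = {0} \<or> {u. f u = c *\<^sub>C u} = UNIV"
    using irr by (auto simp: irreducible_module_def)
  with v have "{u. f u = c *\<^sub>C u} = UNIV" by auto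
  then show ?thesis by auto
qed

text \<open>The kernel is a submodule of the source. The target enters only through
  \<open>\<sigma> x 0 = 0\<close>, so the lemma applies before the loop action is known to be a
  module.\<close>

lemma irreducible_inj:
  assumes irr: "irreducible_module A UNIV \<tau>" and f: "clin f" "\<exists>v. f v \<noteq> 0"
    and equiv: "\<And>x v. x \<in> car A \<Longrightarrow> f (\<tau> x v) = \<sigma> x (f v)"
    and zero: "\<And>x. x \<in> car A \<Longrightarrow> \<sigma> x 0 = 0"
  shows "inj f"
proof -
  have "submodule A UNIV \<tau> {v. f v = 0}"
    by (auto simp: submodule_def cvs.subspace_def cvp.linear_0[OF f(1)] cvp.linear_add[OF f(1)]
        cvp.linear_scale[OF f(1)] equiv zero)
  then have "{v. f v = 0} = {0} \<or> {v. f v = 0} = UNIV"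
    using irr by (auto simp: irreducible_module_def)
  with f(2) have "{v. f v = 0} = {0}" by auto
  then show ?thesis unfolding cvp.linear_inj_iff_eq_0[OF f(1)] by auto
qed

text \<open>Every axiom on the range is the image of the same axiom for \<open>\<tau>\<close>, and
  submodules of the range are pulled back along \<open>f\<close>. Apart from being intertwined by
  \<open>f\<close>, nothing is asked of \<open>\<sigma>\<close>.\<close>

lemma irreducible_range:
  assumes closed: "lie_closed A"
    and irr: "irreducible_module A UNIV \<tau>" and f: "clin f" "inj f"
    and equiv: "\<And>x v. x \<in> car A \<Longrightarrow> f (\<tau> x v) = \<sigma> x (f v)"
  shows "irreducible_module A (range f) \<sigma>"
proof -
  note lin = cvp.linear_add[OF f(1)] cvp.linear_scale[OF f(1)] cvp.linear_diff[OF f(1)]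
  have sub: "cvs.subspace (range f)"
    unfolding cvs.subspace_def
    by (auto simp flip: lin intro: range_eqI[of _ _ 0] simp: cvp.linear_0[OF f(1)])
  have mod: "lie_module A UNIV \<tau>" using irr by (simp add: irreducible_module_def)
  have "lie_module A (range f) \<sigma>"
    using mod closed sub
    by (auto simp: lie_module_def linear_on_def lie_closed_def cvs.subspace_add cvs.subspace_scale
        simp flip: equiv lin)
  moreover have "range f \<noteq> {0}"
  proof -
    have "(UNIV :: 'b set) \<noteq> {0}" using irr by (simp add: irreducible_module_def)
    then obtain v :: 'b where "v \<noteq> 0" by auto
    then have "f v \<noteq> 0" using cvp.linear_inj_iff_eq_0[OF f(1)] f(2) by auto
    then show ?thesis by auto
  qed
  moreover have "N = {0} \<or> N = range f" if N: "submodule A (range f) \<sigma> N" for N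
  proof -
    have "submodule A UNIV \<tau> {v. f v \<in> N}"
      using N by (auto simp: submodule_def cvs.subspace_def lin equiv cvp.linear_0[OF f(1)])
    then have "{v. f v \<in> N} = {0} \<or> {v. f v \<in> N} = UNIV"
      using irr by (auto simp: irreducible_module_def)
    moreover have "N = f ` {v. f v \<in> N}" using N by (auto simp: submodule_def)
    ultimately show ?thesis by (metis cvp.linear_0[OF f(1)] image_empty image_insert)
  qed
  ultimately show ?thesis by (simp add: irreducible_module_def)
qed

text \<open>Once each \<open>\<sigma> x\<close> is linear, both sides of every module axiom are
  linear in the vector, so it suffices to know the axioms on a spanning family.\<close>

lemma lie_module_span:
  assumes closed: "lie_closed A"
    and lin: "\<And>x. x \<in> car A \<Longrightarrow> clin (\<sigma> x)"
    and mod: "\<And>N. N \<in> \<M> \<Longrightarrow> lie_module A N \<sigma>" and span: "cvs.span (\<Union>\<M>) = UNIV"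
  shows "lie_module A UNIV \<sigma>"
proof -
  have clos: "x + y \<in> car A" "c *\<^sub>C x \<in> car A" "bk A x y \<in> car A"
    if "x \<in> car A" "y \<in> car A" for x y c
    using closed that by (auto simp: lie_closed_def cvs.subspace_add cvs.subspace_scale)
  have "(\<forall>x\<in>car A. \<forall>y\<in>car A. \<sigma> (x + y) v = \<sigma> x v + \<sigma> y v \<and> \<sigma> (bk A x y) v = \<sigma> x (\<sigma> y v) - \<sigma> y (\<sigma> x v))
    \<and> (\<forall>c. \<forall>x\<in>car A. \<sigma> (c *\<^sub>C x) v = c *\<^sub>C \<sigma> x v)"
    if "v \<in> cvs.span (\<Union>\<M>)" for v
    using that
  proof (induction rule: cvs.span_induct_alt)
    case base
    show ?case using clos by (simp add: cvp.linear_0[OF lin])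
  next
    case (step c u w)
    then obtain N where "lie_module A N \<sigma>" "u \<in> N" using mod by auto
    then have u: "\<forall>x\<in>car A. \<forall>y\<in>car A. \<sigma> (x + y) u = \<sigma> x u + \<sigma> y u \<and> \<sigma> (bk A x y) u = \<sigma> x (\<sigma> y u) - \<sigma> y (\<sigma> x u)"
      "\<forall>c. \<forall>x\<in>car A. \<sigma> (c *\<^sub>C x) u = c *\<^sub>C \<sigma> x u"
      by (auto simp: lie_module_def linear_on_def)
    show ?case
      using u step.IH clos
      by (simp add: cvp.linear_add[OF lin] cvp.linear_scale[OF lin] scaleC_add_right
          cvs.scale_right_diff_distrib scaleC_scaleC mult.commute)
  qed
  then show ?thesis
    using span
    by (auto simp: lie_module_def linear_on_def cvp.linear_add[OF lin] cvp.linear_scale[OF lin])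
qed

lemma submodule_span:
  assumes lin: "\<And>x. x \<in> car A \<Longrightarrow> clin (\<sigma> x)"
    and N: "\<And>N x v. N \<in> \<N> \<Longrightarrow> x \<in> car A \<Longrightarrow> v \<in> N \<Longrightarrow> \<sigma> x v \<in> N"
  shows "submodule A UNIV \<sigma> (cvs.span (\<Union>\<N>))"
proof -
  have "\<sigma> x v \<in> cvs.span (\<Union>\<N>)" if "v \<in> cvs.span (\<Union>\<N>)" "x \<in> car A" for x v
    using that(1)
  proof (induction rule: cvs.span_induct_alt)
    case base
    show ?case using that by (simp add: cvp.linear_0[OF lin] cvs.span_zero)
  next
    case (step c u w)
    then have "\<sigma> x u \<in> cvs.span (\<Union>\<N>)" using N that(2) by (intro cvs.span_base) auto
    with step that(2) show ?case
      by (simp add: cvp.linear_add[OF lin] cvp.linear_scale[OF lin] cvs.span_add cvs.span_scale)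
  qed
  then show ?thesis by (auto simp: submodule_def)
qed

lemma irreducible_subset_or_disjoint:
  assumes irr: "irreducible_module A N \<sigma>" and C: "submodule A UNIV \<sigma> C"
  shows "N \<subseteq> C \<or> N \<inter> C = {0}"
proof -
  have "submodule A N \<sigma> (N \<inter> C)"
    using assms by (auto simp: submodule_def irreducible_module_def lie_module_def cvs.subspace_inter)
  then have "N \<inter> C = {0} \<or> N \<inter> C = N" using irr by (auto simp: irreducible_module_def)
  then show ?thesis by auto
qed

section \<open>Finite, not necessarily direct sums of irreducible modules\<close>

locale semisimple_family =
  fixes A :: "'a::complex_vector_space lie_alg" and \<sigma> :: "'a \<Rightarrow> 'm::complex_vector_space \<Rightarrow> 'm"
    and \<M> :: "'m set set"
  assumes lin: "\<And>x. x \<in> car A \<Longrightarrow> clin (\<sigma> x)"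
    and fin: "finite \<M>"
    and irr: "\<And>M. M \<in> \<M> \<Longrightarrow> irreducible_module A M \<sigma>"
    and span: "cvs.span (\<Union>\<M>) = UNIV"
begin

lemma submodule_span_irreducible:
  assumes "\<And>N. N \<in> \<N> \<Longrightarrow> irreducible_module A N \<sigma>"
  shows "submodule A UNIV \<sigma> (cvs.span (\<Union>\<N>))"
  using assms lin by (intro submodule_span) (auto simp: irreducible_module_def lie_module_def)

text \<open>In a spanning subfamily of least cardinality no member meets the span of the others: by
  irreducibility it would be contained in that span and could be dropped.\<close>

lemma ex_direct_subfamily: "\<exists>\<N>\<subseteq>\<M>. internal_direct_sum UNIV \<N>"
proof -
  define P where "P = (\<lambda>\<N>. \<N> \<subseteq> \<M> \<and> cvs.span (\<Union>\<N>) = UNIV)"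
  have "P \<M>" using span by (simp add: P_def)
  from ex_has_least_nat[of P, OF this, where m = card]
  obtain \<N> where "P \<N> \<and> (\<forall>\<N>'. P \<N>' \<longrightarrow> card \<N> \<le> card \<N>')" ..
  then have \<N>: "P \<N>" and min: "\<And>\<N>'. P \<N>' \<Longrightarrow> card \<N> \<le> card \<N>'" by auto
  have "N \<inter> cvs.span (\<Union>(\<N> - {N})) = {0}" if "N \<in> \<N>" for N
  proof (rule ccontr)
    assume "N \<inter> cvs.span (\<Union>(\<N> - {N})) \<noteq> {0}"
    moreover have "submodule A UNIV \<sigma> (cvs.span (\<Union>(\<N> - {N})))"
      using \<N> by (intro submodule_span_irreducible irr) (auto simp: P_def)
    ultimately have "N \<subseteq> cvs.span (\<Union>(\<N> - {N}))"
      using irreducible_subset_or_disjoint[OF irr[of N]] \<N> that by (auto simp: P_def)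
    moreover have "\<Union>(\<N> - {N}) \<subseteq> cvs.span (\<Union>(\<N> - {N}))" by (rule cvs.span_superset)
    moreover have "\<Union>\<N> \<subseteq> N \<union> \<Union>(\<N> - {N})" by auto
    ultimately have "\<Union>\<N> \<subseteq> cvs.span (\<Union>(\<N> - {N}))" by (meson Un_least order_trans)
    then have "cvs.span (\<Union>\<N>) \<subseteq> cvs.span (\<Union>(\<N> - {N}))" by (intro cvs.span_minimal) auto
    then have "P (\<N> - {N})" using \<N> by (auto simp: P_def)
    then have "card \<N> \<le> card (\<N> - {N})" by (rule min)
    moreover have "finite \<N>" using \<N> fin by (auto simp: P_def intro: finite_subset)
    ultimately show False using that by (metis card_Diff1_less not_less)
  qed
  moreover have "cvs.subspace N" if "N \<in> \<N>" for N
    using irr[of N] that \<N> by (auto simp: P_def irreducible_module_def lie_module_def)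
  ultimately show ?thesis using \<N> by (auto simp: internal_direct_sum_def P_def)
qed

text \<open>A non-zero vector of an irreducible \<open>M\<close> involves finitely many summands,
  and irreducibility puts all of \<open>M\<close> into their span. So finitely many summands already
  span the module, and any further one would lie in the span of the others and be zero.\<close>

lemma finite_decomposition:
  assumes "irreducible_decomposition A UNIV \<sigma> \<N>"
  shows "finite \<N>"
proof -
  have irrN: "\<And>N. N \<in> \<N> \<Longrightarrow> irreducible_module A N \<sigma>" and dir: "internal_direct_sum UNIV \<N>"
    using assms by (auto simp: irreducible_decomposition_def)
  have "\<exists>\<F>\<subseteq>\<N>. finite \<F> \<and> M \<subseteq> cvs.span (\<Union>\<F>)" if "M \<in> \<M>" for M
  proof -
    have "M \<noteq> {0}" "0 \<in> M"
      using irr[OF that] by (auto simp: irreducible_module_def lie_module_def cvs.subspace_0)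
    then obtain u where u: "u \<in> M" "u \<noteq> 0" by auto
    have "u \<in> cvs.span (\<Union>\<N>)" using dir by (auto simp: internal_direct_sum_def)
    then obtain t r where t: "finite t" "t \<subseteq> \<Union>\<N>" and ueq: "u = (\<Sum>a\<in>t. r a *\<^sub>C a)"
      by (auto simp: cvs.span_explicit)
    from t obtain \<F> where \<F>: "finite \<F>" "\<F> \<subseteq> \<N>" "t \<subseteq> \<Union>\<F>" by (rule finite_subset_Union)
    then have "u \<in> cvs.span (\<Union>\<F>)"
      unfolding ueq by (intro cvs.span_sum cvs.span_scale cvs.span_base) auto
    moreover have "submodule A UNIV \<sigma> (cvs.span (\<Union>\<F>))"
      using \<F> by (intro submodule_span_irreducible irrN) auto
    ultimately have "M \<subseteq> cvs.span (\<Union>\<F>)"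
      using irreducible_subset_or_disjoint[OF irr[OF that]] u by blast
    with \<F> show ?thesis by auto
  qed
  then obtain \<F> where \<F>: "\<And>M. M \<in> \<M> \<Longrightarrow> \<F> M \<subseteq> \<N> \<and> finite (\<F> M) \<and> M \<subseteq> cvs.span (\<Union>(\<F> M))"
    by metis
  define \<G> where "\<G> = (\<Union>M\<in>\<M>. \<F> M)"
  have \<G>: "finite \<G>" "\<G> \<subseteq> \<N>" using \<F> fin by (auto simp: \<G>_def)
  have "\<Union>\<M> \<subseteq> cvs.span (\<Union>\<G>)"
  proof
    fix x assume "x \<in> \<Union>\<M>"
    then obtain M where "M \<in> \<M>" "x \<in> M" by auto
    then have "x \<in> cvs.span (\<Union>(\<F> M))" using \<F> by auto
    also have "\<dots> \<subseteq> cvs.span (\<Union>\<G>)"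
      using \<open>M \<in> \<M>\<close> by (intro cvs.span_mono) (auto simp: \<G>_def)
    finally show "x \<in> cvs.span (\<Union>\<G>)" .
  qed
  then have full: "cvs.span (\<Union>\<G>) = UNIV"
    using cvs.span_minimal[OF _ cvs.subspace_span] span by blast
  have "\<N> \<subseteq> \<G>"
  proof
    fix N assume "N \<in> \<N>"
    show "N \<in> \<G>"
    proof (rule ccontr)
      assume "N \<notin> \<G>"
      then have "cvs.span (\<Union>\<G>) \<subseteq> cvs.span (\<Union>(\<N> - {N}))"
        using \<G> by (intro cvs.span_mono) auto
      moreover have "N \<inter> cvs.span (\<Union>(\<N> - {N})) = {0}"
        using dir \<open>N \<in> \<N>\<close> by (auto simp: internal_direct_sum_def)
      ultimately have "N = {0}" using full by auto
      then show False using irrN[OF \<open>N \<in> \<N>\<close>] by (simp add: irreducible_module_def)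
    qed
  qed
  then show ?thesis using \<G> by (blast intro: finite_subset)
qed

text \<open>A summand not contained in the complement of a component projects isomorphically onto it.\<close>

lemma component_iso:
  assumes "irreducible_component A UNIV \<sigma> N"
  shows "\<exists>M\<in>\<M>. module_iso A M \<sigma> N \<sigma>"
proof -
  obtain \<N> where irrN: "\<And>N. N \<in> \<N> \<Longrightarrow> irreducible_module A N \<sigma>"
    and dir: "internal_direct_sum UNIV \<N>" and N: "N \<in> \<N>"
    using assms by (auto simp: irreducible_component_def irreducible_decomposition_def)
  define C where "C = cvs.span (\<Union>(\<N> - {N}))"
  have C: "cvs.subspace C" and NC: "N \<inter> C = {0}" and subN: "cvs.subspace N"
    using dir N by (auto simp: C_def internal_direct_sum_def)
  have subC: "submodule A UNIV \<sigma> C"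
    unfolding C_def by (intro submodule_span_irreducible irrN) auto
  have "N \<noteq> {0}" using irrN[OF N] by (simp add: irreducible_module_def)
  have "\<exists>M\<in>\<M>. \<not> M \<subseteq> C"
  proof (rule ccontr)
    assume "\<not> ?thesis"
    then have "cvs.span (\<Union>\<M>) \<subseteq> C" using C by (intro cvs.span_minimal) auto
    with span NC \<open>N \<noteq> {0}\<close> show False by auto
  qed
  then obtain M where M: "M \<in> \<M>" "\<not> M \<subseteq> C" by auto
  then have MC: "M \<inter> C = {0}" using irreducible_subset_or_disjoint[OF irr subC] by blast
  have subM: "cvs.subspace M" and closM: "\<And>x v. x \<in> car A \<Longrightarrow> v \<in> M \<Longrightarrow> \<sigma> x v \<in> M"
    using irr[OF M(1)] by (auto simp: irreducible_module_def lie_module_def)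
  have closN: "\<And>x v. x \<in> car A \<Longrightarrow> v \<in> N \<Longrightarrow> \<sigma> x v \<in> N"
    using irrN[OF N] by (auto simp: irreducible_module_def lie_module_def)
  have closC: "\<And>x v. x \<in> car A \<Longrightarrow> v \<in> C \<Longrightarrow> \<sigma> x v \<in> C" using subC by (auto simp: submodule_def)
  have ex: "\<exists>n. n \<in> N \<and> v - n \<in> C" for v
  proof -
    have "v \<in> cvs.span (\<Union>\<N>)" using dir by (auto simp: internal_direct_sum_def)
    then show ?thesis
    proof (induction rule: cvs.span_induct_alt)
      case base
      show ?case using cvs.subspace_0[OF C] cvs.subspace_0[OF subN] by (intro exI[of _ 0]) auto
    next
      case (step c x y)
      then obtain n where n: "n \<in> N" "y - n \<in> C" by auto
      show ?case
      proof (cases "x \<in> N")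
        case True
        with n show ?thesis
          by (intro exI[of _ "c *\<^sub>C x + n"])
            (auto intro: cvs.subspace_add[OF subN] cvs.subspace_scale[OF subN])
      next
        case False
        with step have "x \<in> C" unfolding C_def by (intro cvs.span_base) auto
        with n cvs.subspace_add[OF C cvs.subspace_scale[OF C, of x c], of "y - n"] show ?thesis
          by (intro exI[of _ n]) (auto simp: algebra_simps)
      qed
    qed
  qed
  have uniq: "n = n'" if "n \<in> N" "v - n \<in> C" "n' \<in> N" "v - n' \<in> C" for v n n'
  proof -
    have "n - n' \<in> N" using that by (simp add: cvs.subspace_diff[OF subN])
    moreover have "n - n' \<in> C"
      using cvs.subspace_diff[OF C that(4) that(2)] by simp
    ultimately have "n - n' \<in> {0}" using NC by blast
    then show ?thesis by simp
  qed
  \<comment> \<open>Projection onto \<open>N\<close> along \<open>C\<close>. It is equivariant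
    because both subspaces are stable under the action. Its kernel is \<open>C\<close>, so
    \<open>MC\<close> gives injectivity on \<open>M\<close>.\<close>
  define pr where "pr v = (THE n. n \<in> N \<and> v - n \<in> C)" for v
  have pr: "pr v = n" if "n \<in> N" "v - n \<in> C" for v n
    unfolding pr_def using that uniq by blast
  have prN: "pr v \<in> N" and prC: "v - pr v \<in> C" for v
    using ex[of v] pr by auto
  have pr_add: "pr (u + v) = pr u + pr v" for u v
    using cvs.subspace_add[OF C prC[of u] prC[of v]]
    by (intro pr cvs.subspace_add[OF subN] prN) (simp add: algebra_simps)
  have pr_scale: "pr (c *\<^sub>C v) = c *\<^sub>C pr v" for c v
    using cvs.subspace_scale[OF C prC[of v], of c]
    by (intro pr cvs.subspace_scale[OF subN] prN) (simp add: cvs.scale_right_diff_distrib)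
  have pr_lin: "clin pr" by (intro clinI pr_add pr_scale)
  have pr_act: "pr (\<sigma> x v) = \<sigma> x (pr v)" if "x \<in> car A" for x v
    using closC[OF that prC[of v]] that
    by (intro pr closN prN) (auto simp: cvp.linear_diff[OF lin])
  have "inj_on pr M"
  proof (rule inj_onI)
    fix u v assume uv: "u \<in> M" "v \<in> M" "pr u = pr v"
    then have "pr (u - v) = 0" by (simp add: cvp.linear_diff[OF pr_lin])
    then have "u - v \<in> C" using prC[of "u - v"] by simp
    moreover have "u - v \<in> M" using uv by (simp add: cvs.subspace_diff[OF subM])
    ultimately have "u - v \<in> {0}" using MC by blast
    then show "u = v" by simp
  qed
  moreover have "pr ` M = N"
  proof -
    have "submodule A N \<sigma> (pr ` M)"
      unfolding submodule_def
    proof (intro conjI ballI)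
      show "cvs.subspace (pr ` M)" by (rule cvp.linear_subspace_image[OF pr_lin subM])
      show "pr ` M \<subseteq> N" using prN by auto
      fix x v assume x: "x \<in> car A" and "v \<in> pr ` M"
      then obtain u where "u \<in> M" "v = pr u" by auto
      then have "\<sigma> x v = pr (\<sigma> x u)" "\<sigma> x u \<in> M" using x closM pr_act by auto
      then show "\<sigma> x v \<in> pr ` M" by auto
    qed
    then have "pr ` M = {0} \<or> pr ` M = N"
      using irrN[OF N] by (auto simp: irreducible_module_def)
    moreover have "pr ` M \<noteq> {0}"
    proof
      assume "pr ` M = {0}"
      then have "M \<subseteq> C" using prC by (metis (no_types) diff_zero imageI singletonD subsetI)
      with M show False by simp
    qed
    ultimately show ?thesis by blast
  qed
  ultimately have "module_iso A M \<sigma> N \<sigma>"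
    unfolding module_iso_def
    by (intro exI[of _ pr]) (auto simp: bij_betw_def pr_act intro: linear_on_UNIV_imp[OF pr_lin])
  with M show ?thesis by auto
qed

end

section \<open>Isomorphisms of modules on subspaces\<close>

lemma module_iso_trans:
  assumes "module_iso A M \<rho> M' \<rho>'" "module_iso A M' \<rho>' M'' \<rho>''"
  shows "module_iso A M \<rho> M'' \<rho>''"
proof -
  obtain f g where f: "linear_on M f" "bij_betw f M M'"
      "\<And>x v. x \<in> car A \<Longrightarrow> v \<in> M \<Longrightarrow> f (\<rho> x v) = \<rho>' x (f v)"
    and g: "linear_on M' g" "bij_betw g M' M''"
      "\<And>x v. x \<in> car A \<Longrightarrow> v \<in> M' \<Longrightarrow> g (\<rho>' x v) = \<rho>'' x (g v)"
    using assms by (auto simp: module_iso_def)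
  have "f v \<in> M'" if "v \<in> M" for v using f(2) that by (auto simp: bij_betw_def)
  with f g show ?thesis
    unfolding module_iso_def
    by (intro exI[of _ "g \<circ> f"]) (auto simp: linear_on_def intro: bij_betw_trans)
qed

lemma module_iso_sym:
  assumes "module_iso A M \<rho> M' \<rho>'" "cvs.subspace M" "\<And>x v. x \<in> car A \<Longrightarrow> v \<in> M \<Longrightarrow> \<rho> x v \<in> M"
  shows "module_iso A M' \<rho>' M \<rho>"
proof -
  obtain f where f: "linear_on M f" "bij_betw f M M'"
      "\<And>x v. x \<in> car A \<Longrightarrow> v \<in> M \<Longrightarrow> f (\<rho> x v) = \<rho>' x (f v)"
    using assms by (auto simp: module_iso_def)
  define g where "g = inv_into M f"
  have g: "bij_betw g M' M" unfolding g_def by (rule bij_betw_inv_into[OF f(2)])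
  have gf: "g (f v) = v" if "v \<in> M" for v
    using that f(2) by (auto simp: g_def bij_betw_def)
  have M': "M' = f ` M" using f(2) by (simp add: bij_betw_def)
  have "linear_on M' g"
    unfolding linear_on_def M'
    by (auto simp: gf assms(2) cvs.subspace_add cvs.subspace_scale
        simp flip: linear_on_add[OF f(1)] linear_on_scale[OF f(1)])
  moreover have "g (\<rho>' x w) = \<rho> x (g w)" if "x \<in> car A" "w \<in> M'" for x w
    using that assms(3) unfolding M' by (auto simp: gf simp flip: f(3))
  ultimately show ?thesis using g by (auto simp: module_iso_def)
qed

subsection \<open>Grade shifts\<close>

lemma grade_shift_grade_shift:
  "grade_shift \<gamma> (grade_shift \<delta> \<rho>) = grade_shift (\<gamma> + \<delta>) \<rho>"
  by (auto simp: grade_shift_def fun_eq_iff scaleC_add_left distrib_left sum.distrib add_ac)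

lemma grade_shift_0 [simp]: "grade_shift 0 \<rho> = \<rho>"
  by (auto simp: grade_shift_def fun_eq_iff)

lemma module_iso_grade_shift:
  assumes "module_iso A M \<rho> M' \<rho>'" "cvs.subspace M" "\<And>x v. x \<in> car A \<Longrightarrow> v \<in> M \<Longrightarrow> \<rho> x v \<in> M"
  shows "module_iso A M (grade_shift \<gamma> \<rho>) M' (grade_shift \<gamma> \<rho>')"
proof -
  obtain f where f: "linear_on M f" "bij_betw f M M'"
      "\<And>x v. x \<in> car A \<Longrightarrow> v \<in> M \<Longrightarrow> f (\<rho> x v) = \<rho>' x (f v)"
    using assms by (auto simp: module_iso_def)
  have "f (grade_shift \<gamma> \<rho> x v) = grade_shift \<gamma> \<rho>' x (f v)" if "x \<in> car A" "v \<in> M" for x v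
    using that f(3)[OF that] assms(3)[OF that] cvs.subspace_scale[OF assms(2)]
    by (cases x) (auto simp: grade_shift_def linear_on_add[OF f(1)] linear_on_scale[OF f(1)])
  with f show ?thesis by (auto simp: module_iso_def)
qed

text \<open>Brackets have no derivation part, so \<open>c\<close> is a character of the Lie algebra
  and twisting by it keeps the module axioms. The twist changes each operator by a scalar, which
  does not affect which subspaces are stable.\<close>

lemma irreducible_grade_shift:
  fixes A :: "('g::complex_vector_space, 'n::finite, 'v::complex_vector_space) G_elem lie_alg"
  assumes irr: "irreducible_module A UNIV \<rho>"
    and bk: "\<And>x y. x \<in> car A \<Longrightarrow> y \<in> car A \<Longrightarrow> snd (snd (bk A x y)) = 0"
  shows "irreducible_module A UNIV (grade_shift \<gamma> \<rho>)"
proof -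
  define c where "c = (\<lambda>x :: ('g, 'n, 'v) G_elem. \<Sum>i\<in>UNIV. snd (snd x) (Some i) * \<gamma> $ i)"
  have gs: "grade_shift \<gamma> \<rho> x v = \<rho> x v + c x *\<^sub>C v" for x v
    by (cases x) (auto simp: grade_shift_def c_def)
  have c: "c (x + y) = c x + c y" "c (r *\<^sub>C x) = r * c x" for x y r
    by (simp_all add: c_def scaleC_prod_def distrib_right sum.distrib scaleC_complex_def
        sum_distrib_left mult.assoc)
  have cbk: "c (bk A x y) = 0" if "x \<in> car A" "y \<in> car A" for x y
    using bk[OF that] by (simp add: c_def)
  have mod: "lie_module A UNIV \<rho>" using irr by (simp add: irreducible_module_def)
  then have lin: "linear_on UNIV (\<rho> x)" if "x \<in> car A" for x
    using that by (auto simp: lie_module_def)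
  have "lie_module A UNIV (grade_shift \<gamma> \<rho>)"
    using mod
    by (auto simp: lie_module_def gs linear_on_def c cbk scaleC_add_left scaleC_add_right scaleC_scaleC
        linear_on_add[OF lin] linear_on_scale[OF lin] algebra_simps)
  moreover have "submodule A UNIV \<rho> N" if N: "submodule A UNIV (grade_shift \<gamma> \<rho>) N" for N
    unfolding submodule_def
  proof (intro conjI ballI)
    show sub: "cvs.subspace N" using N by (simp add: submodule_def)
    fix x v assume "x \<in> car A" "v \<in> N"
    then have "(\<rho> x v + c x *\<^sub>C v) - c x *\<^sub>C v \<in> N"
      using N by (intro cvs.subspace_diff[OF sub] cvs.subspace_scale[OF sub]) (auto simp: submodule_def gs)
    then show "\<rho> x v \<in> N" by simp
  qed simp
  ultimately show ?thesis using irr by (auto simp: irreducible_module_def)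
qed

section \<open>Graded structure of the torus module\<close>

lemma pairing_dcoef: "pairing (dcoef i) \<kappa> = of_int (coord \<kappa> i)"
  by (simp add: pairing_def dcoef_def if_distrib[of "\<lambda>c. c * _"] cong: if_cong)

lemma coord_simps [simp]: "coord 0 i = 0" "coord (\<kappa> + \<mu>) i = coord \<kappa> i + coord \<mu> i"
  "coord (- \<kappa>) i = - coord \<kappa> i"
  by (cases i; simp add: coord_def)+

lemma coord_Some: "coord \<kappa> (Some i) = snd \<kappa> $ i"
  by (simp add: coord_def)

lemma sum_option: "(\<Sum>i\<in>UNIV. f i) = f None + (\<Sum>i\<in>(UNIV :: 'n::finite set). f (Some i))"
  by (simp add: UNIV_option_conv sum.reindex)

lemma sum_dcoef: "(\<Sum>i\<in>UNIV. a i *\<^sub>C dcoef i) = (a :: 'n::finite option \<Rightarrow> complex)"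
  by (rule ext) (simp add: sum_fun_apply dcoef_def scaleC_complex_def if_distrib[of "\<lambda>c. _ * c"] cong: if_cong)

lemma lookup_LT_der: "Poly_Mapping.lookup (LT_der a X) \<kappa> = pairing a \<kappa> *\<^sub>C Poly_Mapping.lookup X \<kappa>"
  by (simp add: LT_der_def mapp.rep_eq when_def in_keys_iff)

lemma clin_LT_der: "clin (LT_der a)"
  by (intro clinI poly_mapping_eqI)
    (simp_all add: lookup_LT_der lookup_add lookup_scaleC scaleC_add_right scaleC_scaleC mult.commute)

lemma LT_der_single: "LT_der a (Poly_Mapping.single \<kappa> x) = pairing a \<kappa> *\<^sub>C Poly_Mapping.single \<kappa> x"
  by (rule poly_mapping_eqI) (simp add: lookup_LT_der lookup_scaleC lookup_single when_def)

lemma LT_br_0 [simp]: "LT_br T 0 Y = 0" "LT_br T X 0 = 0"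
  by (simp_all add: LT_br_def)

lemma LT_cocycle_0 [simp]: "LT_cocycle T 0 Y = 0" "LT_cocycle T X 0 = 0"
  by (simp_all add: LT_cocycle_def)

text \<open>Equality of classes means that the difference of representatives is in the span of the
  relations. Here the representatives themselves agree, so the difference is 0.\<close>

lemma clin_kahler_der: "clin (kahler_der a)"
proof (intro clinI)
  fix x y :: "'a kahler" and c
  show "kahler_der a (x + y) = kahler_der a x + kahler_der a y"
  proof (transfer fixing: a)
    fix x y :: "'a deg \<times> 'a option \<Rightarrow>\<^sub>0 complex"
    let ?D = "Poly_Mapping.mapp (\<lambda>(\<kappa>, i) x. pairing a \<kappa> * x)"
    have "?D (x + y) - (?D x + ?D y) = 0"
      by (rule poly_mapping_eqI)
        (simp only: lookup_degree_mult lookup_minus lookup_add, simp add: distrib_left)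
    then show "?D (x + y) - (?D x + ?D y) \<in> cvs.span (range kahler_rel)"
      by (simp only: cvs.span_zero)
  qed
  show "kahler_der a (c *\<^sub>C x) = c *\<^sub>C kahler_der a x"
  proof (transfer fixing: a c)
    fix x :: "'a deg \<times> 'a option \<Rightarrow>\<^sub>0 complex"
    let ?D = "Poly_Mapping.mapp (\<lambda>(\<kappa>, i) x. pairing a \<kappa> * x)"
    have "?D (c *\<^sub>C x) - c *\<^sub>C ?D x = 0"
      by (rule poly_mapping_eqI)
        (simp only: lookup_degree_mult lookup_minus lookup_scaleC, simp add: scaleC_complex_def)
    then show "?D (c *\<^sub>C x) - c *\<^sub>C ?D x \<in> cvs.span (range kahler_rel)"
      by (simp only: cvs.span_zero)
  qed
qed

lemma kahler_der_tK: "kahler_der a (tK \<kappa> i) = pairing a \<kappa> *\<^sub>C tK \<kappa> i"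
proof (transfer fixing: a \<kappa> i)
  let ?D = "Poly_Mapping.mapp (\<lambda>(\<kappa>, i) x. pairing a \<kappa> * x)"
  let ?s = "Poly_Mapping.single (\<kappa>, i) 1 :: 'a deg \<times> 'a option \<Rightarrow>\<^sub>0 complex"
  have "?D ?s - pairing a \<kappa> *\<^sub>C ?s = 0"
    by (rule poly_mapping_eqI)
      (simp only: lookup_degree_mult lookup_minus lookup_scaleC,
        auto simp: scaleC_complex_def lookup_single when_def)
  then show "?D ?s - pairing a \<kappa> *\<^sub>C ?s \<in> cvs.span (range kahler_rel)"
    by (simp only: cvs.span_zero)
qed

lemma kahler_der_zero_left: "kahler_der 0 w = 0"
proof (transfer)
  fix w :: "'a deg \<times> 'a option \<Rightarrow>\<^sub>0 complex"
  let ?D = "Poly_Mapping.mapp (\<lambda>(\<kappa>, i) x. pairing 0 \<kappa> * x)"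
  have "?D w - 0 = 0"
    by (rule poly_mapping_eqI)
      (simp only: lookup_degree_mult lookup_minus, simp add: pairing_def)
  then show "?D w - 0 \<in> cvs.span (range kahler_rel)" by (simp only: cvs.span_zero)
qed

lemma LT_der_zero_left [simp]: "LT_der 0 X = 0"
  by (rule poly_mapping_eqI) (simp add: lookup_LT_der pairing_def)

lemma ZZ_subspace: "cvs.subspace (ZZ T)"
  by (simp add: ZZ_def)

lemmas ZZ_0 [simp] = cvs.subspace_0[OF ZZ_subspace]

lemma tK_in_ZZ: "in_lattice T \<kappa> \<Longrightarrow> tK \<kappa> i \<in> ZZ T"
  unfolding ZZ_def by (rule cvs.span_base) blast

lemma LT_cocycle_in_ZZ: "LT_cocycle T X Y \<in> ZZ T"
  unfolding LT_cocycle_def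
  by (intro cvs.subspace_sum[OF ZZ_subspace])
    (simp add: cvs.subspace_scale[OF ZZ_subspace] cvs.subspace_sum[OF ZZ_subspace] tK_in_ZZ)

text \<open>The two conditions on \<open>h0\<close> place \<open>htilde T\<close> inside the carrier
  and put the derivations into \<open>htilde T\<close>, so weight vectors are also eigenvectors of
  \<open>D\<close>.\<close>

locale torus_module =
  fixes T :: "('g::complex_vector_space, 'n::finite) torus_data"
    and \<rho> :: "('g, 'n) LTt_elem \<Rightarrow> 'v::complex_vector_space \<Rightarrow> 'v"
  assumes lie: "lie_algebra (galg T)"
    and automorphisms: "commuting_automorphisms T"
    and h0_subset: "h0 T \<subseteq> gdeg T 0" and zero_in_h0: "0 \<in> h0 T"
    and irr: "irreducible_module (LTt T) UNIV \<rho>"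
    and weight: "weight_module (htilde T) UNIV \<rho>"
begin

lemma clin_aut: "clin (aut T i)"
  using automorphisms by (simp add: commuting_automorphisms_def linear_on_UNIV_iff)

lemma aut_gbr: "aut T i (gbr T x y) = gbr T (aut T i x) (aut T i y)"
  using automorphisms by (simp add: commuting_automorphisms_def)

lemma zeta_nonzero: "zeta T i \<noteq> 0"
proof
  assume "zeta T i = 0"
  moreover have "zeta T i ^ per T i = 1" "per T i > 0"
    using automorphisms by (auto simp: commuting_automorphisms_def)
  ultimately show False by (simp add: zero_power)
qed

lemma clin_gbr: "clin (gbr T x)" "clin (\<lambda>x. gbr T x y)"
  using lie by (auto simp: lie_algebra_def galg_def linear_on_UNIV_iff)

lemma gdeg_subspace: "cvs.subspace (gdeg T \<kappa>)"
  by (auto simp: gdeg_def cvs.subspace_def cvp.linear_0[OF clin_aut] cvp.linear_add[OF clin_aut]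
      cvp.linear_scale[OF clin_aut] scaleC_add_right scaleC_scaleC mult.commute)

lemma gbr_gdeg: "x \<in> gdeg T \<kappa> \<Longrightarrow> y \<in> gdeg T \<mu> \<Longrightarrow> gbr T x y \<in> gdeg T (\<kappa> + \<mu>)"
  by (auto simp: gdeg_def aut_gbr cvp.linear_scale[OF clin_gbr(1)] cvp.linear_scale[OF clin_gbr(2)]
      scaleC_scaleC power_int_add zeta_nonzero mult.commute)

lemma LT_subspace: "cvs.subspace (LT T)"
  using gdeg_subspace by (auto simp: LT_def cvs.subspace_def lookup_add lookup_scaleC)

lemmas LT_0 [simp] = cvs.subspace_0[OF LT_subspace]

lemma single_in_LT: "x \<in> gdeg T \<kappa> \<Longrightarrow> Poly_Mapping.single \<kappa> x \<in> LT T"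
  by (auto simp: LT_def lookup_single when_def cvs.subspace_0[OF gdeg_subspace])

lemma lookup_in_gdeg: "X \<in> LT T \<Longrightarrow> Poly_Mapping.lookup X \<kappa> \<in> gdeg T \<kappa>"
  unfolding LT_def by blast

lemma LT_br_in_LT: "X \<in> LT T \<Longrightarrow> Y \<in> LT T \<Longrightarrow> LT_br T X Y \<in> LT T"
  unfolding LT_br_def
  by (intro cvs.subspace_sum[OF LT_subspace] single_in_LT gbr_gdeg lookup_in_gdeg)

lemma LT_der_in_LT: "X \<in> LT T \<Longrightarrow> LT_der a X \<in> LT T"
  by (auto simp: LT_def lookup_LT_der cvs.subspace_scale[OF gdeg_subspace])

lemma in_car_LTt: "(X, w, a) \<in> car (LTt T) \<longleftrightarrow> X \<in> LT T \<and> w \<in> ZZ T"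
  by (simp add: LTt_def)

lemma lie_module_LTt: "lie_module (LTt T) UNIV \<rho>"
  using irr by (simp add: irreducible_module_def)

lemma clin_rho: "X \<in> LT T \<Longrightarrow> w \<in> ZZ T \<Longrightarrow> clin (\<rho> (X, w, a))"
  using lie_module_LTt by (simp add: lie_module_def linear_on_UNIV_iff in_car_LTt)

lemma linear_on_rho: "linear_on (car (LTt T)) (\<lambda>x. \<rho> x v)"
  using lie_module_LTt by (simp add: lie_module_def)

lemma rho_add:
  assumes "X \<in> LT T" "Y \<in> LT T" "w \<in> ZZ T" "u \<in> ZZ T"
  shows "\<rho> (X + Y, w + u, a + b) v = \<rho> (X, w, a) v + \<rho> (Y, u, b) v"
  using linear_on_add[OF linear_on_rho, of "(X, w, a)" "(Y, u, b)"] assms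
  by (simp add: in_car_LTt)

lemma rho_scale:
  assumes "X \<in> LT T" "w \<in> ZZ T"
  shows "\<rho> (c *\<^sub>C X, c *\<^sub>C w, c *\<^sub>C a) v = c *\<^sub>C \<rho> (X, w, a) v"
  using linear_on_scale[OF linear_on_rho, of "(X, w, a)" c] assms
  by (simp add: in_car_LTt scaleC_Pair)

lemma rho_zero [simp]: "\<rho> (0, 0, 0) v = 0"
  using rho_scale[of 0 0 0 0 v] by simp

lemma rho_vec_zero [simp]: "X \<in> LT T \<Longrightarrow> w \<in> ZZ T \<Longrightarrow> \<rho> (X, w, a) 0 = 0"
  by (rule cvp.linear_0[OF clin_rho])

lemma rho_split:
  assumes "X \<in> LT T" "w \<in> ZZ T"
  shows "\<rho> (X, w, a) v = \<rho> (X, 0, 0) v + \<rho> (0, w, 0) v + \<rho> (0, 0, a) v"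
  using rho_add[of X 0 0 w 0 0 v] rho_add[of X 0 w 0 0 a v] assms by simp

lemma rho_LT_sum:
  assumes "X \<in> LT T"
  shows "\<rho> (X, 0, 0) v = (\<Sum>\<kappa>\<in>Poly_Mapping.keys X. \<rho> (Poly_Mapping.single \<kappa> (Poly_Mapping.lookup X \<kappa>), 0, 0) v)"
proof -
  have lin: "linear_on (LT T) (\<lambda>X. \<rho> (X, 0, 0) v)"
    using rho_add[of _ _ 0 0 0 0 v] rho_scale[of _ 0 _ 0 v] by (auto simp: linear_on_def)
  show ?thesis
    using linear_on_sum[OF lin LT_subspace, of "Poly_Mapping.keys X"
        "\<lambda>\<kappa>. Poly_Mapping.single \<kappa> (Poly_Mapping.lookup X \<kappa>)"] assms
    by (simp add: sum_single_lookup single_in_LT lookup_in_gdeg)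
qed

lemma linear_on_rho_ZZ: "linear_on (ZZ T) (\<lambda>w. \<rho> (0, w, 0) v)"
  using rho_add[of 0 0 _ _ 0 0 v] rho_scale[of 0 _ _ 0 v] by (auto simp: linear_on_def)

lemma clin_rho_der: "clin (\<lambda>a. \<rho> (0, 0, a) v)"
  using rho_add[of 0 0 0 0] rho_scale[of 0 0] by (intro clinI) auto

lemma rho_der: "\<rho> (0, 0, a) v = (\<Sum>i\<in>UNIV. a i *\<^sub>C \<rho> (0, 0, dcoef i) v)"
  using cvp.linear_sum[OF clin_rho_der, of "\<lambda>i. a i *\<^sub>C dcoef i" UNIV v]
  by (simp add: sum_dcoef cvp.linear_scale[OF clin_rho_der])

lemma rho_bk:
  assumes "X \<in> LT T" "Y \<in> LT T" "w \<in> ZZ T" "u \<in> ZZ T"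
  shows "\<rho> (X, w, a) (\<rho> (Y, u, b) v) - \<rho> (Y, u, b) (\<rho> (X, w, a) v) =
    \<rho> (LT_br T X Y + LT_der a Y - LT_der b X, LT_cocycle T X Y + kahler_der a u - kahler_der b w, 0) v"
proof -
  have "\<forall>x\<in>car (LTt T). \<forall>y\<in>car (LTt T). \<rho> (bk (LTt T) x y) v = \<rho> x (\<rho> y v) - \<rho> y (\<rho> x v)"
    using lie_module_LTt by (simp add: lie_module_def)
  from bspec[OF bspec[OF this, of "(X, w, a)"], of "(Y, u, b)"] show ?thesis
    using assms by (simp add: in_car_LTt) (simp add: LTt_def)
qed

lemma rho_der_bk:
  assumes "X \<in> LT T" "w \<in> ZZ T"
  shows "\<rho> (0, 0, a) (\<rho> (X, w, b) v) - \<rho> (X, w, b) (\<rho> (0, 0, a) v) =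
    \<rho> (LT_der a X, kahler_der a w, 0) v"
  using rho_bk[of 0 X 0 w a b v] assms
  by (simp add: cvp.linear_0[OF clin_LT_der] cvp.linear_0[OF clin_kahler_der])

lemma rho_ZZ_commute:
  assumes "X \<in> LT T" "w \<in> ZZ T" "u \<in> ZZ T"
  shows "\<rho> (0, w, 0) (\<rho> (X, u, 0) v) = \<rho> (X, u, 0) (\<rho> (0, w, 0) v)"
  using rho_bk[of 0 X w u 0 0 v] assms by (simp add: kahler_der_zero_left)

subsection \<open>The weight grading\<close>

text \<open>The derivation \<open>d_0\<close> is left out, since it belongs to \<open>Gbar\<close>
  and the exponents of the loop module record only the degrees for \<open>d_1, ..., d_n\<close>. The
  offset \<open>\<omega>\<close> selects one coset of the integral weights.\<close>

definition wspace :: "complex ^ 'n \<Rightarrow> int ^ 'n \<Rightarrow> 'v set" where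
  "wspace \<omega> k = {v. \<forall>i. \<rho> (0, 0, dcoef (Some i)) v = (\<omega> $ i + of_int (k $ i)) *\<^sub>C v}"

lemma grading_wspace: "grading (wspace \<omega>)"
proof -
  have "inj (\<lambda>k i. \<omega> $ i + of_int (k $ i) :: complex)"
    by (rule injI) (auto simp: fun_eq_iff vec_eq_iff)
  from grading_joint_eigenspaces[OF clin_rho[OF LT_0 ZZ_0] this cvs.subspace_UNIV]
  show ?thesis by (simp add: wspace_def[abs_def])
qed

lemma rho_homogeneous_wspace:
  assumes "X \<in> LT T" "w \<in> ZZ T" "v \<in> wspace \<omega> k"
    and "\<And>i. LT_der (dcoef (Some i)) X = of_int (q $ i) *\<^sub>C X"
      "\<And>i. kahler_der (dcoef (Some i)) w = of_int (q $ i) *\<^sub>C w"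
  shows "\<rho> (X, w, 0) v \<in> wspace \<omega> (k + q)"
proof -
  have "\<rho> (0, 0, dcoef (Some i)) (\<rho> (X, w, 0) v) = (\<omega> $ i + of_int ((k + q) $ i)) *\<^sub>C \<rho> (X, w, 0) v" for i
  proof -
    have "\<rho> (0, 0, dcoef (Some i)) (\<rho> (X, w, 0) v) =
      \<rho> (X, w, 0) (\<rho> (0, 0, dcoef (Some i)) v) + of_int (q $ i) *\<^sub>C \<rho> (X, w, 0) v"
      using rho_der_bk[OF assms(1,2), of "dcoef (Some i)" 0 v] rho_scale[OF assms(1,2), of "of_int (q $ i)" 0 v] assms(4,5)
      by (simp add: algebra_simps)
    then show ?thesis
      using assms(3) by (simp add: wspace_def scaleC_add_left
          cvp.linear_scale[OF clin_rho[OF assms(1,2)]] cvp.linear_add[OF clin_rho[OF assms(1,2)]])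
  qed
  then show ?thesis by (simp add: wspace_def)
qed

lemma rho_der_wspace:
  assumes "v \<in> wspace \<omega> k"
  shows "\<rho> (0, 0, a) v \<in> wspace \<omega> k"
proof -
  have "\<rho> (0, 0, dcoef (Some i)) (\<rho> (0, 0, a) v) = \<rho> (0, 0, a) (\<rho> (0, 0, dcoef (Some i)) v)" for i
    using rho_der_bk[of 0 0 "dcoef (Some i)" a v]
    by (simp add: cvp.linear_0[OF clin_LT_der] cvp.linear_0[OF clin_kahler_der])
  with assms show ?thesis
    by (simp add: wspace_def cvp.linear_scale[OF clin_rho[OF LT_0 ZZ_0]])
qed

text \<open>The element acting splits into pieces homogeneous for \<open>D\<close>: the coefficients
  of \<open>X\<close>, the symbols \<open>tK\<close>, and a derivation of degree 0. Each piece
  carries weight spaces to weight spaces. This holds for any \<open>\<omega>\<close>, so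
  irreducibility leaves only the zero space or everything.\<close>

lemma submodule_wspaces: "submodule (LTt T) UNIV \<rho> (cvs.span (\<Union>k. wspace \<omega> k))"
proof -
  let ?S = "cvs.span (\<Union>k. wspace \<omega> k)"
  have mem: "v \<in> ?S" if "v \<in> wspace \<omega> k" for v k
    using that by (intro cvs.span_base) auto
  have hom: "\<rho> (X, w, a) v \<in> ?S" if X: "X \<in> LT T" and w: "w \<in> ZZ T" and v: "v \<in> wspace \<omega> k" for X w a v k
  proof -
    have "\<rho> (Poly_Mapping.single \<kappa> x, 0, 0) v \<in> ?S" if "x \<in> gdeg T \<kappa>" for \<kappa> x
      by (rule mem[OF rho_homogeneous_wspace[OF single_in_LT[OF that] ZZ_0 v, of "snd \<kappa>"]])
        (simp_all add: LT_der_single pairing_dcoef coord_Some cvp.linear_0[OF clin_kahler_der])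
    then have 1: "\<rho> (X, 0, 0) v \<in> ?S"
      unfolding rho_LT_sum[OF X] by (intro cvs.span_sum) (simp add: lookup_in_gdeg X)
    have tK: "\<rho> (0, tK \<kappa> i, 0) v \<in> ?S" if "in_lattice T \<kappa>" for \<kappa> i
      by (rule mem[OF rho_homogeneous_wspace[OF LT_0 tK_in_ZZ[OF that] v, of "snd \<kappa>"]])
        (simp_all add: kahler_der_tK pairing_dcoef coord_Some cvp.linear_0[OF clin_LT_der])
    have "\<rho> (0, b, 0) v \<in> ?S" if "b \<in> {tK \<kappa> i | \<kappa> i. in_lattice T \<kappa>}" for b
    proof -
      from that obtain \<kappa> i where "b = tK \<kappa> i" "in_lattice T \<kappa>" by blast
      with tK show ?thesis by simp
    qed
    from linear_on_span_mem[OF linear_on_rho_ZZ[unfolded ZZ_def] cvs.subspace_span this w[unfolded ZZ_def]]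
    have "\<rho> (0, w, 0) v \<in> ?S" .
    moreover have "\<rho> (0, 0, a) v \<in> ?S" by (rule mem[OF rho_der_wspace[OF v]])
    ultimately show ?thesis using 1 rho_split[OF X w] by (simp add: cvs.span_add)
  qed
  have "\<rho> (X, w, a) v \<in> ?S" if X: "X \<in> LT T" and w: "w \<in> ZZ T" and v: "v \<in> ?S" for X w a v
    using v
  proof (induction rule: cvs.span_induct_alt)
    case base
    show ?case using X w by (simp add: cvs.span_zero)
  next
    case (step c x y)
    with hom[OF X w] show ?case
      by (auto simp: cvp.linear_add[OF clin_rho[OF X w]] cvp.linear_scale[OF clin_rho[OF X w]]
          intro!: cvs.span_add cvs.span_scale)
  qed
  then show ?thesis by (auto simp: submodule_def in_car_LTt)
qed

lemma htilde_subset: "htilde T \<subseteq> car (LTt T)"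
proof
  fix x assume "x \<in> htilde T"
  then obtain h w a where x: "x = (Poly_Mapping.single 0 h, w, a)" "h \<in> h0 T" "w \<in> cvs.span (range (tK 0))"
    by (auto simp: htilde_def)
  have "cvs.span (range (tK 0)) \<subseteq> ZZ T"
    by (intro cvs.span_minimal[OF _ ZZ_subspace]) (auto intro!: tK_in_ZZ simp: in_lattice_def)
  then show "x \<in> car (LTt T)" using x h0_subset by (auto simp: in_car_LTt single_in_LT)
qed

lemma der_in_htilde: "(0, 0, a) \<in> htilde T"
  using zero_in_h0 by (auto simp: htilde_def intro!: exI[of _ 0] cvs.span_zero)

lemma ex_weight_space:
  "\<exists>\<phi>\<in>dual (htilde T). weight_space (htilde T) UNIV \<rho> \<phi> \<noteq> {0}"
proof (rule ccontr)
  assume "\<not> ?thesis"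
  then have "\<Union> (weight_space (htilde T) UNIV \<rho> ` dual (htilde T)) \<subseteq> {0}" by blast
  then have "cvs.span (\<Union> (weight_space (htilde T) UNIV \<rho> ` dual (htilde T))) \<subseteq> {0}"
    by (intro cvs.span_minimal cvs.subspace_single_0)
  then have "(UNIV :: 'v set) = {0}"
    using weight by (auto simp: weight_module_def internal_direct_sum_def)
  then show False using irr by (simp add: irreducible_module_def)
qed

lemma weight_space_subspace: "cvs.subspace (weight_space (htilde T) UNIV \<rho> \<phi>)"
proof -
  have lin: "clin (\<rho> h)" if "h \<in> htilde T" for h
    using that htilde_subset by (cases h) (auto simp: in_car_LTt intro!: clin_rho)
  show ?thesis
    by (auto simp: weight_space_def cvs.subspace_def cvp.linear_0[OF lin] cvp.linear_add[OF lin]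
        cvp.linear_scale[OF lin] scaleC_add_right scaleC_scaleC mult.commute)
qed

lemma ex_wspace_span: "\<exists>\<omega>. cvs.span (\<Union>k. wspace \<omega> k) = UNIV"
proof -
  obtain \<phi> where ne: "weight_space (htilde T) UNIV \<rho> \<phi> \<noteq> {0}" using ex_weight_space by auto
  have "0 \<in> weight_space (htilde T) UNIV \<rho> \<phi>" by (rule cvs.subspace_0[OF weight_space_subspace])
  with ne obtain v where v: "v \<in> weight_space (htilde T) UNIV \<rho> \<phi>" "v \<noteq> 0" by auto
  \<comment> \<open>The offset is the \<open>D\<close>-weight of \<open>v\<close>, which gives
    \<open>v\<close> degree 0 and makes the span non-zero.\<close>
  define \<omega> where "\<omega> = (\<chi> i. \<phi> (0, 0, dcoef (Some i)))"
  have "v \<in> wspace \<omega> 0"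
    using v(1) der_in_htilde by (auto simp: wspace_def weight_space_def \<omega>_def)
  then have "v \<in> cvs.span (\<Union>k. wspace \<omega> k)" by (intro cvs.span_base) auto
  with submodule_wspaces irr v have "cvs.span (\<Union>k. wspace \<omega> k) = UNIV"
    by (auto simp: irreducible_module_def)
  then show ?thesis ..
qed

subsection \<open>Central operators\<close>

lemma central_clin: "central_operator T \<rho> \<kappa> y \<Longrightarrow> clin y"
  by (simp add: central_operator_def linear_on_UNIV_iff)

lemma central_commute:
  "central_operator T \<rho> \<kappa> y \<Longrightarrow> X \<in> LT T \<Longrightarrow> w \<in> ZZ T \<Longrightarrow> y (\<rho> (X, w, 0) v) = \<rho> (X, w, 0) (y v)"
  by (simp add: central_operator_def)

lemma central_der:
  assumes "central_operator T \<rho> \<kappa> y"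
  shows "\<rho> (0, 0, a) (y v) - y (\<rho> (0, 0, a) v) = pairing a \<kappa> *\<^sub>C y v"
proof -
  note y = central_clin[OF assms]
  have "\<rho> (0, 0, a) (y v) - y (\<rho> (0, 0, a) v) =
    (\<Sum>i\<in>UNIV. a i *\<^sub>C (\<rho> (0, 0, dcoef i) (y v) - y (\<rho> (0, 0, dcoef i) v)))"
    by (subst (1 2) rho_der)
      (simp add: cvp.linear_sum[OF y] cvp.linear_scale[OF y] cvs.scale_right_diff_distrib sum_subtractf)
  also have "\<dots> = (\<Sum>i\<in>UNIV. (a i * of_int (coord \<kappa> i)) *\<^sub>C y v)"
    using assms by (simp add: central_operator_def scaleC_scaleC)
  finally show ?thesis by (simp add: pairing_def cvs.scale_sum_left)
qed

lemma central_rho: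
  assumes "central_operator T \<rho> \<kappa> y" "X \<in> LT T" "w \<in> ZZ T"
  shows "y (\<rho> (X, w, a) v) = \<rho> (X, w, a) (y v) - pairing a \<kappa> *\<^sub>C y v"
proof -
  have "\<rho> (X, w, a) u = \<rho> (X, w, 0) u + \<rho> (0, 0, a) u" for u
    using rho_split[OF assms(2,3), of a u] rho_split[OF assms(2,3), of 0 u] by simp
  then show ?thesis
    using central_der[OF assms(1), of a v] central_commute[OF assms, of v]
    by (simp add: cvp.linear_add[OF central_clin[OF assms(1)]] algebra_simps)
qed

lemma central_id: "central_operator T \<rho> 0 (\<lambda>v. v)"
  by (simp add: central_operator_def linear_on_def)

lemma central_comp:
  assumes x: "central_operator T \<rho> \<kappa> x" and y: "central_operator T \<rho> \<mu> y"
  shows "central_operator T \<rho> (\<kappa> + \<mu>) (\<lambda>v. x (y v))"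
  unfolding central_operator_def linear_on_UNIV_iff
proof (intro conjI ballI allI)
  note lx = central_clin[OF x] and ly = central_clin[OF y]
  show "clin (\<lambda>v. x (y v))"
    by (intro clinI) (simp_all add: cvp.linear_add[OF lx] cvp.linear_add[OF ly]
        cvp.linear_scale[OF lx] cvp.linear_scale[OF ly])
  show "x (y (\<rho> (X, w, 0) v)) = \<rho> (X, w, 0) (x (y v))" if "X \<in> LT T" "w \<in> ZZ T" for X w v
    using that by (simp add: central_commute[OF x] central_commute[OF y])
  show "\<rho> (0, 0, dcoef i) (x (y v)) - x (y (\<rho> (0, 0, dcoef i) v)) =
    of_int (coord (\<kappa> + \<mu>) i) *\<^sub>C x (y v)" for i v
    by (simp add: central_rho[OF x] central_rho[OF y] cvp.linear_diff[OF lx] cvp.linear_scale[OF lx]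
        pairing_dcoef scaleC_add_left)
qed

text \<open>Against a derivation \<open>y\<close> commutes only up to a multiple of \<open>y\<close>
  itself. That is enough for kernel and range to be submodules.\<close>

lemma central_bij:
  assumes y: "central_operator T \<rho> \<kappa> y" and "y \<noteq> 0"
  shows "bij y"
proof -
  note ly = central_clin[OF y]
  have "submodule (LTt T) UNIV \<rho> {v. y v = 0}"
    by (auto simp: submodule_def in_car_LTt cvs.subspace_def cvp.linear_0[OF ly] cvp.linear_add[OF ly]
        cvp.linear_scale[OF ly] central_rho[OF y])
  moreover have "{v. y v = 0} \<noteq> UNIV" using assms(2) by (auto simp: fun_eq_iff)
  ultimately have "{v. y v = 0} = {0}" using irr by (auto simp: irreducible_module_def)
  then have "inj y" unfolding cvp.linear_inj_iff_eq_0[OF ly] by auto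
  have "\<rho> (X, w, a) (y v) = y (\<rho> (X, w, a) v + pairing a \<kappa> *\<^sub>C v)" if "X \<in> LT T" "w \<in> ZZ T" for X w a v
    using that by (simp add: central_rho[OF y] cvp.linear_add[OF ly] cvp.linear_scale[OF ly])
  then have "submodule (LTt T) UNIV \<rho> (range y)"
    using cvp.linear_subspace_image[OF ly cvs.subspace_UNIV] by (auto simp: submodule_def in_car_LTt)
  moreover have "range y \<noteq> {0}"
  proof
    assume r: "range y = {0}"
    have "y v = 0" for v using r rangeI[of y v] by simp
    with assms(2) show False by (auto simp: fun_eq_iff)
  qed
  ultimately have "range y = UNIV" using irr by (auto simp: irreducible_module_def)
  with \<open>inj y\<close> show ?thesis by (simp add: bij_def)
qed

lemma central_inv:
  assumes y: "central_operator T \<rho> \<kappa> y" and "y \<noteq> 0"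
  shows "central_operator T \<rho> (- \<kappa>) (inv y)"
  unfolding central_operator_def linear_on_def
proof (intro conjI ballI allI)
  note ly = central_clin[OF y]
  have bij: "bij y" using assms by (rule central_bij)
  have yi [simp]: "y (inv y v) = v" for v using bij by (simp add: bij_is_surj surj_f_inv_f)
  have iy: "inv y u = v" if "u = y v" for u v using bij that by (simp add: bij_is_inj)
  show "inv y (u + v) = inv y u + inv y v" for u v
    by (rule iy) (simp add: cvp.linear_add[OF ly])
  show "inv y (c *\<^sub>C v) = c *\<^sub>C inv y v" for c v
    by (rule iy) (simp add: cvp.linear_scale[OF ly])
  show "inv y (\<rho> (X, w, 0) v) = \<rho> (X, w, 0) (inv y v)" if "X \<in> LT T" "w \<in> ZZ T" for X w v
    using that by (intro iy) (simp add: central_commute[OF y])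
  have "inv y (\<rho> (0, 0, dcoef i) v) = \<rho> (0, 0, dcoef i) (inv y v) + of_int (coord \<kappa> i) *\<^sub>C inv y v" for i v
    by (rule iy) (simp add: central_rho[OF y] cvp.linear_add[OF ly] cvp.linear_scale[OF ly] pairing_dcoef)
  then show "\<rho> (0, 0, dcoef i) (inv y v) - inv y (\<rho> (0, 0, dcoef i) v) =
    of_int (coord (- \<kappa>) i) *\<^sub>C inv y v" for i v
    by simp
qed

text \<open>In degree 0 the operator commutes with the derivations too, hence preserves each weight
  space. A non-zero one is finite dimensional and starts Schur's lemma.\<close>

lemma central_degree_0_scalar:
  assumes y: "central_operator T \<rho> 0 y"
  shows "\<exists>c. \<forall>v. y v = c *\<^sub>C v"
proof -
  obtain \<phi> where \<phi>: "\<phi> \<in> dual (htilde T)" "weight_space (htilde T) UNIV \<rho> \<phi> \<noteq> {0}"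
    using ex_weight_space by auto
  have comm: "y (\<rho> x v) = \<rho> x (y v)" if "x \<in> car (LTt T)" for x v
    using that by (cases x) (simp add: in_car_LTt central_rho[OF y] pairing_def)
  show ?thesis
  proof (rule schur[OF irr central_clin[OF y] comm weight_space_subspace _ \<phi>(2)])
    show "finite_dim (weight_space (htilde T) UNIV \<rho> \<phi>)"
      using weight \<phi> by (simp add: weight_module_def)
    show "y u \<in> weight_space (htilde T) UNIV \<rho> \<phi>" if "u \<in> weight_space (htilde T) UNIV \<rho> \<phi>" for u
      using that htilde_subset comm[of _ u]
      by (auto simp: weight_space_def cvp.linear_scale[OF central_clin[OF y]] subset_eq
          simp flip: comm)
  qed
qed

text \<open>Composing \<open>x\<close> with the inverse of \<open>y\<close> gives degree 0, where
  operators are scalars.\<close>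

lemma central_unique:
  assumes x: "central_operator T \<rho> \<kappa> x" and y: "central_operator T \<rho> \<kappa> y" and "y \<noteq> 0"
  shows "\<exists>c. x = c *\<^sub>C y"
proof -
  have "central_operator T \<rho> 0 (\<lambda>v. x (inv y v))"
    using central_comp[OF x central_inv[OF y \<open>y \<noteq> 0\<close>]] by simp
  then obtain c where c: "\<And>v. x (inv y v) = c *\<^sub>C v" using central_degree_0_scalar by blast
  have "x v = c *\<^sub>C y v" for v
    using c[of "y v"] central_bij[OF y \<open>y \<noteq> 0\<close>] by (simp add: bij_is_inj)
  then show ?thesis by (auto simp: fun_eq_iff)
qed

lemma central_tK:
  assumes "in_lattice T \<kappa>"
  shows "central_operator T \<rho> \<kappa> (\<rho> (0, tK \<kappa> i, 0))"
  unfolding central_operator_def linear_on_UNIV_iff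
proof (intro conjI ballI allI)
  note Z = tK_in_ZZ[OF assms, of i]
  show "clin (\<rho> (0, tK \<kappa> i, 0))" by (rule clin_rho[OF LT_0 Z])
  show "\<rho> (0, tK \<kappa> i, 0) (\<rho> (X, w, 0) v) = \<rho> (X, w, 0) (\<rho> (0, tK \<kappa> i, 0) v)"
    if "X \<in> LT T" "w \<in> ZZ T" for X w v
    by (rule rho_ZZ_commute[OF that(1) Z that(2)])
  show "\<rho> (0, 0, dcoef j) (\<rho> (0, tK \<kappa> i, 0) v) - \<rho> (0, tK \<kappa> i, 0) (\<rho> (0, 0, dcoef j) v) =
    of_int (coord \<kappa> j) *\<^sub>C \<rho> (0, tK \<kappa> i, 0) v" for j v
    using rho_der_bk[OF LT_0 Z, of "dcoef j" 0 v] rho_scale[OF LT_0 Z, of "of_int (coord \<kappa> j)" 0 v]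
    by (simp add: kahler_der_tK pairing_dcoef cvp.linear_0[OF clin_LT_der])
qed

end

section \<open>The loop module\<close>

locale loop_setting = torus_module T \<rho>
  for T :: "('g::complex_vector_space, 'n::finite) torus_data"
    and \<rho> :: "('g, 'n) LTt_elem \<Rightarrow> 'v::complex_vector_space \<Rightarrow> 'v" +
  fixes l :: "'n \<Rightarrow> nat" and z :: "'n \<Rightarrow> 'v \<Rightarrow> 'v" and W :: "'v set"
    and p :: "'v \<Rightarrow> 'w::complex_vector_space"
  assumes vanish: "\<And>k0 k i. in_lattice T (k0, k) \<Longrightarrow> i \<noteq> None \<or> k0 \<noteq> 0 \<Longrightarrow> \<rho> (0, tK (k0, k) i, 0) = 0"
    and l_pos: "\<And>i. l i > 0"
    and lattice: "subgroup_generated_by (SS T \<rho>) = {k. \<forall>i. int (l i) dvd k $ i}"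
    and z_central: "\<And>i. central_operator T \<rho> (0, axis i (int (l i))) (z i)"
    and W_submodule: "submodule (LL T) UNIV (LL_act \<rho>) W"
    and W_proper: "W \<noteq> UNIV"
    and z_W: "\<And>i v. z i v - v \<in> W"
    and quotient: "is_quotient_map p W"
begin

lemma W_subspace: "cvs.subspace W"
  using W_submodule by (simp add: submodule_def)

lemma rho_W:
  assumes "X \<in> LT T" "v \<in> W"
  shows "\<rho> (X, 0, c *\<^sub>C dcoef None) v \<in> W"
proof -
  have "\<forall>x\<in>car (LL T). \<forall>v\<in>W. LL_act \<rho> x v \<in> W" using W_submodule by (simp add: submodule_def)
  moreover have "(X, 0, c) \<in> car (LL T)" using assms by (simp add: LL_def)
  ultimately have "LL_act \<rho> (X, 0, c) v \<in> W" using assms by blast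
  then show ?thesis by (simp add: LL_act_def)
qed

lemma clin_p: "clin p"
  using quotient by (simp add: is_quotient_map_def linear_on_UNIV_iff)

lemma p_eq_0_iff: "p v = 0 \<longleftrightarrow> v \<in> W"
  using quotient by (auto simp: is_quotient_map_def)

lemma p_surj: "surj p"
  using quotient by (simp add: is_quotient_map_def)

subsection \<open>The operators in \<open>[S]\<close>\<close>

text \<open>Central operators that induce the identity on the quotient. The condition modulo
  \<open>W\<close> removes the scalar ambiguity within a degree, and it is inherited by products and
  inverses.\<close>

definition unit_op :: "int ^ 'n \<Rightarrow> ('v \<Rightarrow> 'v) \<Rightarrow> bool" where
  "unit_op s y \<longleftrightarrow> central_operator T \<rho> (0, s) y \<and> (\<forall>v. y v - v \<in> W)"

lemma unit_op_id: "unit_op 0 (\<lambda>v. v)"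
  using central_id by (simp add: unit_op_def zero_prod_def cvs.subspace_0[OF W_subspace])

lemma unit_op_comp:
  assumes "unit_op s x" "unit_op t y"
  shows "unit_op (s + t) (\<lambda>v. x (y v))"
proof -
  have "central_operator T \<rho> (0, s + t) (\<lambda>v. x (y v))"
    using central_comp[of "(0, s)" x "(0, t)" y] assms by (simp add: unit_op_def)
  moreover have "(x (y v) - y v) + (y v - v) \<in> W" for v
    using assms by (intro cvs.subspace_add[OF W_subspace]) (auto simp: unit_op_def)
  ultimately show ?thesis by (simp add: unit_op_def)
qed

lemma unit_op_nonzero:
  assumes "unit_op s y"
  shows "y \<noteq> 0"
proof
  assume "y = 0"
  then have "- v \<in> W" for v using assms by (auto simp: unit_op_def dest: spec[of _ v])
  then have "v \<in> W" for v using cvs.subspace_neg[OF W_subspace, of "- v"] by simp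
  with W_proper show False by auto
qed

lemma unit_op_inv:
  assumes "unit_op s y"
  shows "unit_op (- s) (inv y)"
proof -
  have y: "central_operator T \<rho> (0, s) y" using assms by (simp add: unit_op_def)
  have "y (inv y v) = v" for v
    using central_bij[OF y unit_op_nonzero[OF assms]] by (simp add: bij_is_surj surj_f_inv_f)
  moreover have "y (inv y v) - inv y v \<in> W" for v using assms by (simp add: unit_op_def)
  ultimately have "v - inv y v \<in> W" for v by simp
  then have "inv y v - v \<in> W" for v
    using cvs.subspace_neg[OF W_subspace, of "v - inv y v"] by simp
  then show ?thesis
    using central_inv[OF y unit_op_nonzero[OF assms]] by (simp add: unit_op_def)
qed

text \<open>Two central operators of one degree differ by a factor \<open>c\<close>. Comparing them
  modulo \<open>W\<close> on a vector outside \<open>W\<close> forces \<open>c = 1\<close>.\<close>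

lemma unit_op_unique:
  assumes "unit_op s x" "unit_op s y"
  shows "x = y"
proof -
  obtain c where c: "x = c *\<^sub>C y"
    using central_unique[of "(0, s)" x y] assms unit_op_nonzero by (auto simp: unit_op_def)
  obtain v where v: "v \<notin> W" using W_proper by auto
  have "x v - v \<in> W" "y v - v \<in> W" using assms by (auto simp: unit_op_def)
  then have "(x v - v) - c *\<^sub>C (y v - v) \<in> W"
    by (rule cvs.subspace_diff[OF W_subspace _ cvs.subspace_scale[OF W_subspace]])
  then have "(c - 1) *\<^sub>C v \<in> W"
    by (simp add: c cvs.scale_right_diff_distrib cvs.scale_left_diff_distrib)
  then have "inverse (c - 1) *\<^sub>C (c - 1) *\<^sub>C v \<in> W" by (rule cvs.subspace_scale[OF W_subspace])
  with v have "c = 1" by (cases "c = 1") (simp_all add: scaleC_scaleC)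
  with c show ?thesis by simp
qed

text \<open>The \<open>z i\<close> are normalised of degree \<open>l i\<close> in the i-th
  coordinate. Their powers, with inverses for negative exponents, are multiplied over the
  coordinates.\<close>

lemma ex_unit_op:
  assumes "\<And>i. int (l i) dvd s $ i"
  shows "\<exists>y. unit_op s y"
proof -
  have nat: "\<exists>y. unit_op (axis i (int m * int (l i))) y" for i m
  proof (induction m)
    case 0
    have "axis i (int 0 * int (l i)) = (0 :: int ^ 'n)" by (simp add: vec_eq_iff axis_def)
    with unit_op_id show ?case by metis
  next
    case (Suc m)
    then obtain y where "unit_op (axis i (int m * int (l i))) y" ..
    moreover have "unit_op (axis i (int (l i))) (z i)"
      using z_central z_W by (simp add: unit_op_def)
    moreover have "axis i (int (Suc m) * int (l i)) =
        (axis i (int (l i)) + axis i (int m * int (l i)) :: int ^ 'n)"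
      by (simp add: vec_eq_iff axis_def algebra_simps)
    ultimately show ?case using unit_op_comp by metis
  qed
  have int: "\<exists>y. unit_op (axis i (s $ i)) y" for i
  proof -
    obtain m where m: "s $ i = int (l i) * m" using assms by (auto simp: dvd_def)
    show ?thesis
    proof (cases "m \<ge> 0")
      case True
      then show ?thesis using nat[of i "nat m"] by (simp add: m mult.commute)
    next
      case False
      then have "axis i (s $ i) = (- axis i (int (nat (- m)) * int (l i)) :: int ^ 'n)"
        by (simp add: m vec_eq_iff axis_def mult.commute)
      moreover obtain y where "unit_op (axis i (int (nat (- m)) * int (l i))) y" using nat by blast
      ultimately show ?thesis using unit_op_inv by metis
    qed
  qed
  have "\<exists>y. unit_op (\<Sum>i\<in>I. axis i (s $ i)) y" for I
  proof (induction I rule: infinite_finite_induct)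
    case (insert i I)
    then obtain x y where "unit_op (axis i (s $ i)) x" "unit_op (\<Sum>i\<in>I. axis i (s $ i)) y"
      using int by blast
    from unit_op_comp[OF this] insert show ?case by auto
  qed (use unit_op_id in auto)
  moreover have "(\<Sum>i\<in>UNIV. axis i (s $ i)) = s"
    by (simp add: vec_eq_iff axis_def cong: if_cong)
  ultimately show ?thesis by metis
qed

text \<open>A central operator of lattice degree is a multiple of the normalised one of that degree.
  Properties of \<open>[S]\<close> can therefore be checked on operators known modulo
  \<open>W\<close>.\<close>

lemma SSspan_eq: "SSspan T \<rho> = cvs.span {y. \<exists>s. (\<forall>i. int (l i) dvd s $ i) \<and> unit_op s y}"
    (is "_ = cvs.span ?U")
proof
  have "y \<in> cvs.span ?U" if y: "central_operator T \<rho> (0, s) y" and s: "\<forall>i. int (l i) dvd s $ i" for y s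
  proof -
    obtain x where x: "unit_op s x" using ex_unit_op s by blast
    then obtain c where "y = c *\<^sub>C x"
      using central_unique[OF y, of x] unit_op_nonzero by (auto simp: unit_op_def)
    moreover have "x \<in> cvs.span ?U" using x s by (intro cvs.span_base) auto
    ultimately show ?thesis by (simp add: cvs.span_scale)
  qed
  then show "SSspan T \<rho> \<subseteq> cvs.span ?U"
    unfolding SSspan_def lattice by (intro cvs.span_minimal) auto
  show "cvs.span ?U \<subseteq> SSspan T \<rho>"
    unfolding SSspan_def lattice by (intro cvs.span_mono) (auto simp: unit_op_def)
qed

lemma SSspan_subspace: "cvs.subspace (SSspan T \<rho>)"
  by (simp add: SSspan_def)

lemma central_in_SSspan:
  "central_operator T \<rho> (0, s) y \<Longrightarrow> (\<And>i. int (l i) dvd s $ i) \<Longrightarrow> y \<in> SSspan T \<rho>"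
  unfolding SSspan_def lattice by (rule cvs.span_base) auto

lemma SSspan_induct [consumes 1, case_names zero add]:
  assumes "A \<in> SSspan T \<rho>" "P 0"
    and "\<And>c s y A. (\<And>i. int (l i) dvd s $ i) \<Longrightarrow> unit_op s y \<Longrightarrow> P A \<Longrightarrow> P (\<lambda>v. c *\<^sub>C y v + A v)"
  shows "P A"
  using assms(1) unfolding SSspan_eq
proof (induction rule: cvs.span_induct_alt)
  case (step c y A)
  then have "P (\<lambda>v. c *\<^sub>C y v + A v)" using assms(3) by blast
  then show ?case by (simp add: plus_fun_def scaleC_fun_def)
qed (rule assms(2))

lemma SSspan_central:
  assumes "A \<in> SSspan T \<rho>"
  shows "clin A \<and> (\<forall>X\<in>LT T. \<forall>w\<in>ZZ T. \<forall>v. A (\<rho> (X, w, 0) v) = \<rho> (X, w, 0) (A v))"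
proof (rule SSspan_induct[OF assms])
  show "clin 0 \<and> (\<forall>X\<in>LT T. \<forall>w\<in>ZZ T. \<forall>v. 0 (\<rho> (X, w, 0) v) = \<rho> (X, w, 0) (0 v))"
    by (auto intro!: clinI)
next
  fix c s y A
  assume "unit_op s y"
    and A: "clin A \<and> (\<forall>X\<in>LT T. \<forall>w\<in>ZZ T. \<forall>v. A (\<rho> (X, w, 0) v) = \<rho> (X, w, 0) (A v))"
  then have y: "central_operator T \<rho> (0, s) y" by (simp add: unit_op_def)
  note ly = central_clin[OF y]
  have "clin (\<lambda>v. c *\<^sub>C y v + A v)"
    using A by (intro clinI) (simp_all add: cvp.linear_add cvp.linear_scale ly scaleC_add_right
        scaleC_scaleC mult.commute)
  then show "clin (\<lambda>v. c *\<^sub>C y v + A v) \<and>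
    (\<forall>X\<in>LT T. \<forall>w\<in>ZZ T. \<forall>v. c *\<^sub>C y (\<rho> (X, w, 0) v) + A (\<rho> (X, w, 0) v) = \<rho> (X, w, 0) (c *\<^sub>C y v + A v))"
    using A by (simp add: central_commute[OF y] cvp.linear_add[OF clin_rho] cvp.linear_scale[OF clin_rho])
qed

lemmas clin_SSspan = SSspan_central[THEN conjunct1]

lemma SSspan_commute_rho:
  "A \<in> SSspan T \<rho> \<Longrightarrow> X \<in> LT T \<Longrightarrow> w \<in> ZZ T \<Longrightarrow> A (\<rho> (X, w, 0) v) = \<rho> (X, w, 0) (A v)"
  using SSspan_central by blast

text \<open>Stability of \<open>W\<close> under \<open>[S]\<close> is not part of the hypothesis on
  \<open>LL\<close>. It holds because a normalised operator moves every vector by an element of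
  \<open>W\<close>.\<close>

lemma SSspan_W:
  assumes "A \<in> SSspan T \<rho>" "v \<in> W"
  shows "A v \<in> W"
  using assms(1)
proof (induction rule: SSspan_induct)
  case zero
  show ?case by (simp add: cvs.subspace_0[OF W_subspace])
next
  case (add c s y A)
  have "(y v - v) + v \<in> W"
    using add assms by (intro cvs.subspace_add[OF W_subspace]) (auto simp: unit_op_def)
  with add show ?case by (simp add: cvs.subspace_add[OF W_subspace] cvs.subspace_scale[OF W_subspace])
qed

text \<open>Both products of two normalised operators are normalised of the same degree, so
  uniqueness makes them equal.\<close>

lemma SSspan_commute:
  assumes "A \<in> SSspan T \<rho>" "B \<in> SSspan T \<rho>"
  shows "A (B v) = B (A v)"
  using assms(2)
proof (induction arbitrary: v rule: SSspan_induct)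
  case zero
  show ?case by (simp add: cvp.linear_0[OF clin_SSspan[OF assms(1)]])
next
  case (add c s y B)
  have "A (y v) = y (A v)" for v
    using assms(1)
  proof (induction arbitrary: v rule: SSspan_induct)
    case zero
    have "clin y" using \<open>unit_op s y\<close> central_clin by (auto simp: unit_op_def)
    then show ?case by (simp add: cvp.linear_0)
  next
    case (add c t x A)
    have "(\<lambda>v. x (y v)) = (\<lambda>v. y (x v))"
      using unit_op_comp[OF \<open>unit_op t x\<close> \<open>unit_op s y\<close>] unit_op_comp[OF \<open>unit_op s y\<close> \<open>unit_op t x\<close>]
      by (intro unit_op_unique) (auto simp: add.commute)
    moreover have "clin y" using \<open>unit_op s y\<close> central_clin by (auto simp: unit_op_def)
    ultimately show ?case using add.IH by (simp add: fun_eq_iff cvp.linear_add cvp.linear_scale)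
  qed
  with add show ?case
    using clin_SSspan[OF assms(1)] by (simp add: cvp.linear_add cvp.linear_scale)
qed

text \<open>By \<open>vanish\<close> a symbol that acts non-trivially is
  \<open>tK (0, k) None\<close> with \<open>k\<close> in \<open>SS\<close>. The central terms in the
  bracket of \<open>G\<close> are thus elements of \<open>[S]\<close>.\<close>

lemma rho_ZZ_in_SSspan:
  assumes "w \<in> ZZ T"
  shows "\<rho> (0, w, 0) \<in> SSspan T \<rho>"
proof -
  have lin: "linear_on (ZZ T) (\<lambda>w. \<rho> (0, w, 0))"
    using linear_on_rho_ZZ by (simp add: linear_on_def fun_eq_iff)
  have "\<rho> (0, b, 0) \<in> SSspan T \<rho>" if "b \<in> {tK \<kappa> i | \<kappa> i. in_lattice T \<kappa>}" for b
  proof -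
    from that obtain \<kappa> i where b: "b = tK \<kappa> i" "in_lattice T \<kappa>" by blast
    obtain k0 k where \<kappa>: "\<kappa> = (k0, k)" by (cases \<kappa>)
    show ?thesis
    proof (cases "\<rho> (0, b, 0) = 0")
      case True
      then show ?thesis using cvs.subspace_0[OF SSspan_subspace] by simp
    next
      case False
      then have i: "i = None" "k0 = 0" using vanish[of k0 k i] b \<kappa> by auto
      then have "k \<in> SS T \<rho>" using False b \<kappa> by (simp add: SS_def)
      then have "k \<in> subgroup_generated_by (SS T \<rho>)" by (auto simp: subgroup_generated_by_def)
      then have "int (l i) dvd k $ i" for i unfolding lattice by simp
      then show ?thesis using central_tK[OF b(2), of i] b \<kappa> i by (intro central_in_SSspan) auto
    qed
  qed
  from linear_on_span_mem[OF lin[unfolded ZZ_def] SSspan_subspace this assms[unfolded ZZ_def]]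
  show ?thesis .
qed

lemma clin_op_der: "clin (op_der \<rho> a)"
  by (intro clinI)
    (auto simp: op_der_def fun_eq_iff cvp.linear_add[OF clin_rho[OF LT_0 ZZ_0]]
      cvp.linear_scale[OF clin_rho[OF LT_0 ZZ_0]] cvs.scale_right_diff_distrib)

lemma op_der_unit_op:
  assumes "unit_op s y"
  shows "op_der \<rho> a y = pairing a (0, s) *\<^sub>C y"
  using assms central_der by (auto simp: op_der_def unit_op_def fun_eq_iff)

lemma op_der_in_SSspan:
  assumes "A \<in> SSspan T \<rho>"
  shows "op_der \<rho> a A \<in> SSspan T \<rho>"
proof (rule linear_on_span_mem[OF linear_on_UNIV_imp[OF clin_op_der] SSspan_subspace _ assms[unfolded SSspan_eq]])
  fix y assume "y \<in> {y. \<exists>s. (\<forall>i. int (l i) dvd s $ i) \<and> unit_op s y}"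
  then obtain s where s: "\<And>i. int (l i) dvd s $ i" "unit_op s y" by auto
  then have "y \<in> SSspan T \<rho>" by (intro central_in_SSspan[of s]) (auto simp: unit_op_def)
  with s show "op_der \<rho> a y \<in> SSspan T \<rho>"
    by (simp add: op_der_unit_op cvs.subspace_scale[OF SSspan_subspace])
qed

subsection \<open>The algebra \<open>G\<close> and its action on \<open>V\<close>\<close>

abbreviation "G \<equiv> G_alg T \<rho>"

lemma in_car_G: "(X, A, a) \<in> car G \<longleftrightarrow> X \<in> LT T \<and> A \<in> SSspan T \<rho>"
  by (simp add: G_alg_def)

lemma bk_G: "bk G (X, A, a) (Y, B, b) =
    (LT_br T X Y + LT_der a Y - LT_der b X,
     \<rho> (0, LT_cocycle T X Y, 0) + op_der \<rho> a B - op_der \<rho> b A, 0)"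
  by (simp add: G_alg_def)

lemma car_G_subspace: "cvs.subspace (car G)"
  using LT_subspace SSspan_subspace
  by (auto simp: cvs.subspace_def G_alg_def zero_prod_def scaleC_prod_def)

lemma bk_G_in_car: "x \<in> car G \<Longrightarrow> y \<in> car G \<Longrightarrow> bk G x y \<in> car G"
  by (cases x; cases y)
    (auto simp: in_car_G bk_G
      intro!: cvs.subspace_add[OF LT_subspace] cvs.subspace_diff[OF LT_subspace]
        cvs.subspace_add[OF SSspan_subspace] cvs.subspace_diff[OF SSspan_subspace]
        LT_br_in_LT LT_der_in_LT rho_ZZ_in_SSspan LT_cocycle_in_ZZ op_der_in_SSspan)

lemma lie_closed_G: "lie_closed G"
  using car_G_subspace bk_G_in_car by (simp add: lie_closed_def)

lemma G_act_eq: "G_act \<rho> (X, A, a) v = \<rho> (X, 0, a) v + A v"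
  by (simp add: G_act_def)

lemma rho_SSspan_commutator:
  assumes "X \<in> LT T" "A \<in> SSspan T \<rho>"
  shows "\<rho> (X, 0, a) (A v) = A (\<rho> (X, 0, a) v) + op_der \<rho> a A v"
  using rho_split[OF assms(1) ZZ_0, of a] SSspan_commute_rho[OF assms(2,1) ZZ_0, of v] assms
  by (simp add: op_der_def cvp.linear_add[OF clin_SSspan])

text \<open>\<open>[S]\<close> is commutative and commutes with \<open>LT\<close>, so in a
  commutator its elements meet only the derivations, which gives \<open>op_der\<close>. The
  remaining terms come from the bracket of \<open>LTt\<close>, with the cocycle read as an
  operator.\<close>

lemma lie_module_G: "lie_module G UNIV (G_act \<rho>)"
  unfolding lie_module_def linear_on_UNIV_iff
proof (intro conjI ballI)
  show "clin (G_act \<rho> x)" if "x \<in> car G" for x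
    using that by (cases x) (auto intro!: clinI simp: in_car_G G_act_eq cvp.linear_add[OF clin_rho]
        cvp.linear_scale[OF clin_rho] cvp.linear_add[OF clin_SSspan] cvp.linear_scale[OF clin_SSspan]
        scaleC_add_right)
  show "linear_on (car G) (\<lambda>x. G_act \<rho> x v)" for v
    using rho_add[of _ _ 0 0 _ _ v] rho_scale[of _ 0 _ _ v]
    by (auto simp: linear_on_def in_car_G G_act_eq scaleC_Pair scaleC_add_right split_paired_all)
  fix x y v
  assume "x \<in> car G" "y \<in> car G"
  then obtain X A a Y B b where x: "x = (X, A, a)" "X \<in> LT T" "A \<in> SSspan T \<rho>"
    and y: "y = (Y, B, b)" "Y \<in> LT T" "B \<in> SSspan T \<rho>"
    by (cases x; cases y) (auto simp: in_car_G)
  have "LT_br T X Y + LT_der a Y - LT_der b X \<in> LT T"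
    using x y by (intro cvs.subspace_add[OF LT_subspace] cvs.subspace_diff[OF LT_subspace] LT_br_in_LT LT_der_in_LT)
  from rho_split[OF this LT_cocycle_in_ZZ[of T X Y], of 0 v]
  have "\<rho> (X, 0, a) (\<rho> (Y, 0, b) v) - \<rho> (Y, 0, b) (\<rho> (X, 0, a) v) =
    \<rho> (LT_br T X Y + LT_der a Y - LT_der b X, 0, 0) v + \<rho> (0, LT_cocycle T X Y, 0) v"
    using rho_bk[OF x(2) y(2) ZZ_0 ZZ_0, of a b v]
    by (simp add: cvp.linear_0[OF clin_kahler_der])
  then show "G_act \<rho> (bk G x y) v = G_act \<rho> x (G_act \<rho> y v) - G_act \<rho> y (G_act \<rho> x v)"
    using x y
    by (simp add: bk_G G_act_eq cvp.linear_add[OF clin_rho] cvp.linear_add[OF clin_SSspan]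
        rho_SSspan_commutator SSspan_commute[of A B])
qed auto

lemma linear_on_G_act: "linear_on (car G) (\<lambda>x. G_act \<rho> x v)"
  using lie_module_G by (simp add: lie_module_def)

lemma clin_G_act: "x \<in> car G \<Longrightarrow> clin (G_act \<rho> x)"
  using lie_module_G by (simp add: lie_module_def linear_on_UNIV_iff)

text \<open>A central element \<open>w\<close> acts as the operator \<open>\<rho> (0, w, 0)\<close>
  of \<open>[S]\<close>, so \<open>G\<close>-submodules are stable under all of
  \<open>LTt\<close>.\<close>

lemma irreducible_G: "irreducible_module G UNIV (G_act \<rho>)"
proof -
  have "submodule (LTt T) UNIV \<rho> N" if N: "submodule G UNIV (G_act \<rho>) N" for N
  proof -
    have "\<rho> (X, w, a) v \<in> N" if "X \<in> LT T" "w \<in> ZZ T" "v \<in> N" for X w a v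
    proof -
      have "G_act \<rho> (X, \<rho> (0, w, 0), a) v \<in> N"
        using N that rho_ZZ_in_SSspan by (auto simp: submodule_def in_car_G)
      then show ?thesis
        using rho_split[of X w a v] rho_split[of X 0 a v] that by (simp add: G_act_eq add_ac)
    qed
    with N show ?thesis by (auto simp: submodule_def in_car_LTt)
  qed
  then show ?thesis using irr lie_module_G by (auto simp: irreducible_module_def)
qed

lemma irreducible_G_shift: "irreducible_module G UNIV (grade_shift \<gamma> (G_act \<rho>))"
  by (rule irreducible_grade_shift[OF irreducible_G]) (auto simp: bk_G)

subsection \<open>The grading of \<open>Gbar\<close>\<close>

lemma car_Gbar: "car (Gbar T \<rho>) = LT T \<times> SSspan T \<rho> \<times> cvs.span {dcoef None}"
  by (simp add: Gbar_def)

lemma Gbar_subset: "car (Gbar T \<rho>) \<subseteq> car G"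
  by (auto simp: car_Gbar G_alg_def)

text \<open>The inner derivation given by \<open>d_i\<close> in closed form. It is linear on the
  whole type, as \<open>grading_joint_eigenspaces\<close> requires.\<close>

definition G_der :: "'n \<Rightarrow> ('g, 'n, 'v) G_elem \<Rightarrow> ('g, 'n, 'v) G_elem" where
  "G_der i = (\<lambda>(X, A, a). (LT_der (dcoef (Some i)) X, op_der \<rho> (dcoef (Some i)) A, 0))"

lemma bk_G_der: "bk G (0, 0, dcoef (Some i)) x = G_der i x"
proof -
  have "op_der \<rho> a 0 = 0" for a by (rule cvp.linear_0[OF clin_op_der])
  moreover have "\<rho> (0, 0, 0) = 0" by (rule ext) simp
  ultimately show ?thesis
    by (cases x) (simp add: bk_G G_der_def cvp.linear_0[OF clin_LT_der])
qed

lemma clin_G_der: "clin (G_der i)"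
  by (intro clinI)
    (auto simp: G_der_def scaleC_Pair split_paired_all cvp.linear_add[OF clin_LT_der]
      cvp.linear_scale[OF clin_LT_der] cvp.linear_add[OF clin_op_der] cvp.linear_scale[OF clin_op_der])

lemma car_Gbar_subspace: "cvs.subspace (car (Gbar T \<rho>))"
  using LT_subspace SSspan_subspace cvs.subspace_span[of "{dcoef None}"]
  by (auto simp: cvs.subspace_def car_Gbar zero_prod_def scaleC_prod_def)

lemma grading_Gbar: "grading (Gbar_deg T \<rho>)"
proof -
  have "inj (\<lambda>k i. of_int (k $ i) :: complex)"
    by (rule injI) (auto simp: fun_eq_iff vec_eq_iff)
  from grading_joint_eigenspaces[OF clin_G_der this car_Gbar_subspace]
  show ?thesis by (simp add: Gbar_deg_def[abs_def] bk_G_der)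
qed

text \<open>The coefficients of \<open>X\<close> and the derivation \<open>d_0\<close> are
  homogeneous. For \<open>[S]\<close> the spanning normalised operators are, being eigenvectors of
  \<open>op_der\<close>.\<close>

lemma Gbar_span: "car (Gbar T \<rho>) \<subseteq> cvs.span (\<Union>k. Gbar_deg T \<rho> k)"
proof
  let ?S = "cvs.span (\<Union>k. Gbar_deg T \<rho> k)"
  fix x assume "x \<in> car (Gbar T \<rho>)"
  then obtain X A a where x: "x = (X, A, a)" "X \<in> LT T" "A \<in> SSspan T \<rho>" "a \<in> cvs.span {dcoef None}"
    by (auto simp: car_Gbar)
  have zero: "(0, 0, 0) = (0 :: ('g, 'n, 'v) G_elem)" by (simp add: zero_prod_def)
  have mem: "y \<in> ?S" if "y \<in> Gbar_deg T \<rho> k" for y k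
    using that by (intro cvs.span_base) auto
  note zeros = cvs.subspace_0[OF LT_subspace] cvs.subspace_0[OF SSspan_subspace] cvs.span_zero
    cvp.linear_0[OF clin_LT_der] cvp.linear_0[OF clin_op_der]
  have "(Poly_Mapping.single \<kappa> (Poly_Mapping.lookup X \<kappa>), 0, 0) \<in> ?S" for \<kappa>
    using lookup_in_gdeg[OF x(2), of \<kappa>]
    by (intro mem[of _ "snd \<kappa>"]) (simp add: Gbar_deg_def bk_G_der G_der_def car_Gbar zeros single_in_LT
        LT_der_single pairing_dcoef coord_Some scaleC_Pair)
  then have "(\<Sum>\<kappa>\<in>Poly_Mapping.keys X. (Poly_Mapping.single \<kappa> (Poly_Mapping.lookup X \<kappa>), 0, 0)) \<in> ?S"
    by (intro cvs.span_sum)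
  also have "(\<Sum>\<kappa>\<in>Poly_Mapping.keys X. (Poly_Mapping.single \<kappa> (Poly_Mapping.lookup X \<kappa>), 0, 0)) =
      ((X, 0, 0) :: ('g, 'n, 'v) G_elem)"
    by (simp add: sum_prod sum_single_lookup)
  finally have 1: "(X, 0, 0) \<in> ?S" .
  have lin: "linear_on (SSspan T \<rho>) (\<lambda>A. (0, A, 0) :: ('g, 'n, 'v) G_elem)"
    by (simp add: linear_on_def scaleC_Pair)
  have "(0, y, 0) \<in> ?S" if "y \<in> {y. \<exists>s. (\<forall>i. int (l i) dvd s $ i) \<and> unit_op s y}" for y
  proof -
    from that obtain s where s: "\<And>i. int (l i) dvd s $ i" "unit_op s y" by auto
    then have "y \<in> SSspan T \<rho>" by (intro central_in_SSspan[of s]) (auto simp: unit_op_def)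
    with s show ?thesis
      by (intro mem[of _ s]) (simp add: Gbar_deg_def bk_G_der G_der_def car_Gbar zeros
          op_der_unit_op pairing_dcoef coord_Some scaleC_Pair)
  qed
  from linear_on_span_mem[OF lin[unfolded SSspan_eq] cvs.subspace_span this x(3)[unfolded SSspan_eq]]
  have 2: "(0, A, 0) \<in> ?S" .
  have 3: "(0, 0, a) \<in> ?S"
    using x(4) by (intro mem[of _ 0]) (simp add: Gbar_deg_def bk_G_der G_der_def car_Gbar zeros zero)
  have "x = (X, 0, 0) + (0, A, 0) + (0, 0, a)" by (simp add: x(1))
  then show "x \<in> ?S" using 1 2 3 by (simp only: cvs.span_add)
qed

lemma Gbar_components_eq: "Gbar_components T \<rho> = components (Gbar_deg T \<rho>)"
  by (rule ext) (simp add: Gbar_components_def components_def)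

lemma Gbar_components_in: "x \<in> car (Gbar T \<rho>) \<Longrightarrow> Poly_Mapping.lookup (Gbar_components T \<rho> x) k \<in> Gbar_deg T \<rho> k"
  unfolding Gbar_components_eq using grading.components_in[OF grading_Gbar] Gbar_span by blast

lemma Gbar_components_sum:
  assumes "x \<in> car (Gbar T \<rho>)"
  shows "G_act \<rho> x v = (\<Sum>k\<in>Poly_Mapping.keys (Gbar_components T \<rho> x).
    G_act \<rho> (Poly_Mapping.lookup (Gbar_components T \<rho> x) k) v)"
proof -
  let ?c = "Gbar_components T \<rho> x"
  have "Poly_Mapping.lookup ?c k \<in> car G" for k
    using Gbar_components_in[OF assms, of k] Gbar_subset by (auto simp: Gbar_deg_def)
  from linear_on_sum[OF linear_on_G_act car_G_subspace this]
  have "G_act \<rho> (\<Sum>k\<in>Poly_Mapping.keys ?c. Poly_Mapping.lookup ?c k) v =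
    (\<Sum>k\<in>Poly_Mapping.keys ?c. G_act \<rho> (Poly_Mapping.lookup ?c k) v)" .
  moreover have "(\<Sum>k\<in>Poly_Mapping.keys ?c. Poly_Mapping.lookup ?c k) = x"
    unfolding Gbar_components_eq using grading.components_sum[OF grading_Gbar] Gbar_span assms by blast
  ultimately show ?thesis by simp
qed

lemma Gbar_deg_wspace:
  assumes x: "x \<in> Gbar_deg T \<rho> k" and v: "v \<in> wspace \<omega> j"
  shows "G_act \<rho> x v \<in> wspace \<omega> (j + k)"
proof -
  have car: "x \<in> car G" "(0, 0, dcoef (Some i)) \<in> car G" for i
    using x Gbar_subset by (auto simp: Gbar_deg_def in_car_G cvs.subspace_0[OF SSspan_subspace])
  have "\<rho> (0, 0, dcoef (Some i)) (G_act \<rho> x v) = (\<omega> $ i + of_int ((j + k) $ i)) *\<^sub>C G_act \<rho> x v" for i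
  proof -
    have "G_act \<rho> (bk G (0, 0, dcoef (Some i)) x) v =
      G_act \<rho> (0, 0, dcoef (Some i)) (G_act \<rho> x v) - G_act \<rho> x (G_act \<rho> (0, 0, dcoef (Some i)) v)"
      using lie_module_G car by (simp add: lie_module_def)
    moreover have "bk G (0, 0, dcoef (Some i)) x = of_int (k $ i) *\<^sub>C x"
      using x by (simp add: Gbar_deg_def)
    ultimately have "\<rho> (0, 0, dcoef (Some i)) (G_act \<rho> x v) =
      G_act \<rho> x (\<rho> (0, 0, dcoef (Some i)) v) + of_int (k $ i) *\<^sub>C G_act \<rho> x v"
      using linear_on_scale[OF linear_on_G_act car(1)] by (simp add: G_act_eq algebra_simps)
    then show ?thesis
      using v by (simp add: wspace_def cvp.linear_scale[OF clin_G_act[OF car(1)]]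
          cvp.linear_add[OF clin_G_act[OF car(1)]] scaleC_add_left)
  qed
  then show ?thesis by (simp add: wspace_def)
qed

text \<open>The derivation part of an element of \<open>Gbar\<close> is a multiple of
  \<open>d_0\<close>, which \<open>LL\<close> contains. The other derivations are not covered by the
  stability of \<open>W\<close> under \<open>LL\<close>.\<close>

lemma Gbar_W:
  assumes "x \<in> car (Gbar T \<rho>)" "v \<in> W"
  shows "G_act \<rho> x v \<in> W"
proof -
  obtain X A a where x: "x = (X, A, a)" "X \<in> LT T" "A \<in> SSspan T \<rho>" "a \<in> cvs.span {dcoef None}"
    using assms(1) by (auto simp: car_Gbar)
  from x(4) obtain c where "a = c *\<^sub>C dcoef None" by (auto simp: cvs.span_singleton)
  with x assms show ?thesis
    by (simp add: G_act_eq cvs.subspace_add[OF W_subspace] rho_W SSspan_W)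
qed

text \<open>The preimage picked by \<open>inv p\<close> differs from \<open>v\<close> by an element
  of \<open>W\<close>, which \<open>Gbar\<close> preserves.\<close>

lemma quot_act_p:
  assumes "x \<in> car (Gbar T \<rho>)"
  shows "quot_act p (G_act \<rho>) x (p v) = p (G_act \<rho> x v)"
proof -
  have lin: "clin (G_act \<rho> x)" using assms Gbar_subset clin_G_act by blast
  have "p (inv p (p v)) = p v" using p_surj by (simp add: surj_f_inv_f)
  then have "inv p (p v) - v \<in> W" by (simp add: cvp.linear_diff[OF clin_p] flip: p_eq_0_iff)
  then have "G_act \<rho> x (inv p (p v) - v) \<in> W" by (rule Gbar_W[OF assms])
  then show ?thesis
    by (simp add: quot_act_def cvp.linear_diff[OF lin] cvp.linear_diff[OF clin_p] flip: p_eq_0_iff)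
qed

lemma clin_quot_act:
  assumes "x \<in> car (Gbar T \<rho>)"
  shows "clin (quot_act p (G_act \<rho>) x)"
proof (intro clinI)
  have lin: "clin (G_act \<rho> x)" using assms Gbar_subset clin_G_act by blast
  note lin_simps = quot_act_p[OF assms] cvp.linear_add[OF lin] cvp.linear_add[OF clin_p]
    cvp.linear_scale[OF lin] cvp.linear_scale[OF clin_p]
  fix u w c
  obtain u' w' where uw: "u = p u'" "w = p w'" using p_surj by (metis surjD)
  show "quot_act p (G_act \<rho>) x (u + w) = quot_act p (G_act \<rho>) x u + quot_act p (G_act \<rho>) x w"
    unfolding uw cvp.linear_add[OF clin_p, symmetric] quot_act_p[OF assms] by (simp add: lin_simps)
  show "quot_act p (G_act \<rho>) x (c *\<^sub>C u) = c *\<^sub>C quot_act p (G_act \<rho>) x u"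
    unfolding uw cvp.linear_scale[OF clin_p, symmetric] quot_act_p[OF assms] by (simp add: lin_simps)
qed

subsection \<open>Embeddings of \<open>V\<close> into the loop module\<close>

lemma Gbar_part_in:
  assumes "(X, A, a) \<in> car G"
  shows "(X, A, a None *\<^sub>C dcoef None) \<in> car (Gbar T \<rho>)"
  using assms by (simp add: in_car_G car_Gbar cvs.span_base cvs.span_scale)

lemma Gbar_components_car:
  assumes "(X, A, a) \<in> car G"
  shows "Poly_Mapping.lookup (Gbar_components T \<rho> (X, A, a None *\<^sub>C dcoef None)) k \<in> car (Gbar T \<rho>)"
  using Gbar_components_in[OF Gbar_part_in[OF assms], of k] by (simp add: Gbar_deg_def)

lemma clin_loop_act:
  assumes "x \<in> car G"
  shows "clin (loop_act T \<rho> p \<alpha> x)"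
proof -
  obtain X A a where x: "x = (X, A, a)" by (cases x)
  let ?c = "Gbar_components T \<rho> (X, A, a None *\<^sub>C dcoef None)"
  have 1: "clin (\<lambda>F. \<Sum>r\<in>Poly_Mapping.keys F. Poly_Mapping.single (r + k)
      (quot_act p (G_act \<rho>) (Poly_Mapping.lookup ?c k) (Poly_Mapping.lookup F r)))" for k
  proof (rule clin_keys_sum)
    fix r
    have q: "clin (quot_act p (G_act \<rho>) (Poly_Mapping.lookup ?c k))"
      using Gbar_components_car assms x by (intro clin_quot_act) simp
    show "clin (\<lambda>u. Poly_Mapping.single (r + k) (quot_act p (G_act \<rho>) (Poly_Mapping.lookup ?c k) u))"
      by (intro clinI) (simp_all add: cvp.linear_add[OF q] cvp.linear_scale[OF q]
          cvp.linear_add[OF clin_single] cvp.linear_scale[OF clin_single])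
  qed
  have 2: "clin (\<lambda>F. \<Sum>r\<in>Poly_Mapping.keys F. Poly_Mapping.single r
      ((\<Sum>i\<in>UNIV. a (Some i) * (of_int (r $ i) + \<alpha> $ i)) *\<^sub>C Poly_Mapping.lookup F r :: 'w))"
    by (intro clin_keys_sum clinI)
      (simp_all add: scaleC_add_right scaleC_scaleC mult.commute cvp.linear_add[OF clin_single] scaleC_single)
  show ?thesis
    unfolding x loop_act_def Let_def case_prod_conv
    by (intro cvp.linear_compose_add cvp.linear_compose_sum ballI 1 2)
qed

definition base_weight :: "complex ^ 'n" where
  "base_weight = (SOME \<omega>. cvs.span (\<Union>k. wspace \<omega> k) = UNIV)"

abbreviation "V \<equiv> wspace base_weight"

lemma span_V: "cvs.span (\<Union>k. V k) = UNIV"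
  unfolding base_weight_def using someI_ex[OF ex_wspace_span] .

definition emb :: "int ^ 'n \<Rightarrow> 'v \<Rightarrow> ((int ^ 'n) \<Rightarrow>\<^sub>0 'w)" where
  "emb r v = (\<Sum>k\<in>Poly_Mapping.keys (components V v).
     Poly_Mapping.single (k + r) (p (Poly_Mapping.lookup (components V v) k)))"

lemma clin_emb: "clin (emb r)"
proof -
  have lin: "clin (\<lambda>f::(int ^ 'n) \<Rightarrow>\<^sub>0 'v. \<Sum>k\<in>Poly_Mapping.keys f.
      Poly_Mapping.single (k + r) (p (Poly_Mapping.lookup f k)))"
    by (intro clin_keys_sum clinI)
      (simp_all add: cvp.linear_add[OF clin_p] cvp.linear_scale[OF clin_p]
        cvp.linear_add[OF clin_single] scaleC_single)
  have comp: "clin (components V)"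
    using grading.linear_on_components[OF grading_wspace, of base_weight]
    by (simp add: span_V linear_on_UNIV_iff)
  show ?thesis
    unfolding emb_def
    by (intro clinI) (simp_all add: cvp.linear_add[OF comp] cvp.linear_scale[OF comp]
        cvp.linear_add[OF lin] cvp.linear_scale[OF lin])
qed

lemma emb_homogeneous:
  assumes "v \<in> V k"
  shows "emb r v = Poly_Mapping.single (k + r) (p v)"
  using assms
  by (cases "v = 0")
    (simp_all add: emb_def grading.components_homogeneous[OF grading_wspace] cvp.linear_0[OF clin_p])

text \<open>On \<open>V k\<close> the derivation \<open>d_i\<close> acts by
  \<open>base_weight $ i + k $ i\<close>; on the image, in exponent \<open>k + r\<close>, it acts by
  \<open>k $ i + r $ i + \<alpha> $ i\<close>. The difference does not depend on \<open>k\<close>,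
  so one grade shift makes \<open>emb r\<close> equivariant.\<close>

definition shift :: "complex ^ 'n \<Rightarrow> int ^ 'n \<Rightarrow> complex ^ 'n" where
  "shift \<alpha> r = (\<chi> i. of_int (r $ i) + \<alpha> $ i - base_weight $ i)"

lemma loop_act_single:
  assumes "(X, A, a) \<in> car G"
  shows "loop_act T \<rho> p \<alpha> (X, A, a) (Poly_Mapping.single r u) =
    (let x = Gbar_components T \<rho> (X, A, a None *\<^sub>C dcoef None) in
       \<Sum>k\<in>Poly_Mapping.keys x. Poly_Mapping.single (r + k)
         (quot_act p (G_act \<rho>) (Poly_Mapping.lookup x k) u)) +
    Poly_Mapping.single r ((\<Sum>i\<in>UNIV. a (Some i) * (of_int (r $ i) + \<alpha> $ i)) *\<^sub>C u)"
proof (cases "u = 0")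
  \<comment> \<open>The zero vector has no key, so the action collapses by itself and the right-hand
    side must be seen to vanish.\<close>
  case True
  have "quot_act p (G_act \<rho>) (Poly_Mapping.lookup (Gbar_components T \<rho> (X, A, a None *\<^sub>C dcoef None)) k) 0 = 0" for k
    by (rule cvp.linear_0[OF clin_quot_act[OF Gbar_components_car[OF assms]]])
  with True show ?thesis by (simp add: loop_act_def)
qed (simp add: loop_act_def Let_def)

lemma loop_act_emb_homogeneous:
  assumes x: "x \<in> car G" and v: "v \<in> V j"
  shows "loop_act T \<rho> p \<alpha> x (emb r v) = emb r (grade_shift (shift \<alpha> r) (G_act \<rho>) x v)"
proof -
  obtain X A a where xeq: "x = (X, A, a)" by (cases x)
  let ?x = "(X, A, a None *\<^sub>C dcoef None)"
  let ?c = "Gbar_components T \<rho> ?x"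
  have car: "(X, A, a) \<in> car G" and bar: "?x \<in> car (Gbar T \<rho>)"
    using x Gbar_part_in by (auto simp: xeq)
  have X: "X \<in> LT T" using x by (simp add: xeq in_car_G)
  let ?e = "\<Sum>i\<in>UNIV. a (Some i) * (base_weight $ i + of_int (j $ i))"
  \<comment> \<open>Only \<open>d_0\<close> stays with the \<open>Gbar\<close> part. The other
    derivations act on \<open>v\<close> by the scalar \<open>?e\<close>.\<close>
  have split: "G_act \<rho> (X, A, a) v = G_act \<rho> ?x v + (\<Sum>i\<in>UNIV. a (Some i) *\<^sub>C \<rho> (0, 0, dcoef (Some i)) v)"
  proof -
    have "\<rho> (0, 0, a None *\<^sub>C dcoef None) v = a None *\<^sub>C \<rho> (0, 0, dcoef None) v"
      by (rule cvp.linear_scale[OF clin_rho_der])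
    then show ?thesis
      using rho_split[OF X ZZ_0, of a v] rho_split[OF X ZZ_0, of "a None *\<^sub>C dcoef None" v] rho_der[of a v]
      by (simp add: G_act_eq sum_option)
  qed
  have "(\<Sum>i\<in>UNIV. a (Some i) *\<^sub>C \<rho> (0, 0, dcoef (Some i)) v) = ?e *\<^sub>C v"
    using v by (simp add: wspace_def scaleC_scaleC cvs.scale_sum_left)
  then have act: "G_act \<rho> (X, A, a) v = (\<Sum>k\<in>Poly_Mapping.keys ?c. G_act \<rho> (Poly_Mapping.lookup ?c k) v) + ?e *\<^sub>C v"
    by (simp only: split Gbar_components_sum[OF bar, of v])
  \<comment> \<open>A component of degree \<open>k\<close> moves \<open>V j\<close> to
    \<open>V (j + k)\<close>, so \<open>emb r\<close> puts its value at exponent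
    \<open>j + k + r\<close>, where the loop action puts it too.\<close>
  have "emb r (G_act \<rho> (Poly_Mapping.lookup ?c k) v) =
      Poly_Mapping.single (j + r + k) (quot_act p (G_act \<rho>) (Poly_Mapping.lookup ?c k) (p v))" for k
    using emb_homogeneous[OF Gbar_deg_wspace[OF Gbar_components_in[OF bar] v]]
    by (simp add: quot_act_p Gbar_components_car[OF car] add_ac)
  \<comment> \<open>The eigenvalue on \<open>V j\<close> plus the grade shift is the eigenvalue
    prescribed by the loop action at exponent \<open>j + r\<close>.\<close>
  moreover have "?e + (\<Sum>i\<in>UNIV. a (Some i) * shift \<alpha> r $ i) =
      (\<Sum>i\<in>UNIV. a (Some i) * (of_int ((j + r) $ i) + \<alpha> $ i))"
    by (simp add: shift_def algebra_simps flip: sum.distrib)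
  ultimately show ?thesis
    by (simp add: xeq emb_homogeneous[OF v] loop_act_single[OF car] grade_shift_def act Let_def
        cvp.linear_add[OF clin_emb] cvp.linear_sum[OF clin_emb] cvp.linear_scale[OF clin_emb]
        add.assoc scaleC_single flip: scaleC_add_left)
qed

lemma loop_act_emb:
  assumes x: "x \<in> car G"
  shows "loop_act T \<rho> p \<alpha> x (emb r v) = emb r (grade_shift (shift \<alpha> r) (G_act \<rho>) x v)"
proof -
  have act: "clin (grade_shift (shift \<alpha> r) (G_act \<rho>) x)"
    using irreducible_G_shift x by (simp add: irreducible_module_def lie_module_def linear_on_UNIV_iff)
  note lin = clin_loop_act[OF x] clin_emb act
  have "v \<in> cvs.span (\<Union>k. V k)" by (simp add: span_V)
  then show ?thesis
  proof (induction rule: cvs.span_induct_alt)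
    case base
    show ?case by (simp add: cvp.linear_0[OF lin(1)] cvp.linear_0[OF lin(2)] cvp.linear_0[OF lin(3)])
  next
    case (step c u w)
    then show ?case
      using loop_act_emb_homogeneous[OF x]
      by (auto simp: cvp.linear_add[OF lin(1)] cvp.linear_add[OF lin(2)] cvp.linear_add[OF lin(3)]
          cvp.linear_scale[OF lin(1)] cvp.linear_scale[OF lin(2)] cvp.linear_scale[OF lin(3)])
  qed
qed

text \<open>If \<open>emb r\<close> were zero, \<open>p\<close> would vanish on every
  \<open>V k\<close>, and these span \<open>V\<close>; then \<open>W\<close> would be
  everything.\<close>

lemma emb_nonzero: "\<exists>v. emb r v \<noteq> 0"
proof (rule ccontr)
  assume "\<not> ?thesis"
  then have zero: "emb r v = 0" for v by auto
  have "p v = 0" if "v \<in> V k" for v k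
  proof -
    have "Poly_Mapping.lookup (Poly_Mapping.single (k + r) (p v)) (k + r) = 0"
      using emb_homogeneous[OF that, of r] zero by simp
    then show ?thesis by simp
  qed
  then have "(\<Union>k. V k) \<subseteq> W" by (auto simp: p_eq_0_iff)
  then have "cvs.span (\<Union>k. V k) \<subseteq> W" by (intro cvs.span_minimal W_subspace)
  with span_V W_proper show False by auto
qed

text \<open>The map does not involve \<open>\<alpha>\<close>, so any value provides a target action;
  0 is taken.\<close>

lemma inj_emb: "inj (emb r)"
  by (rule irreducible_inj[OF irreducible_G_shift clin_emb emb_nonzero,
        where \<sigma> = "loop_act T \<rho> p 0"])
    (auto simp: loop_act_emb[of _ 0] cvp.linear_0[OF clin_loop_act])

lemma irreducible_emb: "irreducible_module G (range (emb r)) (loop_act T \<rho> p \<alpha>)"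
  by (rule irreducible_range[OF lie_closed_G irreducible_G_shift clin_emb inj_emb])
    (simp add: loop_act_emb)

lemma module_iso_emb:
  "module_iso G UNIV (grade_shift (shift \<alpha> r) (G_act \<rho>)) (range (emb r)) (loop_act T \<rho> p \<alpha>)"
  unfolding module_iso_def
  by (intro exI[of _ "emb r"])
    (auto simp: linear_on_UNIV_iff clin_emb loop_act_emb inj_emb intro!: inj_on_imp_bij_betw)

section \<open>Finitely many embedded copies of \<open>V\<close> fill the loop module\<close>

definition reps :: "(int ^ 'n) set" where
  "reps = {r. \<forall>i. 0 \<le> r $ i \<and> r $ i < int (l i)}"

lemma finite_reps: "finite reps"
proof -
  have "finite (vec_lambda ` (\<Pi>\<^sub>E i\<in>(UNIV :: 'n set). {0..<int (l i)}))"
    by (intro finite_imageI finite_PiE) auto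
  moreover have "reps \<subseteq> vec_lambda ` (\<Pi>\<^sub>E i\<in>(UNIV :: 'n set). {0..<int (l i)})"
  proof
    fix r :: "int ^ 'n" assume "r \<in> reps"
    then show "r \<in> vec_lambda ` (\<Pi>\<^sub>E i\<in>(UNIV :: 'n set). {0..<int (l i)})"
      by (intro image_eqI[of _ _ "\<lambda>i. r $ i"]) (auto simp: reps_def)
  qed
  ultimately show ?thesis by (rule finite_subset[rotated])
qed

text \<open>The unit operators identify \<open>p ` V k\<close> with \<open>p ` V (k + s)\<close> for \<open>s\<close> in the lattice, so the
  finitely many representatives suffice.\<close>

lemma span_emb: "cvs.span (\<Union>r\<in>reps. range (emb r)) = UNIV"
proof -
  let ?S = "cvs.span (\<Union>r\<in>reps. range (emb r))"
  have hom: "Poly_Mapping.single k (p v) \<in> ?S" if v: "v \<in> V j" for k j v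
  proof -
    \<comment> \<open>To reach exponent \<open>k\<close> from degree \<open>j\<close>, the
      difference \<open>k - j\<close> is split into a residue \<open>r\<close> and a lattice vector
      \<open>s\<close>. A normalised operator of degree \<open>s\<close> moves \<open>v\<close> to
      degree \<open>j + s = k - r\<close> without changing its class, and \<open>emb r\<close>
      supplies the rest.\<close>
    define r where "r = (\<chi> i. (k $ i - j $ i) mod int (l i))"
    define s where "s = k - j - r"
    have r: "r \<in> reps" using l_pos by (simp add: reps_def r_def)
    have "int (l i) dvd s $ i" for i by (simp add: s_def r_def minus_mod_eq_mult_div)
    then obtain y where y: "unit_op s y" using ex_unit_op by blast
    then have cy: "central_operator T \<rho> (0, s) y" by (simp add: unit_op_def)
    have "y v \<in> V (j + s)"
    proof -
      have "\<rho> (0, 0, dcoef (Some i)) (y v) = y (\<rho> (0, 0, dcoef (Some i)) v) + of_int (s $ i) *\<^sub>C y v" for i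
        using central_der[OF cy, of "dcoef (Some i)" v] by (simp add: pairing_dcoef coord_Some algebra_simps)
      with v show ?thesis
        by (simp add: wspace_def cvp.linear_scale[OF central_clin[OF cy]]
            cvp.linear_add[OF central_clin[OF cy]] scaleC_add_left)
    qed
    then have "emb r (y v) = Poly_Mapping.single k (p (y v))"
      by (simp add: emb_homogeneous s_def)
    also have "p (y v) = p v"
    proof -
      have "p (y v - v) = 0" using y by (simp add: p_eq_0_iff unit_op_def)
      then show ?thesis by (simp add: cvp.linear_diff[OF clin_p])
    qed
    finally have "Poly_Mapping.single k (p v) = emb r (y v)" ..
    then show ?thesis using r by (auto intro!: cvs.span_base)
  qed
  have "Poly_Mapping.single k (p v) \<in> ?S" for k v
  proof -
    have lin: "clin (\<lambda>v. Poly_Mapping.single k (p v))"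
      by (intro clinI) (simp_all add: cvp.linear_add[OF clin_p] cvp.linear_scale[OF clin_p]
          cvp.linear_add[OF clin_single] scaleC_single)
    have mem: "Poly_Mapping.single k (p b) \<in> ?S" if "b \<in> (\<Union>k. V k)" for b
      using that by (elim UN_E) (rule hom)
    have "v \<in> cvs.span (\<Union>k. V k)" by (simp add: span_V)
    from linear_on_span_mem[OF linear_on_UNIV_imp[OF lin] cvs.subspace_span mem this]
    show ?thesis .
  qed
  then have "Poly_Mapping.single k u \<in> ?S" for k u
    using surjD[OF p_surj, of u] by auto
  then have "cvs.span {Poly_Mapping.single k u | k u. True} \<subseteq> ?S"
    by (intro cvs.span_minimal) auto
  then show ?thesis unfolding span_singles by auto
qed

lemma semisimple_loop: "semisimple_family G (loop_act T \<rho> p \<alpha>) ((\<lambda>r. range (emb r)) ` reps)"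
  by (intro semisimple_family.intro clin_loop_act finite_imageI finite_reps)
    (auto simp: irreducible_emb span_emb)

text \<open>Each image of \<open>V\<close> satisfies the module axioms by transport, and the images
  span.\<close>

lemma lie_module_loop: "lie_module G UNIV (loop_act T \<rho> p \<alpha>)"
  using span_emb irreducible_emb
  by (intro lie_module_span[OF lie_closed_G clin_loop_act, where \<M> = "(\<lambda>r. range (emb r)) ` reps"])
    (auto simp: irreducible_module_def)

text \<open>One decomposition serves all \<open>\<alpha>\<close>, so \<open>\<alpha>\<close> can later be adapted to a chosen summand.\<close>

lemma ex_decomposition:
  "\<exists>\<N>\<subseteq>(\<lambda>r. range (emb r)) ` reps. \<forall>\<alpha>. irreducible_decomposition G UNIV (loop_act T \<rho> p \<alpha>) \<N>"
proof -
  obtain \<N> where \<N>: "\<N> \<subseteq> (\<lambda>r. range (emb r)) ` reps" "internal_direct_sum UNIV \<N>"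
    using semisimple_family.ex_direct_subfamily[OF semisimple_loop] by blast
  then have "irreducible_decomposition G UNIV (loop_act T \<rho> p \<alpha>) \<N>" for \<alpha>
    using irreducible_emb by (auto simp: irreducible_decomposition_def)
  with \<N> show ?thesis by blast
qed

lemma completely_reducible_loop: "completely_reducible G UNIV (loop_act T \<rho> p \<alpha>)"
  using ex_decomposition lie_module_loop by (metis completely_reducible_def)

section \<open>Comparison of arbitrary components with grade shifts of \<open>V\<close>\<close>

lemma component_iso_V:
  assumes "irreducible_component G UNIV (loop_act T \<rho> p \<alpha>) N"
  obtains r where "module_iso G UNIV (grade_shift (shift \<alpha> r) (G_act \<rho>)) N (loop_act T \<rho> p \<alpha>)"
  using semisimple_family.component_iso[OF semisimple_loop assms] module_iso_trans[OF module_iso_emb] by blast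

lemma components_iso:
  assumes "irreducible_component G UNIV (loop_act T \<rho> p \<alpha>) N"
    and "irreducible_component G UNIV (loop_act T \<rho> p \<alpha>) N'"
  shows "iso_up_to_grade_shift G N (loop_act T \<rho> p \<alpha>) N' (loop_act T \<rho> p \<alpha>)"
proof -
  obtain r where r: "module_iso G UNIV (grade_shift (shift \<alpha> r) (G_act \<rho>)) N (loop_act T \<rho> p \<alpha>)"
    using component_iso_V[OF assms(1)] .
  obtain r' where r': "module_iso G UNIV (grade_shift (shift \<alpha> r') (G_act \<rho>)) N' (loop_act T \<rho> p \<alpha>)"
    using component_iso_V[OF assms(2)] .
  \<comment> \<open>Both components are grade shifts of \<open>V\<close>. Shifting the second by the
    difference turns its shift into that of the first.\<close>
  let ?\<gamma> = "shift \<alpha> r - shift \<alpha> r'"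
  have "module_iso G N (loop_act T \<rho> p \<alpha>) UNIV (grade_shift (shift \<alpha> r) (G_act \<rho>))"
    by (rule module_iso_sym[OF r]) auto
  moreover have "module_iso G UNIV (grade_shift ?\<gamma> (grade_shift (shift \<alpha> r') (G_act \<rho>)))
      N' (grade_shift ?\<gamma> (loop_act T \<rho> p \<alpha>))"
    by (rule module_iso_grade_shift[OF r']) auto
  ultimately show ?thesis
    unfolding iso_up_to_grade_shift_def grade_shift_grade_shift using module_iso_trans by fastforce
qed

lemma ex_component_iso_V:
  "\<exists>\<alpha> N. irreducible_component G UNIV (loop_act T \<rho> p \<alpha>) N \<and>
     module_iso G N (loop_act T \<rho> p \<alpha>) UNIV (G_act \<rho>)"
proof -
  obtain \<N> where sub: "\<N> \<subseteq> (\<lambda>r. range (emb r)) ` reps"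
    and dec: "\<And>\<alpha>. irreducible_decomposition G UNIV (loop_act T \<rho> p \<alpha>) \<N>"
    using ex_decomposition by blast
  have "\<N> \<noteq> {}"
  proof
    assume "\<N> = {}"
    then have "(UNIV :: ((int ^ 'n) \<Rightarrow>\<^sub>0 'w) set) = {0}"
      using dec by (auto simp: irreducible_decomposition_def internal_direct_sum_def)
    with emb_nonzero show False by blast
  qed
  then obtain r where N: "range (emb r) \<in> \<N>" using sub by auto
  \<comment> \<open>The solution of \<open>shift \<alpha> r = 0\<close>: for this
    \<open>\<alpha>\<close> the chosen summand is \<open>V\<close> itself, not merely a grade shift
    of it.\<close>
  define \<alpha> where "\<alpha> = (\<chi> i. base_weight $ i - of_int (r $ i))"
  have "shift \<alpha> r = 0" by (simp add: shift_def \<alpha>_def vec_eq_iff)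
  then have "module_iso G (range (emb r)) (loop_act T \<rho> p \<alpha>) UNIV (G_act \<rho>)"
    using module_iso_sym[OF module_iso_emb[of \<alpha> r]] by simp
  moreover have "irreducible_component G UNIV (loop_act T \<rho> p \<alpha>) (range (emb r))"
    using dec N by (auto simp: irreducible_component_def)
  ultimately show ?thesis by blast
qed

end

theorem theorem8p6:
  fixes T :: "('g::complex_vector_space, 'n::finite) torus_data"
    and \<rho> :: "('g, 'n) LTt_elem \<Rightarrow> 'v::complex_vector_space \<Rightarrow> 'v"
    and l :: "'n \<Rightarrow> nat"
    and z :: "'n \<Rightarrow> 'v \<Rightarrow> 'v"
    and W :: "'v set"
    and p :: "'v \<Rightarrow> 'w::complex_vector_space"
  assumes "simple_lie_algebra (galg T)" and "finite_dim (UNIV :: 'g set)"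
    and "invariant_form T"
    and "commuting_automorphisms T"
    and "lie_torus T"
    and "irreducible_module (LTt T) UNIV \<rho>" and "weight_module (htilde T) UNIV \<rho>"
    and "\<And>k0 k i. in_lattice T (k0, k) \<Longrightarrow> i \<noteq> None \<or> k0 \<noteq> 0 \<Longrightarrow> \<rho> (0, tK (k0, k) i, 0) = 0"
    and "\<And>i. l i > 0" and "\<And>i. per T (Some i) dvd l i"
    and "subgroup_generated_by (SS T \<rho>) = {k. \<forall>i. int (l i) dvd k $ i}"
    and "\<And>i. central_operator T \<rho> (0, axis i (int (l i))) (z i)" and "\<And>i. z i \<noteq> 0"
    and "maximal_submodule (LL T) UNIV (LL_act \<rho>) W"
    and "\<And>i v. z i v - v \<in> W"
    and "is_quotient_map p W"
    and "irreducible_module (LL T) UNIV (quot_act p (LL_act \<rho>))"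
    and "weight_module (htilde0 T) UNIV (quot_act p (LL_act \<rho>))"
  shows "(\<forall>\<alpha>. completely_reducible (G_alg T \<rho>) UNIV (loop_act T \<rho> p \<alpha>) \<and>
             (\<forall>\<N>. irreducible_decomposition (G_alg T \<rho>) UNIV (loop_act T \<rho> p \<alpha>) \<N> \<longrightarrow> finite \<N>) \<and>
             (\<forall>N N'. irreducible_component (G_alg T \<rho>) UNIV (loop_act T \<rho> p \<alpha>) N \<and>
                     irreducible_component (G_alg T \<rho>) UNIV (loop_act T \<rho> p \<alpha>) N' \<longrightarrow>
                     iso_up_to_grade_shift (G_alg T \<rho>) N (loop_act T \<rho> p \<alpha>) N' (loop_act T \<rho> p \<alpha>))) \<and>
         (\<exists>\<alpha> N. irreducible_component (G_alg T \<rho>) UNIV (loop_act T \<rho> p \<alpha>) N \<and>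
                module_iso (G_alg T \<rho>) N (loop_act T \<rho> p \<alpha>) UNIV (G_act \<rho>))"
proof -
  have "lie_algebra (galg T)" using assms(1) by (simp add: simple_lie_algebra_def)
  moreover have "h0 T \<subseteq> gdeg T 0" "0 \<in> h0 T"
    using assms(5)
    by (auto simp: lie_torus_def cartan_subalgebra_def lie_algebra_def g00_def cvs.subspace_0)
  moreover have "submodule (LL T) UNIV (LL_act \<rho>) W" "W \<noteq> UNIV"
    using assms(14) by (auto simp: maximal_submodule_def)
  ultimately interpret loop_setting T \<rho> l z W p
    using assms by unfold_locales
  show ?thesis
    using completely_reducible_loop components_iso ex_component_iso_V
      semisimple_family.finite_decomposition[OF semisimple_loop] by blast
qed

end
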